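(* Let $m\ge 1$, $n\ge 0$, $m\ne n$, and let $s=(s_1,\dots,s_{m+n})\in(\mathbb C^\times)^{m+n}$ with $\prod_is_i=1$ be generic. Then for every $N\ge0$, $\dim\mathcal B_{m|n,N}(s)\le\dim\mathcal R_{m|n,N}$.
   Context: **Parameters.** Fix $q,d\in\mathbb C^\times$ and set $q_1=q^{-1}d$, $q_2=q^2$, $q_3=q^{-1}d^{-1}$, so $q_1q_2q_3=1$. Assume $q_1^{n_1}q_2^{n_2}q_3^{n_3}=1$ with $n_i\in\mathbb Z$ holds only if $n_1=n_2=n_3$. **The spaces $Sh^0_{m|n,N}$, $n\ge1$.** $Sh^0_{m|n,N}$ is the space of rational functions $F(x_1;\cdots;x_{m+n})$, $x_i=(x_{i,1},\dots,x_{i,N})$ (index $i$ read modulo $m+n$), such that: (1) $F=f/\prod_{i=1}^{m+n}\prod_{1\le a,b\le N}(x_{i,a}-x_{i+1,b})$ with $f$ a Laurent polynomial; (2) $F$ is symmetric in $x_i$ for each $i\ne m,m+n$, and skew-symmetric in $x_m$ and in $x_{m+n}$; (3) (wheel conditions) $f$ vanishes if for some $a,b,c,d$ one of the following holds: (a) $x_{i,b}=q_3x_{i-1,a}$, $x_{i,c}=q_2x_{i,b}$, $1\le i\le m-1$; (b) $x_{i,b}=q_2x_{i,a}$, $x_{i+1,c}=q_3x_{i,b}$, $1\le i\le m-1$; (c) $x_{m,b}=q_3x_{m-1,a}$, $x_{m+1,c}=q_3^{-1}x_{m,b}$, $x_{m,d}=q_1^{-1}x_{m+1,c}$; (d) $x_{i,b}=q_3^{-1}x_{i-1,a}$,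 $x_{i,c}=q_2^{-1}x_{i,b}$, $m+1\le i\le m+n-1$; (e) $x_{i,b}=q_2^{-1}x_{i,a}$, $x_{i+1,c}=q_3^{-1}x_{i,b}$, $m+1\le i\le m+n-1$; (f) $x_{m+n,b}=q_3^{-1}x_{m+n-1,a}$, $x_{1,c}=q_3x_{m+n,b}$, $x_{m+n,d}=q_1x_{1,c}$. **$n=0$.** $Sh^0_{m|0,N}$ is defined in the same way with $m$ colors (mod $m$), $F$ symmetric in every $x_i$, and wheel conditions (a) for $1\le i\le m$ and (b) for $0\le i\le m-1$; for $m=1$ condition (1) reads $F=f(x)/\prod_{1\le a<b\le N}(x_a-x_b)^2$ with $f$ a symmetric Laurent polynomial. **$\mathcal B_{m|n,N}(s)$.** For $F\in Sh^0_{m|n,N}$ and $\mathbf k=(k_1,\dots,k_{m+n})$, $0\le k_i\le N$, let $F_\xi^{\mathbf k}$ be $F$ with $x_{i,a}$ replaced by $\xi x_{i,a}$ for $a\le k_i$ (all $i$), and $F_\infty^{\mathbf k}=\lim_{\xi\to\infty}F_\xi^{\mathbf k}$, $F_0^{\mathbf k}=\lim_{\xi\to0}F_\xi^{\mathbf k}$. $\mathcal B_{m|n,N}(s)$ is the set of $F\in Sh^0_{m|n,N}$ such that for all such $\mathbf k$ both limits exist and $F^{\mathbf k}_\infty=F^{\mathbf k}_0\prod_{i=1}^{m+n}s_i^{k_i}\cdot d^{2N(k_m-k_{m+n})}$ (for $n=0$ the power of $d$ is absent). $s$ is *generic* if $q_1^{a_1}q_2^{a_2}\prod_{i=1}^{m+n-1}s_i^{b_i}=1$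 with $a_i,b_j\in\mathbb Z$ holds only if all $a_i=b_j=0$. $\mathcal R_{m|n}=\mathbb C[T_{i,\nu}\mid1\le i\le m+n,\ \nu\in\mathbb Z_{>0}]$ with $\deg T_{i,\nu}=\nu$, and $\mathcal R_{m|n,N}$ is its degree $N$ component. *)

theory Defs
  imports
    Complex_Main
    "HOL-Library.Function_Algebras"
    "HOL-Library.Poly_Mapping"
    "HOL-Combinatorics.Permutations"
begin

definition q1 :: "complex \<Rightarrow> complex \<Rightarrow> complex" where
  "q1 q d = inverse q * d"

definition q2 :: "complex \<Rightarrow> complex" where
  "q2 q = q ^ 2"

definition q3 :: "complex \<Rightarrow> complex \<Rightarrow> complex" where
  "q3 q d = inverse q * inverse d"

text \<open>
  A point \<open>x\<close> has coordinates \<open>x i a\<close>, where the color \<open>i\<close> ranges over \<open>{1..M}\<close> and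
  \<open>a\<close> over \<open>{1..N}\<close>; the other values of \<open>x\<close> are irrelevant.
  Colors are read modulo \<open>M\<close>, with representatives \<open>1, ..., M\<close>.
\<close>

type_synonym point = "nat \<Rightarrow> nat \<Rightarrow> complex"

definition cyc :: "nat \<Rightarrow> nat \<Rightarrow> nat" where
  "cyc M i = (if i mod M = 0 then M else i mod M)"

definition torus :: "nat \<Rightarrow> nat \<Rightarrow> point set" where
  "torus M N = {x. \<forall>i\<in>{1..M}. \<forall>a\<in>{1..N}. x i a \<noteq> 0}"

definition laurent_polynomial :: "nat \<Rightarrow> nat \<Rightarrow> (point \<Rightarrow> complex) \<Rightarrow> bool" where
  "laurent_polynomial M N f \<longleftrightarrow>
     (\<exists>(S :: (nat \<Rightarrow> nat \<Rightarrow> int) set) c. finite S \<and>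
        f = (\<lambda>x. \<Sum>e\<in>S. c e * (\<Prod>i\<in>{1..M}. \<Prod>a\<in>{1..N}. x i a powi e i a)))"

definition denom :: "nat \<Rightarrow> nat \<Rightarrow> point \<Rightarrow> complex" where
  "denom M N x =
     (if M = 1 then \<Prod>a\<in>{1..N}. \<Prod>b\<in>{a<..N}. (x 1 a - x 1 b) ^ 2
      else \<Prod>i\<in>{1..M}. \<Prod>a\<in>{1..N}. \<Prod>b\<in>{1..N}. (x i a - x (cyc M (i + 1)) b))"

text \<open>
  The rational function \<open>f / denom\<close> is represented by its values on the locus
  \<open>regular_locus\<close> of the torus where the denominator does not vanish, extended by \<open>0\<close>.
  This locus is Zariski dense, so the representation is injective and linear, and
  identities between rational functions can be tested at its points.
\<close>

definition regular_locus :: "nat \<Rightarrow> nat \<Rightarrow> point set" where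
  "regular_locus M N = {x \<in> torus M N. denom M N x \<noteq> 0}"

definition ratfun :: "nat \<Rightarrow> nat \<Rightarrow> (point \<Rightarrow> complex) \<Rightarrow> point \<Rightarrow> complex" where
  "ratfun M N f = (\<lambda>x. if x \<in> regular_locus M N then f x / denom M N x else 0)"

definition symmetric_in :: "nat \<Rightarrow> nat \<Rightarrow> (point \<Rightarrow> complex) \<Rightarrow> bool" where
  "symmetric_in N i F \<longleftrightarrow>
     (\<forall>\<pi> x. \<pi> permutes {1..N} \<longrightarrow> F (x(i := x i \<circ> \<pi>)) = F x)"

definition skew_symmetric_in :: "nat \<Rightarrow> nat \<Rightarrow> (point \<Rightarrow> complex) \<Rightarrow> bool" where
  "skew_symmetric_in N i F \<longleftrightarrow>
     (\<forall>\<pi> x. \<pi> permutes {1..N} \<longrightarrow> F (x(i := x i \<circ> \<pi>)) = of_int (sign \<pi>) * F x)"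

definition on_wheel ::
  "complex \<Rightarrow> complex \<Rightarrow> nat \<Rightarrow> nat \<Rightarrow> point \<Rightarrow> nat \<Rightarrow> nat \<Rightarrow> nat \<Rightarrow> nat \<Rightarrow> bool" where
  "on_wheel q d m n x a b c e \<longleftrightarrow>
     (let X = (\<lambda>i. x (cyc (m + n) i));
          p1 = q1 q d; p2 = q2 q; p3 = q3 q d;
          wheelA = (\<lambda>i. X i b = p3 * X (i - 1) a \<and> X i c = p2 * X i b);
          wheelB = (\<lambda>i. X i b = p2 * X i a \<and> X (i + 1) c = p3 * X i b)
      in if n = 0 then
           (\<exists>i\<in>{1..m}. wheelA i) \<or> (\<exists>i\<in>{0..<m}. wheelB i)
         else
           (\<exists>i\<in>{1..<m}. wheelA i) \<or> (\<exists>i\<in>{1..<m}. wheelB i) \<or>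
           (X m b = p3 * X (m - 1) a \<and> X (m + 1) c = inverse p3 * X m b \<and>
            X m e = inverse p1 * X (m + 1) c) \<or>
           (\<exists>i\<in>{m + 1..<m + n}.
              X i b = inverse p3 * X (i - 1) a \<and> X i c = inverse p2 * X i b) \<or>
           (\<exists>i\<in>{m + 1..<m + n}.
              X i b = inverse p2 * X i a \<and> X (i + 1) c = inverse p3 * X i b) \<or>
           (X (m + n) b = inverse p3 * X (m + n - 1) a \<and> X 1 c = p3 * X (m + n) b \<and>
            X (m + n) e = p1 * X 1 c))"

definition wheel_conditions ::
  "complex \<Rightarrow> complex \<Rightarrow> nat \<Rightarrow> nat \<Rightarrow> nat \<Rightarrow> (point \<Rightarrow> complex) \<Rightarrow> bool" where
  "wheel_conditions q d m n N f \<longleftrightarrow>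
     (\<forall>x\<in>torus (m + n) N.
        (\<exists>a\<in>{1..N}. \<exists>b\<in>{1..N}. \<exists>c\<in>{1..N}. \<exists>e\<in>{1..N}. on_wheel q d m n x a b c e)
        \<longrightarrow> f x = 0)"

definition Sh0 ::
  "complex \<Rightarrow> complex \<Rightarrow> nat \<Rightarrow> nat \<Rightarrow> nat \<Rightarrow> (point \<Rightarrow> complex) set" where
  "Sh0 q d m n N =
     {F. (\<exists>f. laurent_polynomial (m + n) N f \<and> F = ratfun (m + n) N f \<and>
              wheel_conditions q d m n N f) \<and>
         (\<forall>i\<in>{1..m + n}.
            if n \<ge> 1 \<and> (i = m \<or> i = m + n) then skew_symmetric_in N i F
            else symmetric_in N i F)}"

definition scale_point :: "(nat \<Rightarrow> nat) \<Rightarrow> complex \<Rightarrow> point \<Rightarrow> point" where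
  "scale_point k \<xi> x = (\<lambda>i a. if a \<le> k i then \<xi> * x i a else x i a)"

text \<open>
  The limits of the rational function \<open>F (scale_point k \<xi> x)\<close> are taken pointwise on
  \<open>regular_locus\<close>. For such \<open>x\<close> the leading and lowest coefficients in \<open>\<xi>\<close> of the rescaled
  denominator are nonzero, and \<open>scale_point k \<xi> x\<close> is regular for all but finitely many
  \<open>\<xi>\<close>; hence the pointwise limits exist everywhere on \<open>regular_locus\<close> iff the limit
  exists as a rational function. For \<open>n = 0\<close> the exponent of \<open>d\<close> is \<open>0\<close>.
\<close>

definition B_space ::
  "complex \<Rightarrow> complex \<Rightarrow> nat \<Rightarrow> nat \<Rightarrow> (nat \<Rightarrow> complex) \<Rightarrow> nat \<Rightarrow> (point \<Rightarrow> complex) set" where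
  "B_space q d m n s N =
     {F \<in> Sh0 q d m n N.
        \<forall>k. (\<forall>i\<in>{1..m + n}. k i \<le> N) \<longrightarrow>
          (\<exists>F_inf F_zero.
             (\<forall>x\<in>regular_locus (m + n) N.
                ((\<lambda>\<xi>. F (scale_point k \<xi> x)) \<longlongrightarrow> F_inf x) at_infinity \<and>
                ((\<lambda>\<xi>. F (scale_point k \<xi> x)) \<longlongrightarrow> F_zero x) (at 0) \<and>
                F_inf x = F_zero x * (\<Prod>i\<in>{1..m + n}. s i ^ k i) *
                  d powi (2 * int N * (int (k m) - int (k (m + n))))))}"

definition generic_params ::
  "complex \<Rightarrow> complex \<Rightarrow> nat \<Rightarrow> (nat \<Rightarrow> complex) \<Rightarrow> bool" where
  "generic_params q d M s \<longleftrightarrow>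
     (\<forall>(a1 :: int) (a2 :: int) (b :: nat \<Rightarrow> int).
        q1 q d powi a1 * q2 q powi a2 * (\<Prod>i\<in>{1..<M}. s i powi b i) = 1 \<longrightarrow>
        a1 = 0 \<and> a2 = 0 \<and> (\<forall>i\<in>{1..<M}. b i = 0))"

text \<open>
  The variable \<open>T\<close> with indices \<open>i, \<nu>\<close> is the pair \<open>(i, \<nu>)\<close>; a monomial is a finitely
  supported exponent vector.
\<close>

type_synonym T_monomial = "(nat \<times> nat) \<Rightarrow>\<^sub>0 nat"
type_synonym T_polynomial = "T_monomial \<Rightarrow>\<^sub>0 complex"

definition T_degree :: "T_monomial \<Rightarrow> nat" where
  "T_degree t = (\<Sum>v\<in>Poly_Mapping.keys t. Poly_Mapping.lookup t v * snd v)"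

definition R_ring :: "nat \<Rightarrow> T_polynomial set" where
  "R_ring M = {p. \<forall>t\<in>Poly_Mapping.keys p. Poly_Mapping.keys t \<subseteq> {1..M} \<times> {0<..}}"

definition R_comp :: "nat \<Rightarrow> nat \<Rightarrow> nat \<Rightarrow> T_polynomial set" where
  "R_comp m n N = {p \<in> R_ring (m + n). \<forall>t\<in>Poly_Mapping.keys p. T_degree t = N}"

definition scaleF :: "complex \<Rightarrow> (point \<Rightarrow> complex) \<Rightarrow> point \<Rightarrow> complex" where
  "scaleF c F = (\<lambda>x. c * F x)"

definition scaleT :: "complex \<Rightarrow> T_polynomial \<Rightarrow> T_polynomial" where
  "scaleT c p = Poly_Mapping.map (\<lambda>z. c * z) p"

interpretation funs: vector_space scaleF
  by unfold_locales (auto simp: scaleF_def fun_eq_iff algebra_simps)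

interpretation polys: vector_space scaleT
proof -
  have l: "Poly_Mapping.lookup (scaleT c p) t = c * Poly_Mapping.lookup p t" for c p t
    by (simp add: scaleT_def map.rep_eq when_def)
  show "vector_space scaleT"
    by unfold_locales (auto intro!: poly_mapping_eqI simp: l lookup_add algebra_simps)
qed

text \<open>Needed because the library's \<open>dim\<close> is \<open>0\<close> on infinite-dimensional spaces.\<close>

definition finite_dim :: "(point \<Rightarrow> complex) set \<Rightarrow> bool" where
  "finite_dim V \<longleftrightarrow> (\<exists>G. finite G \<and> V \<subseteq> funs.span G)"

end

theory Submission
  imports Defs "HOL-Computational_Algebra.Polynomial"
begin

text \<open>
  The proof exhibits at most \<open>dim R_comp\<close> points of the torus such that a numerator \<open>f\<close> of an
  element of \<open>B_space\<close> that vanishes at all of them is zero (\<open>evaluation_points\<close>); linear algebra then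
  bounds the dimension. The points come from specializing the variables along segments, in the
  spirit of a Gordon filtration.

  A segment is a chain of variables whose colors follow each other cyclically and whose successive
  ratios are \<open>q3\<close> (when a color \<open>1, ..., m\<close> is entered) or its inverse (when a color
  \<open>m + 1, ..., m + n\<close> is entered); these are the chains out of which the wheel conditions are built.
  Because \<open>m \<noteq> n\<close>, going once around the colors multiplies by \<open>q3\<close> to the power \<open>m - n\<close>, which is not
  a root of unity, so equally colored members of a segment have different values.

  Suppose that \<open>f\<close> vanishes at all points containing a segment of length \<open>len + 1\<close>. Put a segment of
  length \<open>len\<close> at the values \<open>y * C t\<close> and let the other variables be arbitrary. Existence of the two
  limits makes \<open>f\<close> a power of \<open>y\<close> times a polynomial in \<open>y\<close> whose degree is at most the number of pairs
  consisting of a segment member and an outside variable of neighboring color. On the other hand every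
  such pair produces a zero: if the neighbor of that color also belongs to the segment, a wheel
  condition or skew symmetry forces it, and if it does not, the outside variable can prolong the segment
  (\<open>segment_zero\<close>). These zeros are pairwise different for generic outside variables, so they are all
  of them, and \<open>f\<close> is an explicit product times a function \<open>g\<close> of the outside variables
  (\<open>segment_factorization\<close>).

  This has two consequences. First, the relation between the two limits compares the highest with the
  lowest coefficient in \<open>y\<close>, which are \<open>g\<close> and \<open>g\<close> times an explicit monomial. If \<open>g \<noteq> 0\<close>, then the
  product of the \<open>s i\<close> over the segment is, up to a square root, a monomial in \<open>q1\<close> and \<open>q2\<close>; as \<open>s\<close> is
  generic, every color occurs equally often. So only lengths \<open>\<nu> * (m + n)\<close> survive
  (\<open>vanishes_nonmultiple\<close>). Second, for such lengths \<open>g\<close> satisfies again all the conditions imposed on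
  \<open>f\<close>, now with \<open>\<nu>\<close> variables fewer in each color (\<open>split_off_admissible\<close>).

  Splitting off segments in order of decreasing length, and for equal lengths in order of their starting
  color, therefore determines \<open>f\<close> by one number for each multiset of pairs \<open>(i, \<nu>)\<close> with \<open>\<Sum>\<nu> = N\<close>,
  where \<open>i\<close> is the starting color (\<open>determining_points\<close>). Such multisets are the monomials of degree \<open>N\<close>
  in the variables \<open>T\<close>, and these form a basis of \<open>R_comp\<close> (\<open>dim_R_comp\<close>).
\<close>

section \<open>Functions that are Laurent polynomials along monomial curves\<close>

definition twist :: "(nat \<Rightarrow> nat \<Rightarrow> nat) \<Rightarrow> complex \<Rightarrow> point \<Rightarrow> point" where
  "twist e \<xi> x = (\<lambda>i a. \<xi> ^ e i a * x i a)"

text \<open>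
  All arguments below look at a function only along the curves \<open>twist e \<xi> x\<close>: scaling some of the
  variables is such a curve, and so is a small generic displacement of a point. The property
  passes at once to specializations of some of the variables.
\<close>

definition laurentian :: "(point \<Rightarrow> complex) \<Rightarrow> bool" where
  "laurentian f \<longleftrightarrow> (\<forall>e x. \<exists>p j. \<forall>\<xi>. \<xi> \<noteq> 0 \<longrightarrow> f (twist e \<xi> x) = poly p \<xi> / \<xi> ^ j)"

lemma twist_1 [simp]: "twist e 1 x = x"
  by (simp add: twist_def)

lemma laurentianI:
  assumes "\<And>e x. \<exists>p j. \<forall>\<xi>. \<xi> \<noteq> 0 \<longrightarrow> f (twist e \<xi> x) = poly p \<xi> / \<xi> ^ j"
  shows "laurentian f"
  using assms by (simp add: laurentian_def)

lemma laurentianE: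
  assumes "laurentian f"
  obtains p j where "\<And>\<xi>. \<xi> \<noteq> 0 \<Longrightarrow> f (twist e \<xi> x) = poly p \<xi> / \<xi> ^ j"
  using assms unfolding laurentian_def by metis

lemma laurentian_const [intro]: "laurentian (\<lambda>x. c)"
proof (rule laurentianI)
  fix e x
  show "\<exists>p j. \<forall>\<xi>. \<xi> \<noteq> 0 \<longrightarrow> c = poly p \<xi> / \<xi> ^ j"
    by (rule exI[of _ "[:c:]"], rule exI[of _ 0]) simp
qed

lemma laurentian_mult [intro]:
  assumes "laurentian f" "laurentian g"
  shows "laurentian (\<lambda>x. f x * g x)"
proof (rule laurentianI)
  fix e x
  obtain p j where p: "\<And>\<xi>. \<xi> \<noteq> 0 \<Longrightarrow> f (twist e \<xi> x) = poly p \<xi> / \<xi> ^ j"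
    using assms(1) by (rule laurentianE) blast
  obtain r k where r: "\<And>\<xi>. \<xi> \<noteq> 0 \<Longrightarrow> g (twist e \<xi> x) = poly r \<xi> / \<xi> ^ k"
    using assms(2) by (rule laurentianE) blast
  show "\<exists>p j. \<forall>\<xi>. \<xi> \<noteq> 0 \<longrightarrow> f (twist e \<xi> x) * g (twist e \<xi> x) = poly p \<xi> / \<xi> ^ j"
    by (rule exI[of _ "p * r"], rule exI[of _ "j + k"]) (simp add: p r power_add)
qed

lemma laurentian_add [intro]:
  assumes "laurentian f" "laurentian g"
  shows "laurentian (\<lambda>x. f x + g x)"
proof (rule laurentianI)
  fix e x
  obtain p j where p: "\<And>\<xi>. \<xi> \<noteq> 0 \<Longrightarrow> f (twist e \<xi> x) = poly p \<xi> / \<xi> ^ j"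
    using assms(1) by (rule laurentianE) blast
  obtain r k where r: "\<And>\<xi>. \<xi> \<noteq> 0 \<Longrightarrow> g (twist e \<xi> x) = poly r \<xi> / \<xi> ^ k"
    using assms(2) by (rule laurentianE) blast
  show "\<exists>p j. \<forall>\<xi>. \<xi> \<noteq> 0 \<longrightarrow> f (twist e \<xi> x) + g (twist e \<xi> x) = poly p \<xi> / \<xi> ^ j"
    by (rule exI[of _ "p * monom 1 k + r * monom 1 j"], rule exI[of _ "j + k"])
       (simp add: p r power_add poly_monom field_simps)
qed

lemma laurentian_sum [intro]:
  assumes "\<And>i. i \<in> A \<Longrightarrow> laurentian (f i)"
  shows "laurentian (\<lambda>x. \<Sum>i\<in>A. f i x)"
  using assms by (induction A rule: infinite_finite_induct) (auto intro!: laurentian_add)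

lemma laurentian_prod [intro]:
  assumes "\<And>i. i \<in> A \<Longrightarrow> laurentian (f i)"
  shows "laurentian (\<lambda>x. \<Prod>i\<in>A. f i x)"
  using assms by (induction A rule: infinite_finite_induct) (auto intro!: laurentian_mult)

lemma laurentian_power [intro]:
  assumes "laurentian f"
  shows "laurentian (\<lambda>x. f x ^ k)"
  using assms by (induction k) auto

lemma laurentian_diff [intro]:
  assumes "laurentian f" "laurentian g"
  shows "laurentian (\<lambda>x. f x - g x)"
  using laurentian_add[OF assms(1) laurentian_mult[OF laurentian_const[of "-1"] assms(2)]]
  by simp

lemma laurentian_coordinate_powi [intro]: "laurentian (\<lambda>x. x i a powi r)"
proof (rule laurentianI)
  fix e :: "nat \<Rightarrow> nat \<Rightarrow> nat" and x :: point
  show "\<exists>p j. \<forall>\<xi>. \<xi> \<noteq> 0 \<longrightarrow> twist e \<xi> x i a powi r = poly p \<xi> / \<xi> ^ j"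
  proof (cases "r \<ge> 0")
    case True
    then obtain k where k: "r = int k" by (rule nonneg_int_cases)
    show ?thesis
      by (rule exI[of _ "monom (x i a ^ k) (e i a * k)"], rule exI[of _ 0])
         (simp add: k twist_def poly_monom power_mult_distrib power_mult)
  next
    case False
    then obtain k where k: "r = - int k" by (metis nonpos_int_cases linorder_linear)
    show ?thesis
      by (rule exI[of _ "[:inverse (x i a ^ k):]"], rule exI[of _ "e i a * k"])
         (simp add: k twist_def power_int_minus power_mult_distrib power_mult divide_inverse)
  qed
qed

lemma laurentian_coordinate [intro]: "laurentian (\<lambda>x. x i a)"
  using laurentian_coordinate_powi[of i a 1] by simp

lemma laurent_polynomial_laurentian:
  "laurent_polynomial M N f \<Longrightarrow> laurentian f"
  unfolding laurent_polynomial_def by (auto intro!: laurentian_sum laurentian_mult laurentian_prod)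

lemma laurentian_tendsto:
  assumes "laurentian f"
  shows "((\<lambda>\<xi>. f (twist e \<xi> x)) \<longlongrightarrow> f x) (at 1)"
proof -
  obtain p j where p: "\<And>\<xi>. \<xi> \<noteq> 0 \<Longrightarrow> f (twist e \<xi> x) = poly p \<xi> / \<xi> ^ j"
    using assms by (rule laurentianE) blast
  have "((\<lambda>\<xi>. poly p \<xi> / \<xi> ^ j) \<longlongrightarrow> poly p 1 / 1 ^ j) (at 1)"
    by (intro tendsto_intros) auto
  moreover have "eventually (\<lambda>\<xi>. poly p \<xi> / \<xi> ^ j = f (twist e \<xi> x)) (at 1)"
    using eventually_neq_at_within[of 0 1 UNIV] by eventually_elim (simp add: p)
  ultimately show ?thesis
    using p[of 1] by (simp add: tendsto_cong)
qed

text \<open>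
  Identities may be checked at generic points: a function of this kind is continuous along the curve at
  the parameter \<open>1\<close>.
\<close>

lemma laurentian_eqI:
  assumes "laurentian f" "laurentian g"
    and "eventually (\<lambda>\<xi>. f (twist e \<xi> x) = g (twist e \<xi> x)) (at 1)"
  shows "f x = g x"
proof -
  have "((\<lambda>\<xi>. g (twist e \<xi> x)) \<longlongrightarrow> f x) (at 1)"
    using tendsto_cong[OF assms(3)] laurentian_tendsto[OF assms(1)] by blast
  then show ?thesis
    using laurentian_tendsto[OF assms(2)] tendsto_unique by (metis at_neq_bot)
qed

lemma eventually_powers_differ:
  fixes v v' :: complex
  assumes "v \<noteq> 0" "e \<noteq> e'"
  shows "eventually (\<lambda>\<xi>. \<xi> ^ e * v \<noteq> \<xi> ^ e' * v') (at \<xi>0)"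
proof -
  define p where "p = monom v e - monom v' e'"
  have "coeff p e \<noteq> 0" using assms by (simp add: p_def)
  then have "p \<noteq> 0" by auto
  then have "finite {\<xi>. poly p \<xi> = 0}" by (rule poly_roots_finite)
  then have "eventually (\<lambda>\<xi>. \<forall>r\<in>{\<xi>. poly p \<xi> = 0}. \<xi> \<noteq> r) (at \<xi>0)"
    by (intro eventually_ball_finite) (auto intro: eventually_neq_at_within)
  then show ?thesis
    by eventually_elim (auto simp: p_def poly_monom mult.commute)
qed

text \<open>
  With these exponents the coordinates of a point move at pairwise different speeds. Hence points
  near \<open>x\<close> on the curve avoid any finite set of relations \<open>x\<^sub>u = c * x\<^sub>w\<close> with \<open>u \<noteq> w\<close>.
\<close>

definition spread :: "nat \<Rightarrow> nat \<Rightarrow> nat \<Rightarrow> nat" where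
  "spread N i a = i * Suc N + a"

lemma spread_inj:
  assumes "a \<le> N" "b \<le> N" "spread N i a = spread N j b"
  shows "i = j \<and> a = b"
proof -
  have "(i * Suc N + a) div Suc N = i" "(j * Suc N + b) div Suc N = j"
    using assms(1,2) by (auto simp: div_nat_eqI)
  with assms(3) show ?thesis by (auto simp: spread_def)
qed

section \<open>Univariate polynomials\<close>

text \<open>
  This lemma and the next one turn the existence of limits at \<open>0\<close> and \<open>\<infinity>\<close> into bounds on the order and
  the degree of a polynomial.
\<close>

lemma poly_zero_order_of_limit:
  fixes p :: "complex poly"
  assumes "((\<lambda>\<xi>. poly p \<xi> / \<xi> ^ k) \<longlongrightarrow> L) (at 0)"
  shows "monom 1 k dvd p"
  using assms
proof (induction k arbitrary: p L)
  case 0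
  then show ?case by (simp add: monom_0 flip: one_pCons)
next
  case (Suc k)
  have "((\<lambda>\<xi>. poly p \<xi> / \<xi> ^ Suc k * \<xi> ^ Suc k) \<longlongrightarrow> L * 0 ^ Suc k) (at 0)"
    by (intro tendsto_intros Suc.prems)
  moreover have "eventually (\<lambda>\<xi>. poly p \<xi> / \<xi> ^ Suc k * \<xi> ^ Suc k = poly p \<xi>) (at 0)"
    using eventually_neq_at_within[of 0 0 UNIV] by eventually_elim simp
  ultimately have "(poly p \<longlongrightarrow> 0) (at 0)"
    by (simp add: tendsto_cong)
  moreover have "(poly p \<longlongrightarrow> poly p 0) (at 0)" by (intro tendsto_intros)
  ultimately have "poly p 0 = 0" using tendsto_unique by (metis at_neq_bot)
  then obtain r where r: "p = [:0, 1:] * r" by (metis dvdE minus_zero poly_eq_0_iff_dvd)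
  have "eventually (\<lambda>\<xi>. poly p \<xi> / \<xi> ^ Suc k = poly r \<xi> / \<xi> ^ k) (at 0)"
    using eventually_neq_at_within[of 0 0 UNIV] by eventually_elim (simp add: r)
  then have "((\<lambda>\<xi>. poly r \<xi> / \<xi> ^ k) \<longlongrightarrow> L) (at 0)"
    using Suc.prems by (simp add: tendsto_cong)
  then have "monom 1 k dvd r" by (rule Suc.IH)
  then have "[:0, 1:] * monom 1 k dvd p" unfolding r by (rule mult_dvd_mono[OF dvd_refl])
  then show ?case by (simp add: monom_Suc)
qed

lemma poly_degree_of_limit:
  fixes p :: "complex poly"
  assumes "((\<lambda>\<xi>. poly p \<xi> / \<xi> ^ k) \<longlongrightarrow> L) at_infinity"
  shows "degree p \<le> k"
proof (rule ccontr)
  assume less: "\<not> degree p \<le> k"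
  have "((\<lambda>\<xi>. poly p (inverse \<xi>) / inverse \<xi> ^ k) \<longlongrightarrow> L) (at 0)"
    using filterlim_compose[OF assms filterlim_inverse_at_infinity] .
  moreover have "eventually (\<lambda>\<xi>. poly p (inverse \<xi>) / inverse \<xi> ^ k
      = poly (reflect_poly p) \<xi> / \<xi> ^ (degree p - k)) (at 0)"
    using eventually_neq_at_within[of 0 0 UNIV]
  proof eventually_elim
    case (elim \<xi>)
    have "\<xi> ^ degree p = \<xi> ^ k * \<xi> ^ (degree p - k)"
      using less by (simp flip: power_add)
    then show ?case using elim poly_reflect_poly_nz[OF elim, of p]
      by (simp add: field_simps)
  qed
  ultimately have "((\<lambda>\<xi>. poly (reflect_poly p) \<xi> / \<xi> ^ (degree p - k)) \<longlongrightarrow> L) (at 0)"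
    by (simp add: tendsto_cong)
  then have "monom 1 (degree p - k) dvd reflect_poly p" by (rule poly_zero_order_of_limit)
  then obtain r where "reflect_poly p = monom 1 (degree p - k) * r" by (elim dvdE)
  then have "coeff (reflect_poly p) 0 = 0"
    using less by (simp add: coeff_mult)
  then have "p = 0" by (simp add: coeff_0_reflect_poly)
  with less show False by simp
qed

lemma poly_eq_prod_roots:
  fixes p :: "complex poly"
  assumes "finite R" "degree p \<le> card R" "\<And>r. r \<in> R \<Longrightarrow> poly p r = 0"
  shows "p = smult (coeff p (card R)) (\<Prod>r\<in>R. [:- r, 1:])"
proof -
  let ?P = "\<Prod>r\<in>R. [:- r, 1:]"
  have deg: "degree ?P = card R"
    by (subst degree_prod_eq_sum_degree) (auto simp: assms(1))
  have lc: "coeff ?P (card R) = 1"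
    using lead_coeff_prod[of "\<lambda>r. [:- r, 1:]" R] by (simp add: deg)
  show ?thesis
  proof (rule poly_eqI_degree_lead_coeff[where A = R and n = "card R"])
    show "degree (smult (coeff p (card R)) ?P) \<le> card R" by (simp add: deg)
    show "poly p r = poly (smult (coeff p (card R)) ?P) r" if "r \<in> R" for r
      using that assms by (auto simp: poly_prod)
  qed (use assms lc in auto)
qed

text \<open>
  A fixed linear combination of values computes the top coefficient of all polynomials of bounded
  degree (divided differences). It is used to write a coefficient function as a combination of
  specializations of the original function.
\<close>

lemma top_coeff_interpolation:
  fixes Y :: "complex set"
  assumes "finite Y" "card Y = Suc D"
  shows "\<exists>l. \<forall>p :: complex poly. degree p \<le> D \<longrightarrow> coeff p D = (\<Sum>y\<in>Y. l y * poly p y)"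
  using assms
proof (induction D arbitrary: Y)
  case 0
  then obtain y where Y: "Y = {y}" by (auto simp: card_1_singleton_iff)
  have "coeff p 0 = poly p y" if "degree p \<le> 0" for p :: "complex poly"
    using degree_eq_zeroE[of p] that by fastforce
  then show ?case by (intro exI[of _ "\<lambda>_. 1"]) (auto simp: Y)
next
  case (Suc D)
  then obtain y0 Y' where Y: "Y = insert y0 Y'" "y0 \<notin> Y'" "card Y' = Suc D" "finite Y'"
    by (metis card_Suc_eq finite_insert)
  then obtain l where l: "\<And>p :: complex poly. degree p \<le> D \<Longrightarrow> coeff p D = (\<Sum>y\<in>Y'. l y * poly p y)"
    using Suc.IH by blast
  let ?l = "\<lambda>y. if y = y0 then - (\<Sum>y\<in>Y'. l y / (y - y0)) else l y / (y - y0)"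
  have "coeff p (Suc D) = (\<Sum>y\<in>Y. ?l y * poly p y)" if deg: "degree p \<le> Suc D" for p :: "complex poly"
  proof -
    have "poly (p - [:poly p y0:]) y0 = 0" by simp
    then obtain r where r: "p - [:poly p y0:] = [:- y0, 1:] * r"
      unfolding poly_eq_0_iff_dvd by (elim dvdE)
    have degr: "degree r \<le> D"
    proof (cases "r = 0")
      case False
      have "degree (p - [:poly p y0:]) \<le> Suc D" using deg by (intro degree_diff_le) auto
      then show ?thesis unfolding r using False by (subst (asm) degree_mult_eq) auto
    qed simp
    have "coeff r (Suc D) = 0" using degr by (simp add: coeff_eq_0)
    then have "coeff p (Suc D) = coeff r D"
      using arg_cong[OF r, of "\<lambda>p. coeff p (Suc D)"] by simp
    also have "\<dots> = (\<Sum>y\<in>Y'. l y * poly r y)" using l degr by blast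
    also have "\<dots> = (\<Sum>y\<in>Y'. l y / (y - y0) * (poly p y - poly p y0))"
    proof (intro sum.cong refl)
      fix y assume "y \<in> Y'"
      with Y have "y \<noteq> y0" by auto
      have "poly p y - poly p y0 = (y - y0) * poly r y"
        using arg_cong[OF r, of "\<lambda>p. poly p y"] by (simp add: algebra_simps)
      then show "l y * poly r y = l y / (y - y0) * (poly p y - poly p y0)"
        using \<open>y \<noteq> y0\<close> by simp
    qed
    also have "\<dots> = (\<Sum>y\<in>Y'. l y / (y - y0) * poly p y) - (\<Sum>y\<in>Y'. l y / (y - y0)) * poly p y0"
      by (simp add: right_diff_distrib sum_subtractf sum_distrib_right)
    also have "(\<Sum>y\<in>Y'. l y / (y - y0) * poly p y) = (\<Sum>y\<in>Y'. ?l y * poly p y)"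
      using Y by (intro sum.cong) auto
    finally have "coeff p (Suc D)
        = (\<Sum>y\<in>Y'. ?l y * poly p y) + ?l y0 * poly p y0" by simp
    also have "\<dots> = (\<Sum>y\<in>Y. ?l y * poly p y)"
      unfolding Y(1) using Y(2,4) by (subst sum.insert) (auto simp: add.commute)
    finally show ?thesis .
  qed
  then show ?case by (intro exI[of _ ?l]) blast
qed

section \<open>Colors and segments\<close>

lemma cyc_mod [simp]: "cyc M t mod M = t mod M"
  by (auto simp: cyc_def)

lemma cyc_range:
  assumes "M \<ge> 1"
  shows "1 \<le> cyc M t" "cyc M t \<le> M"
proof -
  have "t mod M < M" using assms by simp
  then show "1 \<le> cyc M t" "cyc M t \<le> M" using assms by (auto simp: cyc_def)
qed

lemma cyc_eqI: "t mod M = t' mod M \<Longrightarrow> cyc M t = cyc M t'"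
  by (auto simp: cyc_def)

lemma cyc_eq_iff: "cyc M t = cyc M t' \<longleftrightarrow> t mod M = t' mod M"
  using cyc_eqI cyc_mod by metis

lemma cyc_id: "1 \<le> i \<Longrightarrow> i \<le> M \<Longrightarrow> cyc M i = i"
  by (cases "i = M") (auto simp: cyc_def)

lemma cyc_cyc [simp]: "cyc M (cyc M t) = cyc M t"
  by (rule cyc_eqI) simp

lemma cyc_cyc_Suc [simp]: "cyc M (Suc (cyc M t)) = cyc M (Suc t)"
  by (rule cyc_eqI) (metis cyc_mod mod_Suc_eq)

lemma cyc_add_period [simp]: "cyc M (t + M) = cyc M t"
  by (rule cyc_eqI) simp

lemma cyc_cancel_Suc:
  assumes "cyc M (Suc t) = cyc M (Suc t')"
  shows "cyc M t = cyc M t'"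
proof -
  have "Suc t mod M = Suc t' mod M" using assms by (simp add: cyc_eq_iff)
  then have "int (Suc t) mod int M = int (Suc t') mod int M" by (metis zmod_int)
  then have "(int (Suc t) - 1) mod int M = (int (Suc t') - 1) mod int M"
    by (rule mod_diff_cong) simp
  then have "t mod M = t' mod M" by (simp flip: zmod_int)
  then show ?thesis by (simp add: cyc_eq_iff)
qed

lemma cyc_cyc_pred [simp]:
  assumes "M \<ge> 1"
  shows "cyc M (cyc M (Suc t) - 1) = cyc M t"
proof (rule cyc_cancel_Suc)
  show "cyc M (Suc (cyc M (Suc t) - 1)) = cyc M (Suc t)"
    using cyc_range(1)[OF assms, of "Suc t"] by simp
qed

definition slots :: "nat \<Rightarrow> nat \<Rightarrow> (nat \<times> nat) set" where
  "slots M N = {1..M} \<times> {1..N}"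

lemma finite_slots [simp, intro]: "finite (slots M N)"
  by (simp add: slots_def)

definition at_slot :: "point \<Rightarrow> nat \<times> nat \<Rightarrow> complex" where
  "at_slot x u = x (fst u) (snd u)"

lemma torus_iff: "x \<in> torus M N \<longleftrightarrow> (\<forall>u\<in>slots M N. at_slot x u \<noteq> 0)"
  by (auto simp: torus_def slots_def at_slot_def)

definition scale_slots :: "(nat \<times> nat) set \<Rightarrow> complex \<Rightarrow> point \<Rightarrow> point" where
  "scale_slots S \<xi> x = (\<lambda>i a. if (i, a) \<in> S then \<xi> * x i a else x i a)"

lemma scale_slots_twist: "scale_slots S \<xi> x = twist (\<lambda>i a. of_bool ((i, a) \<in> S)) \<xi> x"
  by (auto simp: scale_slots_def twist_def fun_eq_iff)

lemma at_slot_scale: "at_slot (scale_slots S \<xi> x) u = (if u \<in> S then \<xi> * at_slot x u else at_slot x u)"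
  by (auto simp: at_slot_def scale_slots_def)

lemma scale_slots_torus: "x \<in> torus M N \<Longrightarrow> \<xi> \<noteq> 0 \<Longrightarrow> scale_slots S \<xi> x \<in> torus M N"
  by (auto simp: torus_iff at_slot_scale)

lemma twist_torus: "x \<in> torus M N \<Longrightarrow> \<xi> \<noteq> 0 \<Longrightarrow> twist e \<xi> x \<in> torus M N"
  by (auto simp: torus_def twist_def)

lemma at_slot_twist: "at_slot (twist e \<xi> x) u = \<xi> ^ e (fst u) (snd u) * at_slot x u"
  by (simp add: at_slot_def twist_def)

text \<open>
  The number of factors of the denominator, counted with multiplicity, that involve a given variable of
  color \<open>i\<close> and a given other variable of color \<open>j\<close>. The two summands coincide for two colors, and also
  for a single color, where they account for the square in the denominator.
\<close>

definition link :: "nat \<Rightarrow> nat \<Rightarrow> nat \<Rightarrow> nat" where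
  "link M i j = of_bool (cyc M (Suc i) = j) + of_bool (cyc M (Suc j) = i)"

text \<open>
  The difference between the order of growth at \<open>\<infinity>\<close> and the order of vanishing at \<open>0\<close> of the
  denominator when the variables in \<open>S\<close> are scaled: only factors with exactly one scaled variable
  contribute.
\<close>

definition cross :: "nat \<Rightarrow> nat \<Rightarrow> (nat \<times> nat) set \<Rightarrow> nat" where
  "cross M N S = (\<Sum>u\<in>S. \<Sum>w\<in>slots M N - S. link M (fst u) (fst w))"

locale shuffle_parameters =
  fixes q d :: complex and m n :: nat and s :: "nat \<Rightarrow> complex"
  assumes q_nz: "q \<noteq> 0" and d_nz: "d \<noteq> 0"
    and indep: "\<And>n1 n2 n3 :: int.
           q1 q d powi n1 * q2 q powi n2 * q3 q d powi n3 = 1 \<Longrightarrow> n1 = n2 \<and> n2 = n3"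
    and m_pos: "m \<ge> 1" and m_neq_n: "m \<noteq> n"
    and s_nz: "\<And>i. i \<in> {1..m + n} \<Longrightarrow> s i \<noteq> 0"
    and s_prod: "(\<Prod>i\<in>{1..m + n}. s i) = 1"
    and s_generic: "generic_params q d (m + n) s"
begin

abbreviation M :: nat where "M \<equiv> m + n"

abbreviation col :: "nat \<Rightarrow> nat" where "col t \<equiv> cyc M t"

lemma M_pos: "M \<ge> 1" using m_pos by simp

lemma M_pos' [simp]: "0 < M" using m_pos by simp

lemma col_range: "1 \<le> col t" "col t \<le> M" "col t \<in> {1..M}"
  using cyc_range[OF M_pos, of t] by auto

text \<open>
  Positions of segments are natural numbers \<open>t\<close>, of color \<open>col t\<close>; \<open>C t\<close> is the value at position \<open>t\<close> of
  the chain that has value \<open>1\<close> at position \<open>0\<close>.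
\<close>

primrec height :: "nat \<Rightarrow> int" where
  "height 0 = 0"
| "height (Suc t) = height t + (if col (Suc t) \<le> m then 1 else - 1)"

definition C :: "nat \<Rightarrow> complex" where
  "C t = q3 q d powi height t"

lemma qs_nz [simp]: "q1 q d \<noteq> 0" "q2 q \<noteq> 0" "q3 q d \<noteq> 0"
  using q_nz d_nz by (auto simp: q1_def q2_def q3_def)

lemma C_nz [simp]: "C t \<noteq> 0"
  by (simp add: C_def)

lemma C_Suc:
  "C (Suc t) = (if col (Suc t) \<le> m then q3 q d else inverse (q3 q d)) * C t"
  by (auto simp: C_def power_int_add power_int_diff divide_inverse)

lemma height_initial: "t \<le> M \<Longrightarrow> height t = (if t \<le> m then int t else 2 * int m - int t)"
proof (induction t)
  case (Suc t)
  then have "col (Suc t) = Suc t" by (intro cyc_id) auto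
  with Suc show ?case by auto
qed simp

lemma height_period: "height (t + M) = height t + (int m - int n)"
proof (induction t)
  case 0
  then show ?case using height_initial[of M] by auto
next
  case (Suc t)
  have "col (Suc t + M) = col (Suc t)" by (rule cyc_add_period)
  then have "col (Suc (t + M)) = col (Suc t)" by simp
  with Suc show ?case by simp
qed

lemma height_periods: "height (t + k * M) = height t + int k * (int m - int n)"
proof (induction k)
  case (Suc k)
  have "height (t + Suc k * M) = height ((t + k * M) + M)" by (simp add: algebra_simps)
  with Suc height_period[of "t + k * M"] show ?case by (simp add: algebra_simps)
qed simp

text \<open>
  Here \<open>m \<noteq> n\<close> is used: positions of equal color differ by a multiple \<open>k * M\<close>, and the heights then differ
  by \<open>k * (m - n)\<close>.
\<close>

lemma height_inj:
  assumes "col t = col t'" "height t = height t'"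
  shows "t = t'"
  using assms
proof (induction t t' rule: linorder_wlog)
  case (le t t')
  then have "M dvd t' - t" by (metis cyc_eq_iff mod_eq_dvd_iff_nat)
  then obtain k where "t' - t = M * k" by (elim dvdE)
  then have t': "t' = t + k * M" using le(1) by (simp add: mult.commute)
  with le(3) have "k = 0" using height_periods[of t k] m_neq_n by auto
  then show ?case using t' by simp
qed simp

lemma q2_q3_cancel:
  assumes "q2 q powi e * q3 q d powi h = q2 q powi e' * q3 q d powi h'"
  shows "e = e'" "h = h'"
proof -
  have "q1 q d powi 0 * q2 q powi (e - e') * q3 q d powi (h - h') = 1"
    using assms by (simp add: power_int_diff field_simps)
  from indep[OF this] show "e = e'" "h = h'" by auto
qed

lemma C_inj:
  assumes "col t = col t'" "C t * q2 q powi e = C t' * q2 q powi e'"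
  shows "t = t'" "e = e'"
proof -
  have "q2 q powi e * q3 q d powi height t = q2 q powi e' * q3 q d powi height t'"
    using assms(2) by (simp add: C_def mult.commute)
  note * = q2_q3_cancel[OF this]
  show "e = e'" by (rule *)
  show "t = t'" by (rule height_inj[OF assms(1) *(2)])
qed

lemma C_shift: "C (t + M) = C t * q3 q d powi (int m - int n)"
  by (simp only: C_def height_period power_int_add[OF disjI1[OF qs_nz(3)]])

subsection \<open>The group of admissible constants\<close>

text \<open>
  The constants that occur when limits are compared. Allowing square roots of monomials in \<open>q1\<close> and \<open>q2\<close>
  absorbs signs and makes \<open>d\<close> and \<open>q\<close> members, and it does no harm: a relation between the \<open>s i\<close> and
  such a constant can be squared before genericity is applied.
\<close>

definition GG :: "complex set" where
  "GG = {z. \<exists>a b :: int. z ^ 2 = q1 q d powi a * q2 q powi b}"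

lemma GG_1 [intro, simp]: "1 \<in> GG"
  unfolding GG_def by (auto intro!: exI[of _ 0])

lemma GG_nz: "z \<in> GG \<Longrightarrow> z \<noteq> 0"
  unfolding GG_def by auto

lemma GG_mult [intro]:
  assumes "z \<in> GG" "w \<in> GG" shows "z * w \<in> GG"
proof -
  obtain a b where z: "z ^ 2 = q1 q d powi a * q2 q powi b" using assms(1) by (auto simp: GG_def)
  obtain a' b' where w: "w ^ 2 = q1 q d powi a' * q2 q powi b'" using assms(2) by (auto simp: GG_def)
  have "(z * w) ^ 2 = q1 q d powi (a + a') * q2 q powi (b + b')"
    by (simp add: power_mult_distrib z w power_int_add)
  then show ?thesis unfolding GG_def by blast
qed

lemma GG_inverse [intro]:
  assumes "z \<in> GG" shows "inverse z \<in> GG"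
proof -
  obtain a b where z: "z ^ 2 = q1 q d powi a * q2 q powi b" using assms(1) by (auto simp: GG_def)
  have "(inverse z) ^ 2 = q1 q d powi (- a) * q2 q powi (- b)"
    by (simp add: power_inverse z power_int_minus)
  then show ?thesis unfolding GG_def by blast
qed

lemma GG_divide [intro]: "z \<in> GG \<Longrightarrow> w \<in> GG \<Longrightarrow> z / w \<in> GG"
  by (simp add: divide_inverse GG_mult GG_inverse)

lemma GG_minus [intro]: "z \<in> GG \<Longrightarrow> - z \<in> GG"
  by (auto simp: GG_def)

lemma GG_power [intro]: "z \<in> GG \<Longrightarrow> z ^ k \<in> GG"
  by (induction k) auto

lemma GG_powi [intro]: "z \<in> GG \<Longrightarrow> z powi k \<in> GG"
  by (cases "k \<ge> 0") (auto simp: power_int_def)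

lemma GG_prod [intro]: "(\<And>i. i \<in> A \<Longrightarrow> f i \<in> GG) \<Longrightarrow> (\<Prod>i\<in>A. f i) \<in> GG"
  by (induction A rule: infinite_finite_induct) auto

lemma GG_q2 [intro]: "q2 q \<in> GG"
  unfolding GG_def by (rule CollectI, rule exI[of _ 0], rule exI[of _ 2]) simp

lemma GG_q3 [intro]: "q3 q d \<in> GG"
  unfolding GG_def
proof (rule CollectI, rule exI[of _ "- 2"], rule exI[of _ "- 2"])
  show "(q3 q d)\<^sup>2 = q1 q d powi - 2 * q2 q powi - 2"
    using q_nz d_nz by (simp add: q1_def q2_def q3_def power_int_minus field_simps power2_eq_square)
qed

lemma GG_d [intro]: "d \<in> GG"
  unfolding GG_def
proof (rule CollectI, rule exI[of _ "2"], rule exI[of _ "1"])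
  show "d\<^sup>2 = q1 q d powi 2 * q2 q powi 1"
    using q_nz d_nz by (simp add: q1_def q2_def field_simps power2_eq_square)
qed

lemma GG_C [intro]: "C t \<in> GG"
  unfolding C_def by auto

subsection \<open>Segments\<close>

definition carries :: "nat \<Rightarrow> point \<Rightarrow> nat \<Rightarrow> nat \<Rightarrow> complex \<Rightarrow> (nat \<Rightarrow> nat) \<Rightarrow> bool" where
  "carries N x \<alpha> len y a \<longleftrightarrow>
     (\<forall>t\<in>{\<alpha>..<\<alpha> + len}. a t \<in> {1..N} \<and> x (col t) (a t) = y * C t)"

definition vanishes :: "nat \<Rightarrow> (point \<Rightarrow> complex) \<Rightarrow> nat \<Rightarrow> nat \<Rightarrow> bool" where
  "vanishes N f \<alpha> len \<longleftrightarrow> (\<forall>x\<in>torus M N. \<forall>y a. carries N x \<alpha> len y a \<longrightarrow> f x = 0)"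

definition seg_slots :: "nat \<Rightarrow> nat \<Rightarrow> (nat \<Rightarrow> nat) \<Rightarrow> (nat \<times> nat) set" where
  "seg_slots \<alpha> len a = (\<lambda>t. (col t, a t)) ` {\<alpha>..<\<alpha> + len}"

lemma carriesD:
  assumes "carries N x \<alpha> len y a" "\<alpha> \<le> t" "t < \<alpha> + len"
  shows "1 \<le> a t" "a t \<le> N" "a t \<in> {1..N}" "x (col t) (a t) = y * C t"
proof -
  have "t \<in> {\<alpha>..<\<alpha> + len}" using assms(2,3) by auto
  then show "a t \<in> {1..N}" "x (col t) (a t) = y * C t" "1 \<le> a t" "a t \<le> N"
    using assms(1) unfolding carries_def by auto
qed

lemma carries_slots:
  "carries N x \<alpha> len y a \<Longrightarrow> seg_slots \<alpha> len a \<subseteq> slots M N"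
  using col_range by (auto simp: carries_def seg_slots_def slots_def)

lemma carries_nz:
  assumes "carries N x \<alpha> len y a" "x \<in> torus M N" "t \<in> {\<alpha>..<\<alpha> + len}"
  shows "y \<noteq> 0"
proof -
  have t: "\<alpha> \<le> t" "t < \<alpha> + len" using assms(3) by auto
  have "x (col t) (a t) \<noteq> 0"
    using assms(2) col_range(3)[of t] carriesD(3)[OF assms(1) t] unfolding torus_def by blast
  then show ?thesis using carriesD(4)[OF assms(1) t] by auto
qed

text \<open>
  Members of a segment at different positions are different variables, because equally colored ones
  have different values.
\<close>

lemma carries_inj:
  assumes "carries N x \<alpha> len y a" "y \<noteq> 0"
  shows "inj_on (\<lambda>t. (col t, a t)) {\<alpha>..<\<alpha> + len}"
proof (rule inj_onI)
  fix t t' assume t: "t \<in> {\<alpha>..<\<alpha> + len}" "t' \<in> {\<alpha>..<\<alpha> + len}"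
    and eq: "(col t, a t) = (col t', a t')"
  have "y * C t = x (col t) (a t)" "y * C t' = x (col t') (a t')"
    using t carriesD(4)[OF assms(1)] by simp_all
  then have "y * C t = y * C t'" using eq by simp
  then have "C t * q2 q powi 0 = C t' * q2 q powi 0" using assms(2) by simp
  from C_inj(1)[OF _ this] eq show "t = t'" by simp
qed

lemma carries_length:
  assumes "carries N x \<alpha> len y a" "x \<in> torus M N"
  shows "len \<le> M * N"
proof (cases "len = 0")
  case False
  then have "y \<noteq> 0" using carries_nz[OF assms, of \<alpha>] by auto
  then have "inj_on (\<lambda>t. (col t, a t)) {\<alpha>..<\<alpha> + len}" by (rule carries_inj[OF assms(1)])
  then have "card {\<alpha>..<\<alpha> + len} \<le> card (slots M N)"
    by (rule card_inj_on_le) (use carries_slots[OF assms(1)] in \<open>auto simp: seg_slots_def\<close>)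
  then show ?thesis by (simp add: slots_def)
qed simp

text \<open>
  Shifting all positions by one period only rescales \<open>y\<close>.
\<close>

lemma vanishes_shift: "vanishes N f (\<alpha> + M) len \<longleftrightarrow> vanishes N f \<alpha> len"
proof -
  let ?c = "q3 q d powi (int m - int n)"
  have c: "?c \<noteq> 0" by simp
  have 1: "carries N x (\<alpha> + M) len (y / ?c) (\<lambda>t. a (t - M))" if "carries N x \<alpha> len y a" for x y a
    unfolding carries_def
  proof (intro ballI)
    fix t assume t: "t \<in> {\<alpha> + M..<\<alpha> + M + len}"
    define r where "r = t - M"
    have r: "r \<in> {\<alpha>..<\<alpha> + len}" "t = r + M" using t by (auto simp: r_def)
    have "a r \<in> {1..N}" "x (col r) (a r) = y * C r" using that r(1) by (auto simp: carries_def)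
    then show "a (t - M) \<in> {1..N} \<and> x (col t) (a (t - M)) = y / ?c * C t"
      unfolding r(2) C_shift cyc_add_period using c by simp
  qed
  have 2: "carries N x \<alpha> len (y * ?c) (\<lambda>t. a (t + M))" if "carries N x (\<alpha> + M) len y a" for x y a
    unfolding carries_def
  proof (intro ballI)
    fix t assume t: "t \<in> {\<alpha>..<\<alpha> + len}"
    then have "t + M \<in> {\<alpha> + M..<\<alpha> + M + len}" by auto
    then have "a (t + M) \<in> {1..N}" "x (col (t + M)) (a (t + M)) = y * C (t + M)"
      using that unfolding carries_def by blast+
    then show "a (t + M) \<in> {1..N} \<and> x (col t) (a (t + M)) = y * ?c * C t"
      unfolding C_shift cyc_add_period by (simp add: mult_ac)
  qed
  show ?thesis unfolding vanishes_def using 1 2 by blast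
qed

lemma vanishes_all_starts:
  assumes "\<And>\<alpha>. \<alpha> \<in> {1..M} \<Longrightarrow> vanishes N f \<alpha> len"
  shows "vanishes N f \<alpha> len"
proof -
  have shifts: "vanishes N f (\<beta> + k * M) len \<longleftrightarrow> vanishes N f \<beta> len" for \<beta> k
  proof (induction k)
    case (Suc k)
    have "\<beta> + Suc k * M = (\<beta> + k * M) + M" by (simp add: algebra_simps)
    then show ?case by (simp only: vanishes_shift Suc)
  qed simp
  have "vanishes N f (col \<alpha>) len" using assms col_range(3) by blast
  then have *: "vanishes N f (col \<alpha> + k * M) len" for k by (simp only: shifts)
  have "vanishes N f (\<alpha> + M) len"
  proof (cases "\<alpha> mod M = 0")
    case True
    then have "\<alpha> + M = col \<alpha> + (\<alpha> div M) * M"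
      using div_mult_mod_eq[of \<alpha> M] by (simp add: cyc_def)
    then show ?thesis using * by simp
  next
    case False
    have "\<alpha> + M = col \<alpha> + (\<alpha> div M + 1) * M"
      using div_mult_mod_eq[of \<alpha> M] False by (simp add: cyc_def algebra_simps)
    then show ?thesis using *[of "\<alpha> div M + 1"] by metis
  qed
  then show ?thesis by (simp only: vanishes_shift)
qed


definition fermi :: "nat \<Rightarrow> bool" where
  "fermi j \<longleftrightarrow> n \<ge> 1 \<and> (j = m \<or> j = M)"

definition crossing :: "nat \<Rightarrow> (nat \<times> nat) set \<Rightarrow> (nat \<times> nat \<Rightarrow> nat \<times> nat \<Rightarrow> complex) \<Rightarrow> complex" where
  "crossing N S \<phi> = (\<Prod>u\<in>S. \<Prod>w\<in>slots M N - S. \<phi> u w ^ link M (fst u) (fst w))"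

text \<open>
  The limit condition, for an arbitrary set \<open>S\<close> of scaled variables and on all of the torus, expressed by
  the numerator: \<open>A\<close> and \<open>B\<close> are its extreme coefficients in \<open>\<xi>\<close>, and the two \<open>crossing\<close> products are
  what remains, up to sign, of those of the denominator after cancelling common factors. The
  exact constant in the relation is replaced by an unspecified element of \<open>GG\<close>, since only this weaker
  form is stable under splitting off segments.
\<close>

definition balanced :: "nat \<Rightarrow> (point \<Rightarrow> complex) \<Rightarrow> (nat \<times> nat) set \<Rightarrow> nat \<Rightarrow> bool" where
  "balanced N f S b \<longleftrightarrow>
     (\<forall>x\<in>torus M N. \<exists>A B g. g \<in> GG \<and>
        ((\<lambda>\<xi>. f (scale_slots S \<xi> x) / \<xi> ^ (b + cross M N S)) \<longlongrightarrow> A) at_infinity \<and>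
        ((\<lambda>\<xi>. f (scale_slots S \<xi> x) / \<xi> ^ b) \<longlongrightarrow> B) (at 0) \<and>
        A * crossing N S (\<lambda>u w. at_slot x w) =
          B * crossing N S (\<lambda>u w. at_slot x u) * g * (\<Prod>u\<in>S. s (fst u)))"

definition depends_on_slots :: "nat \<Rightarrow> (point \<Rightarrow> complex) \<Rightarrow> bool" where
  "depends_on_slots N f \<longleftrightarrow>
     (\<forall>x x'. (\<forall>u\<in>slots M N. at_slot x u = at_slot x' u) \<longrightarrow> f x = f x')"

definition sign_symmetric :: "nat \<Rightarrow> (point \<Rightarrow> complex) \<Rightarrow> bool" where
  "sign_symmetric N f \<longleftrightarrow>
     (\<forall>i\<in>{1..M}. \<forall>\<pi>. \<pi> permutes {1..N} \<longrightarrow>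
        (\<exists>e\<in>{1, -1}. \<forall>x\<in>torus M N. f (x(i := x i \<circ> \<pi>)) = e * f x))"

definition fermi_vanishing :: "nat \<Rightarrow> (point \<Rightarrow> complex) \<Rightarrow> bool" where
  "fermi_vanishing N f \<longleftrightarrow>
     (\<forall>i\<in>{1..M}. \<forall>x\<in>torus M N. \<forall>a\<in>{1..N}. \<forall>b\<in>{1..N}.
        fermi i \<longrightarrow> a \<noteq> b \<longrightarrow> x i a = x i b \<longrightarrow> f x = 0)"

text \<open>
  The properties of numerators on which the induction runs.
\<close>

definition admissible :: "nat \<Rightarrow> (point \<Rightarrow> complex) \<Rightarrow> bool" where
  "admissible N f \<longleftrightarrow>
     depends_on_slots N f \<and> laurentian f \<and> sign_symmetric N f \<and> fermi_vanishing N f \<and>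
     wheel_conditions q d m n N f \<and> (\<forall>S. S \<subseteq> slots M N \<longrightarrow> (\<exists>b. balanced N f S b))"

lemma admissibleD:
  assumes "admissible N f"
  shows "depends_on_slots N f" "laurentian f" "sign_symmetric N f" "fermi_vanishing N f"
    "wheel_conditions q d m n N f" "\<And>S. S \<subseteq> slots M N \<Longrightarrow> \<exists>b. balanced N f S b"
  using assms by (auto simp: admissible_def)

lemma fermi_vanishingD:
  assumes "fermi_vanishing N f" "i \<in> {1..M}" "fermi i" "x \<in> torus M N" "a \<in> {1..N}" "b \<in> {1..N}"
    "a \<noteq> b" "x i a = x i b"
  shows "f x = 0"
  using assms unfolding fermi_vanishing_def by blast

subsection \<open>The zeros forced by a segment\<close>

text \<open>
  Consider a segment member of color \<open>j\<close> and value \<open>z\<close>, and an outside variable \<open>w\<close> of the same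
  color. Its predecessor in the segment, if there is one, gives a zero at \<open>w = q2 powi e * z\<close> with \<open>e\<close> as in
  \<open>zero_exponent_succ\<close>, and its successor one with \<open>e\<close> as in \<open>zero_exponent_pred\<close>. For the colors \<open>m\<close> and
  \<open>m + n\<close> one of the two zeros is due to skew symmetry and has \<open>e = 0\<close>; the other one comes from a wheel
  with four variables, which requires both neighbors, so that at the start of the segment the zero
  from skew symmetry takes its place.
\<close>

definition zero_exponent_succ :: "nat \<Rightarrow> int" where
  "zero_exponent_succ j = (if fermi j then 0 else if j \<le> m then 1 else - 1)"

definition zero_exponent_pred :: "bool \<Rightarrow> nat \<Rightarrow> int" where
  "zero_exponent_pred start j =
     (if fermi j then (if start then 0 else if j = m then 1 else - 1)
      else if j \<le> m then - 1 else 1)"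

text \<open>
  A pair \<open>(t, forward)\<close> stands for the position next to \<open>t\<close>, after or before it, where that position
  has the color \<open>j\<close> of an outside variable. Indexing the zeros by neighboring positions, and not by
  members of the same color, makes their number equal to the degree in \<open>y\<close> without further counting.
\<close>

definition attached :: "nat \<Rightarrow> nat \<Rightarrow> nat \<Rightarrow> (nat \<times> bool) set" where
  "attached \<alpha> len j =
     {(t, forward). t \<in> {\<alpha>..<\<alpha> + len} \<and>
        (if forward then col (Suc t) = j else col (Suc j) = col t)}"

text \<open>
  The outside variable divided by \<open>y\<close>, at the zero belonging to the pair. The exponent \<open>0\<close> occurs beyond
  the ends of the segment, where the zero means that the variable prolongs the segment.
\<close>

definition zero_ratio :: "nat \<Rightarrow> nat \<Rightarrow> nat \<times> bool \<Rightarrow> complex" where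
  "zero_ratio \<alpha> len k = (case k of (t, forward) \<Rightarrow>
     if forward then
       C (Suc t) * q2 q powi (if Suc t < \<alpha> + len then zero_exponent_succ (col (Suc t)) else 0)
     else
       C (t - 1) * q2 q powi
         (if \<alpha> < t then zero_exponent_pred (t - 1 = \<alpha>) (col (t - 1)) else 0))"

lemma zero_ratio_GG [intro, simp]: "zero_ratio \<alpha> len k \<in> GG"
  by (cases k) (auto simp: zero_ratio_def intro!: GG_mult GG_powi)

lemma zero_ratio_nz [simp]: "zero_ratio \<alpha> len k \<noteq> 0"
  using GG_nz[OF zero_ratio_GG] .

lemma finite_attached [simp, intro]: "finite (attached \<alpha> len j)"
  by (rule finite_subset[of _ "{\<alpha>..<\<alpha> + len} \<times> UNIV"]) (auto simp: attached_def)

lemma card_attached: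
  assumes "j \<in> {1..M}"
  shows "card (attached \<alpha> len j) = (\<Sum>t\<in>{\<alpha>..<\<alpha> + len}. link M (col t) j)"
proof -
  have "attached \<alpha> len j =
      (SIGMA t:{\<alpha>..<\<alpha> + len}. {fw. if fw then col (Suc t) = j else col (Suc j) = col t})"
    by (auto simp: attached_def)
  then have "card (attached \<alpha> len j) =
      (\<Sum>t\<in>{\<alpha>..<\<alpha> + len}. card {fw. if fw then col (Suc t) = j else col (Suc j) = col t})"
    by (simp add: card_SigmaI)
  also have "\<dots> = (\<Sum>t\<in>{\<alpha>..<\<alpha> + len}. link M (col t) j)"
  proof (intro sum.cong refl)
    fix t
    have "{fw. if fw then col (Suc t) = j else col (Suc j) = col t} =
        (if col (Suc t) = j then {True} else {}) \<union> (if col (Suc j) = col t then {False} else {})"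
      by (auto split: if_splits)
    then show "card {fw. if fw then col (Suc t) = j else col (Suc j) = col t} = link M (col t) j"
      by (auto simp: link_def)
  qed
  finally show ?thesis .
qed

lemma attached_pred_color:
  assumes "(t, False) \<in> attached \<alpha> len j" "1 \<le> \<alpha>" "j \<in> {1..M}"
  shows "col (t - 1) = j"
proof -
  have "t \<ge> 1" "col (Suc j) = col t" using assms(1,2) by (auto simp: attached_def)
  then have "col (Suc j) = col (Suc (t - 1))" by simp
  then have "col j = col (t - 1)" by (rule cyc_cancel_Suc)
  then show ?thesis using assms(3) by (simp add: cyc_id)
qed

text \<open>
  For a fixed color the zeros are simple: equal ratios have equal positions and equal exponents of
  \<open>q2\<close>, and an inner position gives two different exponents.
\<close>

lemma zero_ratio_inj:
  assumes "1 \<le> \<alpha>" "j \<in> {1..M}"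
  shows "inj_on (zero_ratio \<alpha> len) (attached \<alpha> len j)"
proof (rule inj_onI)
  fix k k' assume k: "k \<in> attached \<alpha> len j" "k' \<in> attached \<alpha> len j"
    and eq: "zero_ratio \<alpha> len k = zero_ratio \<alpha> len k'"
  obtain t fw where kt: "k = (t, fw)" by (cases k)
  obtain t' fw' where kt': "k' = (t', fw')" by (cases k')
  have colt: "col (if fw then Suc t else t - 1) = j"
    using k(1) attached_pred_color[OF _ assms] by (cases fw) (auto simp: kt attached_def)
  have colt': "col (if fw' then Suc t' else t' - 1) = j"
    using k(2) attached_pred_color[OF _ assms] by (cases fw') (auto simp: kt' attached_def)
  have rng: "\<alpha> \<le> t" "t < \<alpha> + len" "\<alpha> \<le> t'" "t' < \<alpha> + len"
    using k by (auto simp: kt kt' attached_def)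
  have mixed: False
    if "(u, True) \<in> attached \<alpha> len j" "(v, False) \<in> attached \<alpha> len j"
      "zero_ratio \<alpha> len (u, True) = zero_ratio \<alpha> len (v, False)" for u v
  proof -
    have c: "col (Suc u) = j" "col (v - 1) = j"
      using that(1) attached_pred_color[OF that(2) assms] by (auto simp: attached_def)
    have uv: "\<alpha> \<le> u" "u < \<alpha> + len" "\<alpha> \<le> v" "v < \<alpha> + len"
      using that by (auto simp: attached_def)
    have eq: "Suc u = v - 1"
      "(if Suc u < \<alpha> + len then zero_exponent_succ (col (Suc u)) else 0)
       = (if \<alpha> < v then zero_exponent_pred (v - 1 = \<alpha>) (col (v - 1)) else 0)"
      using C_inj[of "Suc u" "v - 1"] c that(3) by (auto simp: zero_ratio_def)
    moreover have v: "v = Suc (Suc u)" using eq(1) by linarith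
    ultimately have "zero_exponent_succ j = zero_exponent_pred False j"
      using uv c by auto
    then show False by (auto simp: zero_exponent_succ_def zero_exponent_pred_def split: if_splits)
  qed
  consider "fw" "fw'" | "\<not> fw" "\<not> fw'" | "fw" "\<not> fw'" | "\<not> fw" "fw'" by blast
  then show "k = k'"
  proof cases
    case 1
    then have "Suc t = Suc t'"
      using C_inj(1)[of "Suc t" "Suc t'"] colt colt' eq by (auto simp: zero_ratio_def kt kt')
    then show ?thesis using 1 by (simp add: kt kt')
  next
    case 2
    then have "t - 1 = t' - 1"
      using C_inj(1)[of "t - 1" "t' - 1"] colt colt' eq by (auto simp: zero_ratio_def kt kt')
    then show ?thesis using 2 rng assms(1) by (simp add: kt kt')
  next
    case 3
    then show ?thesis using mixed[of t t'] k eq by (auto simp: kt kt')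
  next
    case 4
    then show ?thesis using mixed[of t' t] k eq by (auto simp: kt kt')
  qed
qed

lemma wheel_conditionsD:
  assumes "wheel_conditions q d m n N f" "x \<in> torus M N" "a \<in> {1..N}" "b \<in> {1..N}"
    "c \<in> {1..N}" "e \<in> {1..N}" "on_wheel q d m n x a b c e"
  shows "f x = 0"
  using assms unfolding wheel_conditions_def by blast

lemma wheel_a_zero:
  assumes "wheel_conditions q d m n N f" "x \<in> torus M N" "a \<in> {1..N}" "b \<in> {1..N}" "c \<in> {1..N}"
    and "col (Suc t) \<le> m" "\<not> fermi (col (Suc t))"
    and "x (col (Suc t)) b = q3 q d * x (col t) a" "x (col (Suc t)) c = q2 q * x (col (Suc t)) b"
  shows "f x = 0"
proof (rule wheel_conditionsD[OF assms(1-5,3)])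
  define i where "i = col (Suc t)"
  have i: "i \<in> {1..m}" "n \<noteq> 0 \<Longrightarrow> i \<in> {1..<m}"
    using assms(6,7) col_range(1)[of "Suc t"] by (auto simp: fermi_def i_def)
  have c: "col i = col (Suc t)" "col (i - 1) = col t"
    using cyc_cyc_pred[OF M_pos] by (simp_all add: i_def)
  have "x (col i) b = q3 q d * x (col (i - 1)) a \<and> x (col i) c = q2 q * x (col i) b"
    by (simp only: c assms)
  then show "on_wheel q d m n x a b c a"
    unfolding on_wheel_def Let_def using i by (cases "n = 0") (simp_all only: if_True if_False simp_thms, blast+)
qed

lemma wheel_b_zero:
  assumes "wheel_conditions q d m n N f" "x \<in> torus M N" "a \<in> {1..N}" "b \<in> {1..N}" "c \<in> {1..N}"
    and "col t \<le> m" "\<not> fermi (col t)"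
    and "x (col t) b = q2 q * x (col t) a" "x (col (Suc t)) c = q3 q d * x (col t) b"
  shows "f x = 0"
proof (rule wheel_conditionsD[OF assms(1-5,3)])
  \<comment> \<open>For \<open>n = 0\<close> this wheel condition is indexed by \<open>0, ..., m - 1\<close>, with \<open>0\<close> standing for the color \<open>m\<close>.\<close>
  define i where "i = (if n = 0 \<and> col t = m then 0 else col t)"
  have i: "n = 0 \<Longrightarrow> i \<in> {0..<m}" "n \<noteq> 0 \<Longrightarrow> i \<in> {1..<m}"
    using assms(6,7) col_range(1)[of "t"] by (auto simp: fermi_def i_def)
  have ci: "col i = col t"
    using cyc_cyc[of M t] by (auto simp: i_def cyc_def)
  have c: "col i = col t" "col (i + 1) = col (Suc t)"
    using ci cyc_cyc_Suc[of M i] cyc_cyc_Suc[of M t] by simp_all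
  have "x (col i) b = q2 q * x (col i) a \<and> x (col (i + 1)) c = q3 q d * x (col i) b"
    by (simp only: c assms)
  then show "on_wheel q d m n x a b c a"
    unfolding on_wheel_def Let_def using i by (cases "n = 0") (simp_all only: if_True if_False simp_thms, blast+)
qed

lemma wheel_d_zero:
  assumes "wheel_conditions q d m n N f" "x \<in> torus M N" "a \<in> {1..N}" "b \<in> {1..N}" "c \<in> {1..N}"
    and "\<not> col (Suc t) \<le> m" "\<not> fermi (col (Suc t))"
    and "x (col (Suc t)) b = inverse (q3 q d) * x (col t) a"
      "x (col (Suc t)) c = inverse (q2 q) * x (col (Suc t)) b"
  shows "f x = 0"
proof (rule wheel_conditionsD[OF assms(1-5,3)])
  define i where "i = col (Suc t)"
  have i: "n \<noteq> 0" "i \<in> {m + 1..<m + n}"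
    using assms(6,7) col_range(2)[of "Suc t"] by (auto simp: fermi_def i_def)
  have c: "col i = col (Suc t)" "col (i - 1) = col t"
    using cyc_cyc_pred[OF M_pos] by (simp_all add: i_def)
  have "x (col i) b = inverse (q3 q d) * x (col (i - 1)) a \<and> x (col i) c = inverse (q2 q) * x (col i) b"
    by (simp only: c assms)
  then show "on_wheel q d m n x a b c a"
    unfolding on_wheel_def Let_def using i by (cases "n = 0") (simp_all only: if_True if_False simp_thms, blast+)
qed

lemma wheel_e_zero:
  assumes "wheel_conditions q d m n N f" "x \<in> torus M N" "a \<in> {1..N}" "b \<in> {1..N}" "c \<in> {1..N}"
    and "\<not> col t \<le> m" "\<not> fermi (col t)"
    and "x (col t) b = inverse (q2 q) * x (col t) a"
      "x (col (Suc t)) c = inverse (q3 q d) * x (col t) b"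
  shows "f x = 0"
proof (rule wheel_conditionsD[OF assms(1-5,3)])
  define i where "i = col t"
  have i: "n \<noteq> 0" "i \<in> {m + 1..<m + n}"
    using assms(6,7) col_range(2)[of "t"] by (auto simp: fermi_def i_def)
  have c: "col i = col t" "col (i + 1) = col (Suc t)" by (simp_all add: i_def)
  have "x (col i) b = inverse (q2 q) * x (col i) a \<and> x (col (i + 1)) c = inverse (q3 q d) * x (col i) b"
    by (simp only: c assms)
  then show "on_wheel q d m n x a b c a"
    unfolding on_wheel_def Let_def using i by (cases "n = 0") (simp_all only: if_True if_False simp_thms, blast+)
qed

lemma wheel_c_zero:
  assumes "wheel_conditions q d m n N f" "x \<in> torus M N" "a \<in> {1..N}" "b \<in> {1..N}" "c \<in> {1..N}" "e \<in> {1..N}"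
    and "n \<ge> 1" "col (Suc t) = m"
    and "x (col (Suc t)) b = q3 q d * x (col t) a"
      "x (col (Suc (Suc t))) c = inverse (q3 q d) * x (col (Suc t)) b"
      "x (col (Suc t)) e = inverse (q1 q d) * x (col (Suc (Suc t))) c"
  shows "f x = 0"
proof (rule wheel_conditionsD[OF assms(1-6)])
  have i: "n \<noteq> 0" using assms(7) by simp
  have c: "col m = col (Suc t)" "col (m - 1) = col t" "col (m + 1) = col (Suc (Suc t))"
    using assms(8) cyc_cyc_pred[OF M_pos, of t] cyc_cyc_Suc[of M "Suc t"] cyc_cyc[of M "Suc t"] by auto
  have "x (col m) b = q3 q d * x (col (m - 1)) a \<and> x (col (m + 1)) c = inverse (q3 q d) * x (col m) b \<and> x (col m) e = inverse (q1 q d) * x (col (m + 1)) c"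
    unfolding c using assms(9-11) by blast
  then show "on_wheel q d m n x a b c e"
    unfolding on_wheel_def Let_def by (simp only: i if_False simp_thms)
qed

lemma wheel_f_zero:
  assumes "wheel_conditions q d m n N f" "x \<in> torus M N" "a \<in> {1..N}" "b \<in> {1..N}" "c \<in> {1..N}" "e \<in> {1..N}"
    and "n \<ge> 1" "col (Suc t) = M"
    and "x (col (Suc t)) b = inverse (q3 q d) * x (col t) a"
      "x (col (Suc (Suc t))) c = q3 q d * x (col (Suc t)) b"
      "x (col (Suc t)) e = q1 q d * x (col (Suc (Suc t))) c"
  shows "f x = 0"
proof (rule wheel_conditionsD[OF assms(1-6)])
  have i: "n \<noteq> 0" using assms(7) by simp
  have c: "col (m + n) = col (Suc t)" "col (m + n - 1) = col t" "col 1 = col (Suc (Suc t))"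
    using assms(8) cyc_cyc_pred[OF M_pos, of t] cyc_cyc[of M "Suc t"] cyc_cyc_Suc[of M "Suc t"]
      cyc_add_period[of M 1] by auto
  have "x (col (m + n)) b = inverse (q3 q d) * x (col (m + n - 1)) a \<and> x (col 1) c = q3 q d * x (col (m + n)) b \<and> x (col (m + n)) e = q1 q d * x (col 1) c"
    unfolding c using assms(9-11) by blast
  then show "on_wheel q d m n x a b c e"
    unfolding on_wheel_def Let_def by (simp only: i if_False simp_thms)
qed

text \<open>
  Every attached pair really gives a zero. The proof goes through the cases: prolongation of the segment
  at either end, skew symmetry, and one wheel condition for each kind of color and each direction.
\<close>

lemma segment_zero:
  assumes adm: "admissible N f" and van: "\<And>\<beta>. vanishes N f \<beta> (Suc len)" and "1 \<le> \<alpha>"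
    and x: "x \<in> torus M N" and seg: "carries N x \<alpha> len y a" and y: "y \<noteq> 0"
    and w: "w \<in> slots M N - seg_slots \<alpha> len a"
    and k: "k \<in> attached \<alpha> len (fst w)"
    and eq: "at_slot x w = y * zero_ratio \<alpha> len k"
  shows "f x = 0"
proof -
  obtain j b where wjb: "w = (j, b)" by (cases w)
  have j: "j \<in> {1..M}" and b: "b \<in> {1..N}" using w by (auto simp: wjb slots_def)
  note wheel = admissibleD(5)[OF adm]
  have pos [simp]: "Suc 0 \<le> a r" "a r \<le> N" if "\<alpha> \<le> r" "r < \<alpha> + len" for r
    using carriesD(1,2)[OF seg that] by simp_all
  have on_seg [simp]: "x i (a r) = y * C r" if "\<alpha> \<le> r" "r < \<alpha> + len" "col r = i" for r i
    using carriesD(4)[OF seg that(1,2)] that(3) by simp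
  have val: "x j b = y * zero_ratio \<alpha> len k" using eq by (simp add: wjb at_slot_def)
  obtain t fw where kt: "k = (t, fw)" by (cases k)
  have t: "\<alpha> \<le> t" "t < \<alpha> + len" using k by (auto simp: kt attached_def)
  have q123: "q1 q d * q3 q d * q2 q = 1"
    using q_nz d_nz by (simp add: q1_def q2_def q3_def power2_eq_square field_simps)
  have outside: "b \<noteq> a r" if "\<alpha> \<le> r" "r < \<alpha> + len" "col r = j" for r
    using w that by (auto simp: wjb seg_slots_def)
  have skew: "f x = 0" if "\<alpha> \<le> r" "r < \<alpha> + len" "col r = j" "fermi j" "x j b = y * C r" for r
    using fermi_vanishingD[OF admissibleD(4)[OF adm] j \<open>fermi j\<close> x b, of "a r"]
      outside[OF that(1-3)] carriesD(3,4)[OF seg that(1,2)] that by simp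
  show ?thesis
  proof (cases fw)
    case True
    have cj: "col (Suc t) = j" using k True by (auto simp: kt wjb attached_def)
    show ?thesis
    proof (cases "Suc t < \<alpha> + len")
      case False
      then have last: "Suc t = \<alpha> + len" using t by simp
      have "x j b = y * C (Suc t)" using val True False by (simp add: kt zero_ratio_def)
      then have "carries N x \<alpha> (Suc len) y (a(Suc t := b))"
        using seg b cj last by (auto simp: carries_def less_Suc_eq)
      then show ?thesis using van x unfolding vanishes_def by blast
    next
      case inside: True
      have val': "x j b = y * (C (Suc t) * q2 q powi zero_exponent_succ j)"
        using val True inside cj by (simp add: kt zero_ratio_def)
      show ?thesis
      proof (cases "fermi j")
        case fermi: True
        then show ?thesis using skew[of "Suc t"] t inside cj val' by (simp add: zero_exponent_succ_def)
      next
        case nofermi: False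
        show ?thesis
        proof (cases "j \<le> m")
          case True
          show ?thesis
            by (rule wheel_a_zero[OF wheel x _ _ b, of "a t" "a (Suc t)" t])
               (use t inside cj nofermi True val' in
                 \<open>simp_all add: zero_exponent_succ_def C_Suc del: cyc_cyc_Suc\<close>)
        next
          case False
          show ?thesis
            by (rule wheel_d_zero[OF wheel x _ _ b, of "a t" "a (Suc t)" t])
               (use t inside cj nofermi False val' in
                 \<open>simp_all add: zero_exponent_succ_def C_Suc power_int_minus del: cyc_cyc_Suc\<close>)
        qed
      qed
    qed
  next
    case False
    define r where "r = t - 1"
    have tr: "t = Suc r" using t assms(3) by (simp add: r_def)
    have cj: "col r = j"
      using attached_pred_color[of t \<alpha> len j] k False assms(3) j by (auto simp: kt wjb r_def)
    show ?thesis
    proof (cases "\<alpha> < t")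
      case False
      then have first: "t = \<alpha>" "\<alpha> = Suc r" using t tr by auto
      have "x j b = y * C r" using val \<open>\<not> fw\<close> False by (simp add: kt zero_ratio_def tr)
      then have "carries N x r (Suc len) y (a(r := b))"
        using seg b cj first by (auto simp: carries_def)
      then show ?thesis using van x unfolding vanishes_def by blast
    next
      case inside: True
      have val': "x j b = y * (C r * q2 q powi zero_exponent_pred (r = \<alpha>) j)"
        using val False inside cj by (simp add: kt zero_ratio_def tr)
      have r: "\<alpha> \<le> r" "r < \<alpha> + len" using inside t tr by auto
      show ?thesis
      proof (cases "fermi j")
        case nofermi: False
        show ?thesis
        proof (cases "j \<le> m")
          case True
          have Cstep: "C (Suc r) = q3 q d * C r"
          proof -
            have "col (Suc r) \<le> m"
            proof (cases "n = 0")
              case True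
              then show ?thesis using col_range(2)[of "Suc r"] by simp
            next
              case False
              then have "j < m" using \<open>j \<le> m\<close> nofermi by (auto simp: fermi_def)
              then have "col (Suc j) = Suc j" by (intro cyc_id) auto
              then show ?thesis using \<open>j < m\<close> cj by (metis Suc_leI cyc_cyc_Suc)
            qed
            then show ?thesis by (simp add: C_Suc)
          qed
          show ?thesis
            by (rule wheel_b_zero[OF wheel x b, of "a r" "a t" r])
               (use t r tr cj nofermi True val' Cstep in
                 \<open>simp_all add: zero_exponent_pred_def power_int_minus del: cyc_cyc_Suc\<close>)
        next
          case False
          have Cstep: "C (Suc r) = inverse (q3 q d) * C r"
          proof -
            have "j < M" using False nofermi j by (auto simp: fermi_def)
            then have "col (Suc j) = Suc j" by (intro cyc_id) auto
            then have "\<not> col (Suc r) \<le> m" using False cj by (metis cyc_cyc_Suc Suc_leD)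
            then show ?thesis by (simp add: C_Suc)
          qed
          show ?thesis
            by (rule wheel_e_zero[OF wheel x b, of "a r" "a t" r])
               (use t r tr cj nofermi False val' Cstep in
                 \<open>simp_all add: zero_exponent_pred_def power_int_minus del: cyc_cyc_Suc\<close>)
        qed
      next
        case fermi: True
        then have n1: "n \<ge> 1" by (simp add: fermi_def)
        show ?thesis
        proof (cases "r = \<alpha>")
          case True
          then show ?thesis using skew[of r] r cj fermi val' by (simp add: zero_exponent_pred_def)
        next
          case notfirst: False
          define p where "p = r - 1"
          have rp: "r = Suc p" "\<alpha> \<le> p" "p < \<alpha> + len" using notfirst r assms(3) by (auto simp: p_def)
          show ?thesis
          proof (cases "j = m")
            case True
            have cm: "col (Suc p) = m" using cj rp True by simp
            have "col (Suc m) = Suc m" using n1 by (intro cyc_id) auto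
            then have "col (Suc (Suc p)) = Suc m" using cm by (metis cyc_cyc_Suc)
            then have C1: "C (Suc (Suc p)) = inverse (q3 q d) * C (Suc p)"
              "C (Suc p) = q3 q d * C p" using cm by (simp_all add: C_Suc)
            have "q2 q = inverse (q1 q d) * inverse (q3 q d)"
              using q123 by (simp add: field_simps)
            then show ?thesis
              by (intro wheel_c_zero[OF wheel x _ _ _ b, of "a p" "a r" "a t" p])
                 (use t r rp tr cj n1 cm True val' C1 fermi notfirst in
                   \<open>simp_all add: zero_exponent_pred_def mult_ac del: cyc_cyc_Suc\<close>)
          next
            case False
            then have jM: "j = M" using fermi by (auto simp: fermi_def)
            have cm: "col (Suc p) = M" using cj rp jM by simp
            have "col (Suc (Suc p)) = col (Suc M)" using cm by (metis cyc_cyc_Suc)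
            also have "\<dots> = 1" using cyc_add_period[of M 1] cyc_id[of 1 M] m_pos by simp
            finally have C1: "C (Suc (Suc p)) = q3 q d * C (Suc p)"
              "C (Suc p) = inverse (q3 q d) * C p" using cm n1 m_pos by (simp_all add: C_Suc)
            have "inverse (q2 q) = q1 q d * q3 q d"
              using q123 by (simp add: field_simps)
            then show ?thesis
              by (intro wheel_f_zero[OF wheel x _ _ _ b, of "a p" "a r" "a t" p])
                 (use t r rp tr cj n1 cm False jM val' C1 fermi notfirst in
                   \<open>simp_all add: zero_exponent_pred_def power_int_minus mult_ac del: cyc_cyc_Suc\<close>)
          qed
        qed
      qed
    qed
  qed
qed

end

section \<open>Factorization along a segment\<close>

lemma scale_slots_twist_commute:
  "scale_slots S y (twist e \<xi> x) = twist e \<xi> (scale_slots S y x)"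
  by (auto simp: scale_slots_def twist_def fun_eq_iff)

lemma laurentian_scale_slots:
  assumes "laurentian f"
  shows "laurentian (\<lambda>x. f (scale_slots S y x))"
  using assms unfolding laurentian_def scale_slots_twist_commute by blast

lemma laurentian_at_slot [intro]: "laurentian (\<lambda>x. at_slot x u)"
  unfolding at_slot_def by (rule laurentian_coordinate)

lemma at_infinity_nontrivial: "(at_infinity :: complex filter) \<noteq> bot"
proof
  assume "(at_infinity :: complex filter) = bot"
  then have "at (0 :: complex) = bot" unfolding at_to_infinity by simp
  then show False by simp
qed

lemma tendsto_shifted_ratio: "((\<lambda>\<xi>. (\<xi> - r) / \<xi>) \<longlongrightarrow> 1) (at_infinity :: complex filter)"
proof -
  have "((\<lambda>\<xi>. 1 - r * inverse \<xi>) \<longlongrightarrow> 1 - r * 0) (at_infinity :: complex filter)"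
    by (intro tendsto_intros tendsto_inverse_0)
  moreover have "eventually (\<lambda>\<xi>. 1 - r * inverse \<xi> = (\<xi> - r) / \<xi>) (at_infinity :: complex filter)"
    using eventually_not_equal_at_infinity[of 0] by eventually_elim (simp add: field_simps)
  ultimately show ?thesis by (simp add: tendsto_cong)
qed

lemma scaling_polynomial:
  fixes f :: "complex \<Rightarrow> complex"
  assumes P: "\<And>\<xi>. \<xi> \<noteq> 0 \<Longrightarrow> f \<xi> = poly P \<xi> / \<xi> ^ j"
    and inf: "((\<lambda>\<xi>. f \<xi> / \<xi> ^ (b + c)) \<longlongrightarrow> A) at_infinity"
    and zero: "((\<lambda>\<xi>. f \<xi> / \<xi> ^ b) \<longlongrightarrow> B) (at 0)"
  shows "\<exists>p. degree p \<le> c \<and> (\<forall>\<xi>. \<xi> \<noteq> 0 \<longrightarrow> f \<xi> = \<xi> ^ b * poly p \<xi>)"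
proof -
  have "eventually (\<lambda>\<xi>. f \<xi> / \<xi> ^ b = poly P \<xi> / \<xi> ^ (j + b)) (at 0)"
    using eventually_neq_at_within[of 0 0 UNIV] by eventually_elim (simp add: P power_add)
  then have "((\<lambda>\<xi>. poly P \<xi> / \<xi> ^ (j + b)) \<longlongrightarrow> B) (at 0)"
    using zero by (simp add: tendsto_cong)
  then obtain p where p: "P = monom 1 (j + b) * p"
    using poly_zero_order_of_limit by (metis dvdE)
  have fp: "f \<xi> = \<xi> ^ b * poly p \<xi>" if "\<xi> \<noteq> 0" for \<xi>
    using that by (simp add: P p poly_monom power_add)
  have "eventually (\<lambda>\<xi>. f \<xi> / \<xi> ^ (b + c) = poly p \<xi> / \<xi> ^ c) at_infinity"
    using eventually_not_equal_at_infinity[of 0] by eventually_elim (simp add: fp power_add)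
  then have "((\<lambda>\<xi>. poly p \<xi> / \<xi> ^ c) \<longlongrightarrow> A) at_infinity"
    using inf by (simp add: tendsto_cong)
  then have "degree p \<le> c" by (rule poly_degree_of_limit)
  with fp show ?thesis by blast
qed

context shuffle_parameters
begin

definition seg_factor ::
  "(nat \<times> nat) set \<Rightarrow> nat \<Rightarrow> nat \<Rightarrow> point \<Rightarrow> complex \<Rightarrow> complex" where
  "seg_factor W \<alpha> len x y =
     (\<Prod>w\<in>W. \<Prod>k\<in>attached \<alpha> len (fst w). y - at_slot x w / zero_ratio \<alpha> len k)"

lemma laurentian_seg_factor [intro]: "laurentian (\<lambda>x. seg_factor W \<alpha> len x y)"
  unfolding seg_factor_def divide_inverse
  by (intro laurentian_prod laurentian_diff laurentian_mult laurentian_at_slot laurentian_const)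

lemma seg_factor_nonzero_iff:
  assumes "finite W"
  shows "seg_factor W \<alpha> len x y \<noteq> 0 \<longleftrightarrow>
    (\<forall>w\<in>W. \<forall>k\<in>attached \<alpha> len (fst w). y \<noteq> at_slot x w / zero_ratio \<alpha> len k)"
  using assms by (auto simp: seg_factor_def)

lemma seg_factor_avoid:
  assumes "finite X" "finite W"
  shows "\<exists>y. y \<noteq> 0 \<and> (\<forall>x\<in>X. seg_factor W \<alpha> len x y \<noteq> 0)"
proof -
  let ?R = "insert 0 (\<Union>x\<in>X. \<Union>w\<in>W. (\<lambda>k. at_slot x w / zero_ratio \<alpha> len k) ` attached \<alpha> len (fst w))"
  have "finite ?R" using assms by auto
  then obtain y where "y \<notin> ?R" using ex_new_if_finite[OF infinite_UNIV_char_0] by blast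
  then show ?thesis
    unfolding seg_factor_nonzero_iff[OF assms(2)] by (intro exI[of _ y]) blast
qed

lemma sum_card_attached:
  assumes "inj_on (\<lambda>t. (col t, a t)) {\<alpha>..<\<alpha> + len}" "j \<in> {1..M}"
  shows "(\<Sum>u\<in>seg_slots \<alpha> len a. link M (fst u) j) = card (attached \<alpha> len j)"
  unfolding seg_slots_def card_attached[OF assms(2)] by (subst sum.reindex[OF assms(1)]) simp

lemma cross_seg:
  assumes "inj_on (\<lambda>t. (col t, a t)) {\<alpha>..<\<alpha> + len}"
  shows "cross M N (seg_slots \<alpha> len a) =
    (\<Sum>w\<in>slots M N - seg_slots \<alpha> len a. card (attached \<alpha> len (fst w)))"
  unfolding cross_def
  by (subst sum.swap, intro sum.cong refl sum_card_attached[OF assms]) (auto simp: slots_def)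

lemma crossing_seg:
  assumes "inj_on (\<lambda>t. (col t, a t)) {\<alpha>..<\<alpha> + len}"
  shows "crossing N (seg_slots \<alpha> len a) (\<lambda>u w. \<phi> w) =
    (\<Prod>w\<in>slots M N - seg_slots \<alpha> len a. \<phi> w ^ card (attached \<alpha> len (fst w)))"
  unfolding crossing_def
proof (subst prod.swap, intro prod.cong refl)
  fix w assume "w \<in> slots M N - seg_slots \<alpha> len a"
  then have "fst w \<in> {1..M}" by (auto simp: slots_def)
  then show "(\<Prod>u\<in>seg_slots \<alpha> len a. \<phi> w ^ link M (fst u) (fst w))
      = \<phi> w ^ card (attached \<alpha> len (fst w))"
    by (simp flip: power_sum add: sum_card_attached[OF assms])
qed

lemma carries_scale:
  assumes "carries N x \<alpha> len y a" "z \<noteq> 0"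
  shows "carries N (scale_slots (seg_slots \<alpha> len a) z x) \<alpha> len (z * y) a"
  using assms by (auto simp: carries_def scale_slots_def seg_slots_def)

text \<open>
  Degree and number of zeros agree. The genericity hypothesis keeps the zeros attached to different
  outside variables apart; those attached to the same variable are distinct by \<open>zero_ratio_inj\<close>.
\<close>

lemma segment_factorization_generic:
  assumes adm: "admissible N f" and van: "\<And>\<beta>. vanishes N f \<beta> (Suc len)"
    and \<alpha>: "1 \<le> \<alpha>" and x: "x \<in> torus M N" and seg: "carries N x \<alpha> len 1 a"
    and bal: "balanced N f (seg_slots \<alpha> len a) b"
    and gen: "\<And>w w' k k'. w \<in> slots M N \<Longrightarrow> w' \<in> slots M N \<Longrightarrow> w \<notin> seg_slots \<alpha> len a \<Longrightarrow>
      w' \<notin> seg_slots \<alpha> len a \<Longrightarrow> w \<noteq> w' \<Longrightarrow> k \<in> attached \<alpha> len (fst w) \<Longrightarrow>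
      k' \<in> attached \<alpha> len (fst w') \<Longrightarrow>
      at_slot x w / zero_ratio \<alpha> len k \<noteq> at_slot x w' / zero_ratio \<alpha> len k'"
  shows "\<exists>g. \<forall>y. y \<noteq> 0 \<longrightarrow> f (scale_slots (seg_slots \<alpha> len a) y x) =
    g * y ^ b * seg_factor (slots M N - seg_slots \<alpha> len a) \<alpha> len x y"
proof -
  let ?l = "seg_slots \<alpha> len a" let ?W = "slots M N - ?l"
  let ?c = "cross M N ?l"
  note inj = carries_inj[OF seg, simplified]
  obtain A B where lims:
      "((\<lambda>\<xi>. f (scale_slots ?l \<xi> x) / \<xi> ^ (b + ?c)) \<longlongrightarrow> A) at_infinity"
      "((\<lambda>\<xi>. f (scale_slots ?l \<xi> x) / \<xi> ^ b) \<longlongrightarrow> B) (at 0)"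
    using bal x unfolding balanced_def by blast
  obtain P j where "\<And>\<xi>. \<xi> \<noteq> 0 \<Longrightarrow> f (scale_slots ?l \<xi> x) = poly P \<xi> / \<xi> ^ j"
    unfolding scale_slots_twist using admissibleD(2)[OF adm] by (rule laurentianE) blast
  from scaling_polynomial[OF this lims] obtain p
    where p: "degree p \<le> ?c" "\<And>y. y \<noteq> 0 \<Longrightarrow> f (scale_slots ?l y x) = y ^ b * poly p y"
    by blast
  define I where "I = (SIGMA w:?W. attached \<alpha> len (fst w))"
  define root where "root = (\<lambda>(w, k). at_slot x w / zero_ratio \<alpha> len k)"
  have finI: "finite I" by (auto simp: I_def)
  have nz: "at_slot x w \<noteq> 0" if "w \<in> ?W" for w using x that by (auto simp: torus_iff)
  have injr: "inj_on root I"
  proof (rule inj_onI)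
    fix v v' assume v: "v \<in> I" "v' \<in> I" "root v = root v'"
    obtain w k w' k' where vv: "v = (w, k)" "v' = (w', k')" by (cases v, cases v')
    have w: "w \<in> ?W" "w' \<in> ?W" "k \<in> attached \<alpha> len (fst w)" "k' \<in> attached \<alpha> len (fst w')"
      using v by (auto simp: I_def vv)
    have ww: "w = w'" using gen[of w w' k k'] w v(3) by (auto simp: root_def vv)
    moreover have "zero_ratio \<alpha> len k = zero_ratio \<alpha> len k'"
      using v(3) nz[OF w(1)] ww by (simp add: root_def vv)
    moreover have "fst w \<in> {1..M}" using w(1) by (auto simp: slots_def)
    ultimately have "k = k'"
      using inj_onD[OF zero_ratio_inj[OF \<alpha>, of "fst w" len], of k k'] w by blast
    with ww show "v = v'" by (simp add: vv)
  qed
  have "card I = ?c"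
    unfolding I_def cross_seg[OF inj] by (subst card_SigmaI) auto
  then have card: "card (root ` I) = ?c" by (simp add: card_image[OF injr])
  have zeros: "poly p r = 0" if "r \<in> root ` I" for r
  proof -
    from that obtain w k where w: "w \<in> ?W" "k \<in> attached \<alpha> len (fst w)"
      "r = at_slot x w / zero_ratio \<alpha> len k" by (auto simp: I_def root_def)
    have r: "r \<noteq> 0" using w nz by simp
    have "f (scale_slots ?l r x) = 0"
    proof (rule segment_zero[OF adm van \<alpha> scale_slots_torus[OF x r] _ r w(1,2)])
      show "carries N (scale_slots ?l r x) \<alpha> len r a"
        using carries_scale[OF seg r] by simp
      show "at_slot (scale_slots ?l r x) w = r * zero_ratio \<alpha> len k"
        using w by (auto simp: at_slot_scale)
    qed
    then show ?thesis using p(2)[OF r] r by simp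
  qed
  have pp: "p = smult (coeff p ?c) (\<Prod>r\<in>root ` I. [:- r, 1:])"
    using poly_eq_prod_roots[of "root ` I" p] finI p(1) card zeros by auto
  have "poly p y = coeff p ?c * (\<Prod>r\<in>root ` I. y - r)" for y
    using arg_cong[OF pp, of "\<lambda>p. poly p y"] by (simp add: poly_prod)
  moreover have "(\<Prod>r\<in>root ` I. y - r) = seg_factor ?W \<alpha> len x y" for y
  proof -
    have "(\<Prod>r\<in>root ` I. y - r) = (\<Prod>v\<in>I. y - root v)"
      by (subst prod.reindex[OF injr]) simp
    also have "\<dots> = seg_factor ?W \<alpha> len x y"
      unfolding seg_factor_def I_def root_def by (subst prod.Sigma) (auto simp: case_prod_unfold)
    finally show ?thesis .
  qed
  ultimately show ?thesis
    using p(2) by (intro exI[of _ "coeff p ?c"]) (simp add: mult_ac)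
qed

text \<open>
  The general case follows by continuity. The outside variables are moved along a curve and the segment
  is kept fixed, so the genericity hypothesis holds near the point, and the coefficient \<open>g\<close> is eliminated
  by comparing with a value \<open>y1\<close> at which the product does not vanish.
\<close>

lemma segment_factorization:
  assumes adm: "admissible N f" and van: "\<And>\<beta>. vanishes N f \<beta> (Suc len)"
    and \<alpha>: "1 \<le> \<alpha>" and x: "x \<in> torus M N" and seg: "carries N x \<alpha> len 1 a"
    and bal: "balanced N f (seg_slots \<alpha> len a) b"
  shows "\<exists>g. \<forall>y. y \<noteq> 0 \<longrightarrow> f (scale_slots (seg_slots \<alpha> len a) y x) =
    g * y ^ b * seg_factor (slots M N - seg_slots \<alpha> len a) \<alpha> len x y"
proof -
  let ?l = "seg_slots \<alpha> len a" let ?W = "slots M N - ?l"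
  \<comment> \<open>The exponent 0 keeps the segment in place.\<close>
  define e where "e = (\<lambda>i b. if (i, b) \<in> ?l then 0 else spread N i b)"
  obtain y1 where y1: "y1 \<noteq> 0" "seg_factor ?W \<alpha> len x y1 \<noteq> 0"
    using seg_factor_avoid[of "{x}" ?W \<alpha> len] by auto
  have ev1: "\<forall>\<^sub>F \<xi> in at 1. \<forall>v\<in>(?W \<times> ?W) - Id. \<forall>k\<in>attached \<alpha> len (fst (fst v)).
      \<forall>k'\<in>attached \<alpha> len (fst (snd v)).
      at_slot (twist e \<xi> x) (fst v) / zero_ratio \<alpha> len k \<noteq> at_slot (twist e \<xi> x) (snd v) / zero_ratio \<alpha> len k'"
  proof (intro eventually_ball_finite ballI)
    fix v k k' assume v: "v \<in> (?W \<times> ?W) - Id"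
    obtain w w' where vw: "v = (w, w')" by (cases v)
    have "at_slot x w / zero_ratio \<alpha> len k \<noteq> 0" using v x by (auto simp: vw torus_iff)
    moreover have "e (fst w) (snd w) \<noteq> e (fst w') (snd w')"
      using v spread_inj[of "snd w" N "snd w'" "fst w" "fst w'"]
      by (auto simp: vw e_def slots_def prod_eq_iff)
    ultimately have "\<forall>\<^sub>F \<xi> in at 1. \<xi> ^ e (fst w) (snd w) * (at_slot x w / zero_ratio \<alpha> len k)
        \<noteq> \<xi> ^ e (fst w') (snd w') * (at_slot x w' / zero_ratio \<alpha> len k')"
      by (rule eventually_powers_differ)
    then show "\<forall>\<^sub>F \<xi> in at 1. at_slot (twist e \<xi> x) (fst v) / zero_ratio \<alpha> len k
        \<noteq> at_slot (twist e \<xi> x) (snd v) / zero_ratio \<alpha> len k'"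
      by (simp add: vw at_slot_twist)
  qed auto
  have fac: "\<forall>\<^sub>F \<xi> in at 1. \<exists>g. \<forall>y. y \<noteq> 0 \<longrightarrow> f (scale_slots ?l y (twist e \<xi> x)) =
      g * y ^ b * seg_factor ?W \<alpha> len (twist e \<xi> x) y"
    using ev1 eventually_neq_at_within[of 0 1 UNIV]
  proof eventually_elim
    case (elim \<xi>)
    have "carries N (twist e \<xi> x) \<alpha> len 1 a"
      using seg by (auto simp: carries_def twist_def e_def seg_slots_def)
    then show ?case
    proof (rule segment_factorization_generic[OF adm van \<alpha> twist_torus[OF x elim(2)] _ bal], goal_cases)
      case (1 w w' k k')
      then show ?case using bspec[OF elim(1), of "(w, w')"] by simp
    qed
  qed
  have "f (scale_slots ?l y x) * (y1 ^ b * seg_factor ?W \<alpha> len x y1)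
      = f (scale_slots ?l y1 x) * (y ^ b * seg_factor ?W \<alpha> len x y)" if y: "y \<noteq> 0" for y
  proof (rule laurentian_eqI[where x = x and e = e])
    show "\<forall>\<^sub>F \<xi> in at 1. f (scale_slots ?l y (twist e \<xi> x)) * (y1 ^ b * seg_factor ?W \<alpha> len (twist e \<xi> x) y1)
      = f (scale_slots ?l y1 (twist e \<xi> x)) * (y ^ b * seg_factor ?W \<alpha> len (twist e \<xi> x) y)"
      using fac
    proof eventually_elim
      case (elim \<xi>)
      then obtain g where "\<And>y. y \<noteq> 0 \<Longrightarrow> f (scale_slots ?l y (twist e \<xi> x)) =
          g * y ^ b * seg_factor ?W \<alpha> len (twist e \<xi> x) y" by blast
      then show ?case using y y1(1) by simp
    qed
  qed (rule laurentian_mult[OF laurentian_scale_slots[OF admissibleD(2)[OF adm]]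
      laurentian_mult[OF laurentian_const laurentian_seg_factor]])+
  then show ?thesis
    using y1 by (intro exI[of _ "f (scale_slots ?l y1 x) / (y1 ^ b * seg_factor ?W \<alpha> len x y1)"])
      (simp add: field_simps)
qed

subsection \<open>Only segments of length divisible by the number of colors survive\<close>

lemma seg_factor_at_infinity:
  assumes "finite W"
  shows "((\<lambda>\<xi>. seg_factor W \<alpha> len x \<xi> / \<xi> ^ (\<Sum>w\<in>W. card (attached \<alpha> len (fst w)))) \<longlongrightarrow> 1) at_infinity"
proof -
  have "seg_factor W \<alpha> len x \<xi> / \<xi> ^ (\<Sum>w\<in>W. card (attached \<alpha> len (fst w)))
     = (\<Prod>w\<in>W. \<Prod>k\<in>attached \<alpha> len (fst w). (\<xi> - at_slot x w / zero_ratio \<alpha> len k) / \<xi>)" for \<xi>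
    by (simp add: seg_factor_def prod_dividef power_sum)
  moreover have "((\<lambda>\<xi>. \<Prod>w\<in>W. \<Prod>k\<in>attached \<alpha> len (fst w).
      (\<xi> - at_slot x w / zero_ratio \<alpha> len k) / \<xi>) \<longlongrightarrow> (\<Prod>w\<in>W. \<Prod>k\<in>attached \<alpha> len (fst w). 1)) at_infinity"
    by (intro tendsto_prod tendsto_shifted_ratio)
  ultimately show ?thesis by simp
qed

lemma seg_factor_at_zero:
  "((\<lambda>\<xi>. seg_factor W \<alpha> len x \<xi>) \<longlongrightarrow> seg_factor W \<alpha> len x 0) (at 0)"
  unfolding seg_factor_def by (intro tendsto_intros)

lemma seg_factor_0:
  "seg_factor W \<alpha> len x 0 = (\<Prod>w\<in>W. at_slot x w ^ card (attached \<alpha> len (fst w))) *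
     (\<Prod>w\<in>W. \<Prod>k\<in>attached \<alpha> len (fst w). - inverse (zero_ratio \<alpha> len k))"
  by (simp add: seg_factor_def divide_inverse flip: prod.distrib)
     (simp add: prod.distrib flip: prod_constant mult_minus_right)

text \<open>
  Since the product of all \<open>s i\<close> is \<open>1\<close>, the last one can be eliminated; genericity then says that every
  color occurs as often in the segment as the last one.
\<close>

lemma generic_segment_length:
  assumes g: "g \<in> GG" and eq: "g * (\<Prod>t\<in>{\<alpha>..<\<alpha> + len}. s (col t)) = 1"
  shows "M dvd len"
proof -
  define k where "k i = card {t \<in> {\<alpha>..<\<alpha> + len}. col t = i}" for i
  obtain a b where ab: "g ^ 2 = q1 q d powi a * q2 q powi b" using g by (auto simp: GG_def)
  have img: "col ` {\<alpha>..<\<alpha> + len} \<subseteq> {1..M}" using col_range by auto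
  have "(\<Prod>t\<in>{\<alpha>..<\<alpha> + len}. s (col t)) = (\<Prod>i\<in>{1..M}. \<Prod>t\<in>{t \<in> {\<alpha>..<\<alpha> + len}. col t = i}. s (col t))"
    by (rule prod.group[symmetric]) (use img in auto)
  also have "\<dots> = (\<Prod>i\<in>{1..M}. s i ^ k i)"
    by (intro prod.cong refl) (simp add: k_def)
  finally have prod: "(\<Prod>t\<in>{\<alpha>..<\<alpha> + len}. s (col t)) = (\<Prod>i\<in>{1..M}. s i ^ k i)" .
  have ins: "{1..M} = insert M {1..<M}" using m_pos by auto
  have sM: "s M = inverse (\<Prod>i\<in>{1..<M}. s i)"
    using s_prod unfolding ins by (simp add: inverse_unique mult.commute)
  have "(\<Prod>i\<in>{1..M}. s i ^ k i) = (\<Prod>i\<in>{1..<M}. s i powi (int (k i) - int (k M)))"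
  proof -
    have "(\<Prod>i\<in>{1..M}. s i ^ k i) = s M ^ k M * (\<Prod>i\<in>{1..<M}. s i ^ k i)"
      unfolding ins by simp
    also have "\<dots> = (\<Prod>i\<in>{1..<M}. s i ^ k i / s i ^ k M)"
      by (simp add: sM power_inverse prod_power_distrib prod_dividef divide_inverse[of _ "prod _ _"]
          mult.commute)
    also have "\<dots> = (\<Prod>i\<in>{1..<M}. s i powi (int (k i) - int (k M)))"
      by (intro prod.cong refl) (use s_nz in \<open>auto simp: power_int_diff\<close>)
    finally show ?thesis .
  qed
  then have "1 = (g * (\<Prod>i\<in>{1..<M}. s i powi (int (k i) - int (k M)))) ^ 2"
    using eq prod by simp
  also have "\<dots> = q1 q d powi a * q2 q powi b * (\<Prod>i\<in>{1..<M}. s i powi (2 * (int (k i) - int (k M))))"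
  proof -
    have "(\<Prod>i\<in>{1..<M}. s i powi (int (k i) - int (k M))) ^ 2 =
        (\<Prod>i\<in>{1..<M}. s i powi (2 * (int (k i) - int (k M))))"
      unfolding prod_power_distrib
    proof (intro prod.cong refl)
      fix i assume "i \<in> {1..<M}"
      then have "s i \<noteq> 0" using s_nz by auto
      then show "(s i powi (int (k i) - int (k M))) ^ 2 = s i powi (2 * (int (k i) - int (k M)))"
        unfolding mult_2 power2_eq_square by (subst power_int_add) auto
    qed
    then show ?thesis by (simp add: power_mult_distrib ab)
  qed
  finally have "\<forall>i\<in>{1..<M}. 2 * (int (k i) - int (k M)) = 0"
    using s_generic[unfolded generic_params_def, rule_format, of a b "\<lambda>i. 2 * (int (k i) - int (k M))"]
    by simp
  then have kk: "k i = k M" if "i \<in> {1..M}" for i using that by (cases "i = M") auto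
  have "len = (\<Sum>t\<in>{\<alpha>..<\<alpha> + len}. 1)" by simp
  also have "\<dots> = (\<Sum>i\<in>{1..M}. \<Sum>t\<in>{t \<in> {\<alpha>..<\<alpha> + len}. col t = i}. 1)"
    by (rule sum.group[symmetric]) (use img in auto)
  also have "\<dots> = (\<Sum>i\<in>{1..M}. k i)" by (simp add: k_def)
  also have "\<dots> = (\<Sum>i\<in>{1..M}. k M)" by (rule sum.cong[OF refl kk])
  finally show ?thesis by simp
qed

text \<open>
  The highest coefficient in \<open>y\<close> is \<open>g\<close>, the lowest is \<open>g\<close> times the product of the negated roots. In the
  relation between them the outside variables cancel, because each has as many zeros as it has
  neighbors in the segment, and an equation between constants remains.
\<close>

lemma vanishes_nonmultiple:
  assumes adm: "admissible N f" and van: "\<And>\<beta>. vanishes N f \<beta> (Suc len)"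
    and len: "\<not> M dvd len"
  shows "vanishes N f \<alpha> len"
proof -
  have "vanishes N f \<alpha> len" if \<alpha>: "1 \<le> \<alpha>" for \<alpha>
    unfolding vanishes_def
  proof (intro ballI allI impI)
    fix x0 y0 a assume x0: "x0 \<in> torus M N" and seg0: "carries N x0 \<alpha> len y0 a"
    let ?l = "seg_slots \<alpha> len a" let ?W = "slots M N - ?l"
    have "len \<noteq> 0" using len by (rule contrapos_nn) simp
    then have y0: "y0 \<noteq> 0" using carries_nz[OF seg0 x0, of \<alpha>] by auto
    define x where "x = scale_slots ?l (inverse y0) x0"
    have x: "x \<in> torus M N" using y0 x0 by (simp add: x_def scale_slots_torus)
    have seg: "carries N x \<alpha> len 1 a"
      using carries_scale[OF seg0, of "inverse y0"] y0 by (simp add: x_def)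
    have "scale_slots ?l y0 (scale_slots ?l (inverse y0) x0) = x0"
      unfolding scale_slots_def using y0 by (intro ext) simp
    then have x0x: "x0 = scale_slots ?l y0 x" by (simp add: x_def)
    note inj = carries_inj[OF seg, simplified]
    obtain b where bal: "balanced N f ?l b"
      using admissibleD(6)[OF adm carries_slots[OF seg]] by blast
    obtain g where g: "\<And>y. y \<noteq> 0 \<Longrightarrow> f (scale_slots ?l y x) = g * y ^ b * seg_factor ?W \<alpha> len x y"
      using segment_factorization[OF adm van \<alpha> x seg bal] by blast
    obtain A B h where h: "h \<in> GG"
      and inf: "((\<lambda>\<xi>. f (scale_slots ?l \<xi> x) / \<xi> ^ (b + cross M N ?l)) \<longlongrightarrow> A) at_infinity"
      and zero: "((\<lambda>\<xi>. f (scale_slots ?l \<xi> x) / \<xi> ^ b) \<longlongrightarrow> B) (at 0)"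
      and rel: "A * crossing N ?l (\<lambda>u w. at_slot x w) =
          B * crossing N ?l (\<lambda>u w. at_slot x u) * h * (\<Prod>u\<in>?l. s (fst u))"
      using bal x unfolding balanced_def by blast
    have "((\<lambda>\<xi>. g * (seg_factor ?W \<alpha> len x \<xi> / \<xi> ^ cross M N ?l)) \<longlongrightarrow> g * 1) at_infinity"
      unfolding cross_seg[OF inj] by (intro tendsto_mult tendsto_const seg_factor_at_infinity) auto
    moreover have "\<forall>\<^sub>F \<xi> in at_infinity. g * (seg_factor ?W \<alpha> len x \<xi> / \<xi> ^ cross M N ?l)
        = f (scale_slots ?l \<xi> x) / \<xi> ^ (b + cross M N ?l)"
      using eventually_not_equal_at_infinity[of 0] by eventually_elim (simp add: g power_add)
    ultimately have "((\<lambda>\<xi>. f (scale_slots ?l \<xi> x) / \<xi> ^ (b + cross M N ?l)) \<longlongrightarrow> g) at_infinity"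
      by (simp add: tendsto_cong)
    then have A: "A = g" using inf tendsto_unique at_infinity_nontrivial by blast
    have "((\<lambda>\<xi>. g * seg_factor ?W \<alpha> len x \<xi>) \<longlongrightarrow> g * seg_factor ?W \<alpha> len x 0) (at 0)"
      by (intro tendsto_mult tendsto_const seg_factor_at_zero)
    moreover have "\<forall>\<^sub>F \<xi> in at 0. g * seg_factor ?W \<alpha> len x \<xi> = f (scale_slots ?l \<xi> x) / \<xi> ^ b"
      using eventually_neq_at_within[of 0 0 UNIV] by eventually_elim (simp add: g)
    ultimately have "((\<lambda>\<xi>. f (scale_slots ?l \<xi> x) / \<xi> ^ b) \<longlongrightarrow> g * seg_factor ?W \<alpha> len x 0) (at 0)"
      by (simp add: tendsto_cong)
    then have B: "B = g * seg_factor ?W \<alpha> len x 0" using zero tendsto_unique by (metis at_neq_bot)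
    let ?X = "\<Prod>w\<in>?W. at_slot x w ^ card (attached \<alpha> len (fst w))"
    let ?Z = "\<Prod>w\<in>?W. \<Prod>k\<in>attached \<alpha> len (fst w). - inverse (zero_ratio \<alpha> len k)"
    let ?U = "crossing N ?l (\<lambda>u w. at_slot x u)"
    have X: "?X \<noteq> 0" using x by (auto simp: torus_iff)
    have "g * ?X = g * (?X * ?Z) * ?U * h * (\<Prod>u\<in>?l. s (fst u))"
      using rel unfolding A B crossing_seg[OF inj] seg_factor_0 .
    then have gg: "g = g * (?Z * ?U * h * (\<Prod>u\<in>?l. s (fst u)))"
      using X by (simp add: mult_ac)
    have "at_slot x u \<in> GG" if "u \<in> ?l" for u
      using that seg by (auto simp: seg_slots_def at_slot_def carries_def)
    then have "?Z * ?U * h \<in> GG"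
      unfolding crossing_def using h by (intro GG_mult GG_prod GG_power GG_minus GG_inverse) auto
    moreover have "(\<Prod>u\<in>?l. s (fst u)) = (\<Prod>t\<in>{\<alpha>..<\<alpha> + len}. s (col t))"
      unfolding seg_slots_def by (subst prod.reindex[OF inj]) simp
    ultimately have "?Z * ?U * h * (\<Prod>u\<in>?l. s (fst u)) \<noteq> 1"
      using generic_segment_length len by metis
    then have "g = 0" using gg by (metis mult_cancel_left2)
    then show "f x0 = 0" using g[OF y0] x0x by simp
  qed
  \<comment> \<open>The start is shifted by a period so that a position precedes it.\<close>
  from this[of "\<alpha> + M"] show ?thesis using m_pos by (simp add: vanishes_shift)
qed

end

section \<open>Permuting variables and splitting off segments\<close>

lemma permutes_extending:
  assumes "A \<subseteq> {1..N :: nat}" "inj_on h A" "h ` A \<subseteq> {1..N}"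
  shows "\<exists>\<pi>. \<pi> permutes {1..N} \<and> (\<forall>a\<in>A. \<pi> a = h a)"
proof -
  have fA: "finite A" using assms(1) finite_subset by blast
  have "card ({1..N} - A) = card ({1..N} - h ` A)"
    using assms fA by (simp add: card_Diff_subset card_image)
  then obtain k where k: "bij_betw k ({1..N} - A) ({1..N} - h ` A)"
    using finite_same_card_bij[of "{1..N} - A" "{1..N} - h ` A"] by auto
  define \<pi> where "\<pi> = (\<lambda>a. if a \<in> A then h a else if a \<in> {1..N} then k a else a)"
  have "bij_betw \<pi> A (h ` A)"
    using inj_on_imp_bij_betw[OF assms(2)] by (rule bij_betw_cong[THEN iffD1, rotated]) (simp add: \<pi>_def)
  moreover have "bij_betw \<pi> ({1..N} - A) ({1..N} - h ` A)"
    using k by (rule bij_betw_cong[THEN iffD1, rotated]) (simp add: \<pi>_def)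
  ultimately have "bij_betw \<pi> (A \<union> ({1..N} - A)) (h ` A \<union> ({1..N} - h ` A))"
    by (rule bij_betw_combine) auto
  moreover have "A \<union> ({1..N} - A) = {1..N}" "h ` A \<union> ({1..N} - h ` A) = {1..N}" using assms by auto
  ultimately have "bij_betw \<pi> {1..N} {1..N}" by simp
  then have "\<pi> permutes {1..N}"
    by (rule bij_imp_permutes) (use assms(1) in \<open>auto simp: \<pi>_def\<close>)
  then show ?thesis by (intro exI[of _ \<pi>]) (auto simp: \<pi>_def)
qed

lemma on_wheel_cong:
  assumes "\<And>i r. r \<in> {a, b, c, e} \<Longrightarrow> x i r = x' i r"
  shows "on_wheel q d m n x a b c e \<longleftrightarrow> on_wheel q d m n x' a b c e"
proof -
  have "x i a = x' i a" "x i b = x' i b" "x i c = x' i c" "x i e = x' i e" for i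
    using assms by simp_all
  then show ?thesis unfolding on_wheel_def Let_def by simp
qed

lemma link_commute: "link M i j = link M j i"
  by (simp add: link_def)

context shuffle_parameters
begin

lemma depends_on_slotsD:
  "depends_on_slots N f \<Longrightarrow> (\<And>u. u \<in> slots M N \<Longrightarrow> at_slot x u = at_slot x' u) \<Longrightarrow> f x = f x'"
  unfolding depends_on_slots_def by blast

lemma sign_symmetricD:
  assumes "sign_symmetric N f" "i \<in> {1..M}" "\<pi> permutes {1..N}"
  obtains e where "e \<in> {1, -1}" "\<And>x. x \<in> torus M N \<Longrightarrow> f (x(i := x i \<circ> \<pi>)) = e * f x"
  using assms unfolding sign_symmetric_def by metis

lemma sign_symmetric_all_colors:
  assumes sym: "sign_symmetric N f" and dep: "depends_on_slots N f"
    and \<pi>: "\<And>i. i \<in> {1..M} \<Longrightarrow> \<pi> i permutes {1..N}"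
  shows "\<exists>e\<in>{1, -1}. \<forall>x\<in>torus M N. f (\<lambda>i b. x i (\<pi> i b)) = e * f x"
proof -
  define X where "X k x = (\<lambda>i. if i \<in> {1..k} then x i \<circ> \<pi> i else x i)" for k and x :: point
  have "k \<le> M \<Longrightarrow> \<exists>e\<in>{1, -1}. \<forall>x\<in>torus M N. X k x \<in> torus M N \<and> f (X k x) = e * f x" for k
  proof (induction k)
    case 0
    then show ?case by (intro bexI[of _ 1]) (auto simp: X_def)
  next
    case (Suc k)
    then obtain e where e: "e \<in> {1, -1}" "\<And>x. x \<in> torus M N \<Longrightarrow> X k x \<in> torus M N \<and> f (X k x) = e * f x"
      by (meson Suc_leD)
    have i: "Suc k \<in> {1..M}" using Suc.prems by auto
    obtain e' where e': "e' \<in> {1, -1}"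
      "\<And>x. x \<in> torus M N \<Longrightarrow> f (x(Suc k := x (Suc k) \<circ> \<pi> (Suc k))) = e' * f x"
      using sign_symmetricD[OF sym i \<pi>[OF i]] by blast
    have XS: "X (Suc k) x = (X k x)(Suc k := X k x (Suc k) \<circ> \<pi> (Suc k))" for x
      by (auto simp: X_def fun_eq_iff)
    have tor: "X (Suc k) x \<in> torus M N" if "x \<in> torus M N" for x
      unfolding torus_def
    proof (intro CollectI ballI)
      fix j b assume j: "j \<in> {1..M}" "b \<in> {1..N}"
      have "\<pi> j b \<in> {1..N}" using permutes_in_image[OF \<pi>[OF j(1)]] j(2) by simp
      then show "X (Suc k) x j b \<noteq> 0" using that j by (auto simp: X_def torus_def)
    qed
    have "f (X (Suc k) x) = (e' * e) * f x" if "x \<in> torus M N" for x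
      unfolding XS using e'(2) e(2)[OF that] by simp
    moreover have "e' * e \<in> {1, -1}" using e(1) e'(1) by auto
    ultimately show ?case using tor by blast
  qed
  from this[OF order_refl] obtain e
    where e: "e \<in> {1, -1}" "\<And>x. x \<in> torus M N \<Longrightarrow> f (X M x) = e * f x" by meson
  have "f (\<lambda>i b. x i (\<pi> i b)) = f (X M x)" for x
    by (rule depends_on_slotsD[OF dep]) (auto simp: X_def at_slot_def slots_def)
  with e show ?thesis by (intro bexI[of _ e]) auto
qed

subsection \<open>Splitting off a segment of length \<open>\<nu> M\<close>\<close>

text \<open>
  The segment starting at position \<open>\<alpha>\<close> and going \<open>\<nu>\<close> times around the colors is put on the last \<open>\<nu>\<close>
  variables of each color: \<open>ext_index\<close> sends a position to the index of its variable and \<open>ext_pos\<close> is its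
  inverse.
\<close>

definition ext_pos :: "nat \<Rightarrow> nat \<Rightarrow> nat \<Rightarrow> nat \<Rightarrow> nat" where
  "ext_pos \<alpha> K i a = (if \<alpha> \<le> i then i else i + M) + (a - K - 1) * M"

definition ext_index :: "nat \<Rightarrow> nat \<Rightarrow> nat \<Rightarrow> nat" where
  "ext_index \<alpha> K t = K + 1 + (t - \<alpha>) div M"

definition ext :: "nat \<Rightarrow> nat \<Rightarrow> complex \<Rightarrow> point \<Rightarrow> point" where
  "ext \<alpha> K y x = (\<lambda>i a. if a \<le> K then x i a else y * C (ext_pos \<alpha> K i a))"

lemma ext_pos_index:
  assumes "\<alpha> \<in> {1..M}" "\<alpha> \<le> t"
  shows "ext_pos \<alpha> K (col t) (ext_index \<alpha> K t) = t"
proof -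
  define r k where "r = (t - \<alpha>) mod M" and "k = (t - \<alpha>) div M"
  have t: "t = \<alpha> + r + k * M"
    using div_mult_mod_eq[of "t - \<alpha>" M] assms(2) by (simp add: r_def k_def algebra_simps)
  have r: "r < M" unfolding r_def using M_pos' by (rule mod_less_divisor)
  have "(\<alpha> + r + k * M) mod M = (\<alpha> + r) mod M" by (rule mod_mult_self1)
  then have c: "col t = col (\<alpha> + r)" unfolding t by (rule cyc_eqI)
  show ?thesis
  proof (cases "\<alpha> + r \<le> M")
    case True
    then have "col t = \<alpha> + r" using c assms(1) by (simp add: cyc_id)
    then show ?thesis by (simp add: ext_pos_def ext_index_def flip: k_def) (simp add: t)
  next
    case False
    have "\<alpha> + r = (\<alpha> + r - M) + M" using False by simp
    then have "col (\<alpha> + r) = col (\<alpha> + r - M)" by (metis cyc_add_period)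
    also have "\<dots> = \<alpha> + r - M" using False assms(1) r by (intro cyc_id) auto
    finally have "col t = \<alpha> + r - M" using c by simp
    then show ?thesis using False r by (simp add: ext_pos_def ext_index_def flip: k_def) (simp add: t)
  qed
qed

lemma ext_pos_range:
  assumes "\<alpha> \<in> {1..M}" "i \<in> {1..M}" "a \<in> {K + 1..K + \<nu>}"
  shows "\<alpha> \<le> ext_pos \<alpha> K i a" "ext_pos \<alpha> K i a < \<alpha> + \<nu> * M"
    "col (ext_pos \<alpha> K i a) = i" "ext_index \<alpha> K (ext_pos \<alpha> K i a) = a"
proof -
  define k where "k = a - K - 1"
  have k: "a = K + 1 + k" "k < \<nu>" using assms(3) by (auto simp: k_def)
  define i' where "i' = (if \<alpha> \<le> i then i else i + M)"
  have i': "\<alpha> \<le> i'" "i' < \<alpha> + M" "col i' = i" using assms(1,2) by (auto simp: i'_def cyc_id)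
  have p: "ext_pos \<alpha> K i a = i' + k * M" by (simp add: ext_pos_def i'_def k_def)
  show "\<alpha> \<le> ext_pos \<alpha> K i a" using i' p by simp
  have "k * M + M \<le> \<nu> * M" using k(2) by (metis Suc_leI add.commute mult_Suc mult_le_mono1)
  then show "ext_pos \<alpha> K i a < \<alpha> + \<nu> * M" using p i' by linarith
  have "(i' + k * M) mod M = i' mod M" by (rule mod_mult_self1)
  then show "col (ext_pos \<alpha> K i a) = i" using i'(3) unfolding p by (metis cyc_eqI)
  have "(i' + k * M - \<alpha>) = (i' - \<alpha>) + k * M" using i' by simp
  moreover have "((i' - \<alpha>) + k * M) div M = k"
  proof -
    have "(i' - \<alpha>) div M = 0" using i' by (intro div_less) linarith
    moreover have "M \<noteq> 0" using M_pos by linarith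
    then have "((i' - \<alpha>) + k * M) div M = k + (i' - \<alpha>) div M" by (rule div_mult_self1)
    ultimately show ?thesis by linarith
  qed
  ultimately show "ext_index \<alpha> K (ext_pos \<alpha> K i a) = a"
    unfolding ext_index_def p by (simp add: k(1))
qed

lemma ext_index_range:
  assumes "\<alpha> \<le> t" "t < \<alpha> + \<nu> * M"
  shows "ext_index \<alpha> K t \<in> {K + 1..K + \<nu>}"
proof -
  have "t - \<alpha> < \<nu> * M" using assms by linarith
  then have "(t - \<alpha>) div M < \<nu>" by (simp add: less_mult_imp_div_less)
  then show ?thesis by (simp add: ext_index_def)
qed

abbreviation ext_slots :: "nat \<Rightarrow> nat \<Rightarrow> nat \<Rightarrow> (nat \<times> nat) set" where
  "ext_slots \<alpha> K \<nu> \<equiv> seg_slots \<alpha> (\<nu> * M) (ext_index \<alpha> K)"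

lemma ext_slots:
  assumes "\<alpha> \<in> {1..M}"
  shows "ext_slots \<alpha> K \<nu> = {1..M} \<times> {K + 1..K + \<nu>}"
proof (intro set_eqI iffI)
  fix u assume "u \<in> ext_slots \<alpha> K \<nu>"
  then obtain t where "\<alpha> \<le> t" "t < \<alpha> + \<nu> * M" "u = (col t, ext_index \<alpha> K t)"
    by (auto simp: seg_slots_def)
  then show "u \<in> {1..M} \<times> {K + 1..K + \<nu>}" using ext_index_range col_range by blast
next
  fix u assume "u \<in> {1..M} \<times> {K + 1..K + \<nu>}"
  then obtain i a where u: "u = (i, a)" "i \<in> {1..M}" "a \<in> {K + 1..K + \<nu>}" by auto
  note r = ext_pos_range[OF assms u(2,3)]
  show "u \<in> ext_slots \<alpha> K \<nu>"
    unfolding seg_slots_def u(1) using r by (intro image_eqI[of _ _ "ext_pos \<alpha> K i a"]) auto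
qed

lemma slots_split:
  assumes "\<alpha> \<in> {1..M}"
  shows "slots M (K + \<nu>) = slots M K \<union> ext_slots \<alpha> K \<nu>" "slots M K \<inter> ext_slots \<alpha> K \<nu> = {}"
  unfolding ext_slots[OF assms] by (auto simp: slots_def)

lemma slots_diff:
  assumes "\<alpha> \<in> {1..M}"
  shows "slots M (K + \<nu>) - ext_slots \<alpha> K \<nu> = slots M K"
  using slots_split[OF assms, of K \<nu>] by blast

lemma at_slot_ext: "u \<in> slots M K \<Longrightarrow> at_slot (ext \<alpha> K y x) u = at_slot x u"
  by (auto simp: at_slot_def ext_def slots_def)

lemma at_slot_ext_new:
  assumes "\<alpha> \<in> {1..M}" "u \<in> ext_slots \<alpha> K \<nu>"
  shows "at_slot (ext \<alpha> K y x) u = y * C (ext_pos \<alpha> K (fst u) (snd u))"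
  using assms(2) unfolding ext_slots[OF assms(1)] by (auto simp: at_slot_def ext_def)

lemma ext_torus:
  assumes "\<alpha> \<in> {1..M}" "x \<in> torus M K" "y \<noteq> 0"
  shows "ext \<alpha> K y x \<in> torus M (K + \<nu>)"
  using assms(2,3) unfolding torus_def by (auto simp: ext_def)

lemma ext_carries:
  assumes "\<alpha> \<in> {1..M}"
  shows "carries (K + \<nu>) (ext \<alpha> K y x) \<alpha> (\<nu> * M) y (ext_index \<alpha> K)"
  unfolding carries_def
proof (intro ballI conjI)
  fix t assume "t \<in> {\<alpha>..<\<alpha> + \<nu> * M}"
  then have t: "\<alpha> \<le> t" "t < \<alpha> + \<nu> * M" by auto
  then show "ext_index \<alpha> K t \<in> {1..K + \<nu>}" using ext_index_range[OF t, of K] by auto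
  show "ext \<alpha> K y x (col t) (ext_index \<alpha> K t) = y * C t"
    using ext_index_range[OF t, of K] ext_pos_index[OF assms t(1), of K] by (simp add: ext_def)
qed

lemma ext_scale:
  assumes "\<alpha> \<in> {1..M}" "u \<in> slots M (K + \<nu>)"
  shows "at_slot (scale_slots (ext_slots \<alpha> K \<nu>) y (ext \<alpha> K 1 x)) u = at_slot (ext \<alpha> K y x) u"
proof (cases "u \<in> ext_slots \<alpha> K \<nu>")
  case True
  then show ?thesis by (simp add: at_slot_scale at_slot_ext_new[OF assms(1)])
next
  case False
  then have "u \<in> slots M K" using slots_split(1)[OF assms(1)] assms(2) by blast
  with False show ?thesis by (simp add: at_slot_scale at_slot_ext)
qed

lemma ext_twist: "ext \<alpha> K y (twist e \<xi> x) = twist (\<lambda>i a. if a \<le> K then e i a else 0) \<xi> (ext \<alpha> K y x)"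
  by (auto simp: ext_def twist_def fun_eq_iff)

lemma ext_scale_old:
  assumes "S \<subseteq> slots M K"
  shows "ext \<alpha> K y (scale_slots S \<xi> x) = scale_slots S \<xi> (ext \<alpha> K y x)"
  using assms by (auto simp: ext_def scale_slots_def fun_eq_iff slots_def)

lemma laurentian_ext: "laurentian f \<Longrightarrow> laurentian (\<lambda>x. f (ext \<alpha> K y x))"
  unfolding laurentian_def ext_twist by blast

lemma seg_factor_cong:
  "(\<And>w. w \<in> W \<Longrightarrow> at_slot x w = at_slot x' w) \<Longrightarrow> seg_factor W \<alpha> len x y = seg_factor W \<alpha> len x' y"
  unfolding seg_factor_def by (intro prod.cong refl) auto

text \<open>
  The cofactor is written as a linear combination of specializations of \<open>f\<close>, with coefficients
  independent of the point: the top coefficient in \<open>z\<close> of \<open>f (ext \<alpha> K z x) / z ^ b\<close> is obtained by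
  interpolation. In this form it visibly inherits linear properties of \<open>f\<close>.
\<close>

lemma split_off_exists:
  assumes adm: "admissible (K + \<nu>) f" and van: "\<And>\<beta>. vanishes (K + \<nu>) f \<beta> (Suc (\<nu> * M))"
    and \<alpha>: "\<alpha> \<in> {1..M}"
  shows "\<exists>Y l b. finite Y \<and> 0 \<notin> Y \<and>
    (\<forall>x\<in>torus M K. \<forall>y. y \<noteq> 0 \<longrightarrow> f (ext \<alpha> K y x) =
      (\<Sum>z\<in>Y. l z * f (ext \<alpha> K z x)) * y ^ b * seg_factor (slots M K) \<alpha> (\<nu> * M) x y)"
proof -
  let ?L = "ext_slots \<alpha> K \<nu>" and ?len = "\<nu> * M"
  define c where "c = (\<Sum>w\<in>slots M K. card (attached \<alpha> ?len (fst w)))"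
  have \<alpha>1: "1 \<le> \<alpha>" using \<alpha> by simp
  have "?L \<subseteq> slots M (K + \<nu>)" using slots_split(1)[OF \<alpha>] by blast
  then obtain b where bal: "balanced (K + \<nu>) f ?L b" using admissibleD(6)[OF adm] by blast
  obtain Y where Y: "finite Y" "card Y = Suc c" "Y \<subseteq> UNIV - {0 :: complex}"
    using infinite_arbitrarily_large[of "UNIV - {0 :: complex}" "Suc c"] infinite_UNIV_char_0[where 'a = complex]
    by auto
  obtain l where l: "\<And>p :: complex poly. degree p \<le> c \<Longrightarrow> coeff p c = (\<Sum>y\<in>Y. l y * poly p y)"
    using top_coeff_interpolation[OF Y(1,2)] by blast
  have "f (ext \<alpha> K y x) = (\<Sum>z\<in>Y. l z / z ^ b * f (ext \<alpha> K z x)) * y ^ b *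
      seg_factor (slots M K) \<alpha> ?len x y" if x: "x \<in> torus M K" and y: "y \<noteq> 0" for x y
  proof -
    have scale: "f (scale_slots ?L z (ext \<alpha> K 1 x)) = f (ext \<alpha> K z x)" for z
      by (rule depends_on_slotsD[OF admissibleD(1)[OF adm] ext_scale[OF \<alpha>]])
    have SF: "seg_factor (slots M K) \<alpha> ?len (ext \<alpha> K 1 x) z = seg_factor (slots M K) \<alpha> ?len x z" for z
      by (rule seg_factor_cong) (rule at_slot_ext)
    obtain g where g: "\<And>z. z \<noteq> 0 \<Longrightarrow> f (ext \<alpha> K z x) = g * z ^ b * seg_factor (slots M K) \<alpha> ?len x z"
      using segment_factorization[OF adm van \<alpha>1 ext_torus[OF \<alpha> x] ext_carries[OF \<alpha>] bal]
      unfolding slots_diff[OF \<alpha>] scale SF by auto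
    define Q where "Q = (\<Prod>w\<in>slots M K. \<Prod>k\<in>attached \<alpha> ?len (fst w).
        [:- (at_slot x w / zero_ratio \<alpha> ?len k), 1:])"
    have PQ: "poly Q z = seg_factor (slots M K) \<alpha> ?len x z" for z
      by (simp add: Q_def seg_factor_def poly_prod)
    have "degree Q = c" unfolding Q_def c_def
      by (subst degree_prod_eq_sum_degree; (subst degree_prod_eq_sum_degree)?) auto
    moreover have "lead_coeff Q = 1" by (simp add: Q_def lead_coeff_prod)
    ultimately have "g = coeff (smult g Q) c" by simp
    also have "\<dots> = (\<Sum>z\<in>Y. l z * (g * seg_factor (slots M K) \<alpha> ?len x z))"
      using l[of "smult g Q"] \<open>degree Q = c\<close> by (simp add: PQ)
    also have "\<dots> = (\<Sum>z\<in>Y. l z / z ^ b * f (ext \<alpha> K z x))"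
    proof (intro sum.cong refl)
      fix z assume "z \<in> Y"
      then have "z \<noteq> 0" using Y(3) by auto
      then show "l z * (g * seg_factor (slots M K) \<alpha> ?len x z) = l z / z ^ b * f (ext \<alpha> K z x)"
        using g by simp
    qed
    finally show ?thesis using g[OF y] by simp
  qed
  then show ?thesis using Y by (intro exI[of _ Y] exI[of _ "\<lambda>z. l z / z ^ b"] exI[of _ b]) auto
qed

text \<open>
  The limits of \<open>g\<close> come from those of \<open>f\<close> by dividing by the limits \<open>XS * Z\<close> and \<open>y ^ cS\<close> of the explicit
  factor \<open>T\<close>, for a fixed \<open>y\<close>. In the relation for \<open>f\<close> the pairs of a scaled variable and a segment member
  contribute the same monomial in the scaled variables as \<open>XS\<close>, up to elements of \<open>GG\<close>.
\<close>

lemma split_off_balanced: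
  assumes \<alpha>: "\<alpha> \<in> {1..M}" and S: "S \<subseteq> slots M K" and bal: "balanced (K + \<nu>) f S b"
    and g: "\<And>x y. x \<in> torus M K \<Longrightarrow> y \<noteq> 0 \<Longrightarrow>
      f (ext \<alpha> K y x) = g x * y ^ b0 * seg_factor (slots M K) \<alpha> (\<nu> * M) x y"
  shows "balanced K g S b"
  unfolding balanced_def
proof
  fix x assume x: "x \<in> torus M K"
  let ?len = "\<nu> * M" let ?L = "ext_slots \<alpha> K \<nu>"
  have finS: "finite S" using S finite_slots finite_subset by blast
  obtain y where y: "y \<noteq> 0" "seg_factor (slots M K - S) \<alpha> ?len x y \<noteq> 0"
    using seg_factor_avoid[of "{x}" "slots M K - S" \<alpha> ?len] by auto
  let ?x = "ext \<alpha> K y x"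
  have tor: "?x \<in> torus M (K + \<nu>)" by (rule ext_torus[OF \<alpha> x y(1)])
  obtain A B h where h: "h \<in> GG"
      and inf: "((\<lambda>\<xi>. f (scale_slots S \<xi> ?x) / \<xi> ^ (b + cross M (K + \<nu>) S)) \<longlongrightarrow> A) at_infinity"
      and zero: "((\<lambda>\<xi>. f (scale_slots S \<xi> ?x) / \<xi> ^ b) \<longlongrightarrow> B) (at 0)"
      and rel: "A * crossing (K + \<nu>) S (\<lambda>u w. at_slot ?x w) =
          B * crossing (K + \<nu>) S (\<lambda>u w. at_slot ?x u) * h * (\<Prod>u\<in>S. s (fst u))"
    using bal tor unfolding balanced_def by blast
  define \<kappa> where "\<kappa> = y ^ b0 * seg_factor (slots M K - S) \<alpha> ?len x y"
  have \<kappa>: "\<kappa> \<noteq> 0" using y by (simp add: \<kappa>_def)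
  define T where "T \<xi> = (\<Prod>w\<in>S. \<Prod>k\<in>attached \<alpha> ?len (fst w). y - \<xi> * (at_slot x w / zero_ratio \<alpha> ?len k))" for \<xi>
  define cS where "cS = (\<Sum>w\<in>S. card (attached \<alpha> ?len (fst w)))"
  define XS where "XS = (\<Prod>w\<in>S. at_slot x w ^ card (attached \<alpha> ?len (fst w)))"
  define Z where "Z = (\<Prod>w\<in>S. \<Prod>k\<in>attached \<alpha> ?len (fst w). - inverse (zero_ratio \<alpha> ?len k))"
  have XS: "XS \<noteq> 0" using x S finS by (auto simp: XS_def torus_iff)
  have Z: "Z \<in> GG" unfolding Z_def by (intro GG_prod GG_minus GG_inverse zero_ratio_GG)
  have SF: "seg_factor (slots M K) \<alpha> ?len (scale_slots S \<xi> x) y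
      = T \<xi> * seg_factor (slots M K - S) \<alpha> ?len x y" for \<xi>
  proof -
    have "seg_factor (slots M K) \<alpha> ?len (scale_slots S \<xi> x) y =
        seg_factor S \<alpha> ?len (scale_slots S \<xi> x) y * seg_factor (slots M K - S) \<alpha> ?len (scale_slots S \<xi> x) y"
      unfolding seg_factor_def using prod.subset_diff[OF S finite_slots] by (simp add: mult.commute)
    also have "seg_factor (slots M K - S) \<alpha> ?len (scale_slots S \<xi> x) y = seg_factor (slots M K - S) \<alpha> ?len x y"
      by (rule seg_factor_cong) (simp add: at_slot_scale)
    also have "seg_factor S \<alpha> ?len (scale_slots S \<xi> x) y = T \<xi>"
      by (simp add: seg_factor_def T_def at_slot_scale)
    finally show ?thesis .
  qed
  have F: "f (scale_slots S \<xi> ?x) = g (scale_slots S \<xi> x) * (\<kappa> * T \<xi>)" if "\<xi> \<noteq> 0" for \<xi>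
    using g[OF scale_slots_torus[OF x that] y(1), of S] unfolding ext_scale_old[OF S] SF \<kappa>_def
    by (simp add: mult_ac)
  have Tinf: "((\<lambda>\<xi>. T \<xi> / \<xi> ^ cS) \<longlongrightarrow> XS * Z) at_infinity"
  proof -
    have "((\<lambda>\<xi>. \<Prod>w\<in>S. \<Prod>k\<in>attached \<alpha> ?len (fst w). y * inverse \<xi> - at_slot x w / zero_ratio \<alpha> ?len k) \<longlongrightarrow>
       (\<Prod>w\<in>S. \<Prod>k\<in>attached \<alpha> ?len (fst w). y * 0 - at_slot x w / zero_ratio \<alpha> ?len k)) at_infinity"
      by (intro tendsto_intros tendsto_inverse_0)
    moreover have "(\<Prod>w\<in>S. \<Prod>k\<in>attached \<alpha> ?len (fst w). y * 0 - at_slot x w / zero_ratio \<alpha> ?len k) = XS * Z"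
      using seg_factor_0[of S \<alpha> ?len x] by (simp add: seg_factor_def XS_def Z_def)
    moreover have "\<forall>\<^sub>F \<xi> in at_infinity. (\<Prod>w\<in>S. \<Prod>k\<in>attached \<alpha> ?len (fst w).
        y * inverse \<xi> - at_slot x w / zero_ratio \<alpha> ?len k) = T \<xi> / \<xi> ^ cS"
      using eventually_not_equal_at_infinity[of 0]
    proof eventually_elim
      case (elim \<xi>)
      have "T \<xi> / \<xi> ^ cS = (\<Prod>w\<in>S. \<Prod>k\<in>attached \<alpha> ?len (fst w).
          (y - \<xi> * (at_slot x w / zero_ratio \<alpha> ?len k)) / \<xi>)"
        by (simp add: T_def cS_def prod_dividef power_sum)
      also have "\<dots> = (\<Prod>w\<in>S. \<Prod>k\<in>attached \<alpha> ?len (fst w). y * inverse \<xi> - at_slot x w / zero_ratio \<alpha> ?len k)"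
        using elim by (intro prod.cong refl) (simp add: field_simps)
      finally show ?case by simp
    qed
    ultimately show ?thesis by (simp add: tendsto_cong)
  qed
  have T0: "(T \<longlongrightarrow> y ^ cS) (at 0)"
  proof -
    have "(T \<longlongrightarrow> (\<Prod>w\<in>S. \<Prod>k\<in>attached \<alpha> ?len (fst w). y - 0 * (at_slot x w / zero_ratio \<alpha> ?len k))) (at 0)"
      unfolding T_def by (intro tendsto_intros)
    then show ?thesis by (simp add: cS_def power_sum)
  qed
  note inj = carries_inj[OF ext_carries[OF \<alpha>, of K \<nu> 1], simplified]
  have diff: "slots M (K + \<nu>) - S = (slots M K - S) \<union> ?L" and disj: "(slots M K - S) \<inter> ?L = {}"
    using slots_split[OF \<alpha>, of K \<nu>] S by blast+
  have finL: "finite ?L" by (simp add: seg_slots_def)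
  have links: "(\<Sum>w\<in>?L. link M (fst u) (fst w)) = card (attached \<alpha> ?len (fst u))" if "u \<in> S" for u
  proof -
    have "fst u \<in> {1..M}" using that S by (auto simp: slots_def)
    from sum_card_attached[OF inj this] show ?thesis by (simp add: link_commute[of _ "fst u"])
  qed
  have cross: "cross M (K + \<nu>) S = cross M K S + cS"
    unfolding cross_def cS_def diff
    by (simp add: sum.union_disjoint[OF _ finL disj] sum.distrib links)
  have crossing: "crossing (K + \<nu>) S \<phi> = crossing K S \<phi> * (\<Prod>u\<in>S. \<Prod>w\<in>?L. \<phi> u w ^ link M (fst u) (fst w))" for \<phi>
    unfolding crossing_def diff by (simp add: prod.union_disjoint[OF _ finL disj] prod.distrib)
  define G1 where "G1 = (\<Prod>u\<in>S. \<Prod>w\<in>?L. C (ext_pos \<alpha> K (fst w) (snd w)) ^ link M (fst u) (fst w))"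
  have G1: "G1 \<in> GG" unfolding G1_def by (intro GG_prod GG_power GG_C)
  have cr_w: "crossing (K + \<nu>) S (\<lambda>u w. at_slot ?x w) = crossing K S (\<lambda>u w. at_slot x w) * (y ^ cS * G1)"
  proof -
    have "(\<Prod>u\<in>S. \<Prod>w\<in>?L. at_slot ?x w ^ link M (fst u) (fst w))
        = (\<Prod>u\<in>S. \<Prod>w\<in>?L. y ^ link M (fst u) (fst w) * C (ext_pos \<alpha> K (fst w) (snd w)) ^ link M (fst u) (fst w))"
      by (intro prod.cong refl) (simp add: at_slot_ext_new[OF \<alpha>] power_mult_distrib)
    also have "\<dots> = y ^ cS * G1"
      by (simp add: prod.distrib G1_def cS_def links flip: power_sum)
    finally show ?thesis unfolding crossing
      by (simp add: crossing_def at_slot_ext)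
  qed
  have cr_u: "crossing (K + \<nu>) S (\<lambda>u w. at_slot ?x u) = crossing K S (\<lambda>u w. at_slot x u) * XS"
  proof -
    have old: "at_slot ?x u = at_slot x u" if "u \<in> S" for u
      using that S by (intro at_slot_ext) auto
    have "(\<Prod>u\<in>S. \<Prod>w\<in>?L. at_slot ?x u ^ link M (fst u) (fst w)) = XS"
      unfolding XS_def by (intro prod.cong refl) (simp add: old links flip: power_sum)
    then show ?thesis unfolding crossing by (simp add: crossing_def old)
  qed
  have hZ: "h / (Z * G1) \<in> GG" using h Z G1 by (intro GG_divide GG_mult)
  have nz: "Z \<noteq> 0" "G1 \<noteq> 0" "y ^ cS \<noteq> 0" using GG_nz Z G1 y(1) by auto
  have lim_inf: "((\<lambda>\<xi>. g (scale_slots S \<xi> x) / \<xi> ^ (b + cross M K S)) \<longlongrightarrow> A / (\<kappa> * (XS * Z))) at_infinity"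
  proof -
    have "((\<lambda>\<xi>. (f (scale_slots S \<xi> ?x) / \<xi> ^ (b + cross M (K + \<nu>) S)) / (\<kappa> * (T \<xi> / \<xi> ^ cS)))
        \<longlongrightarrow> A / (\<kappa> * (XS * Z))) at_infinity"
      using \<kappa> XS nz by (intro tendsto_divide tendsto_mult tendsto_const inf Tinf) auto
    moreover have "\<forall>\<^sub>F \<xi> in at_infinity. T \<xi> / \<xi> ^ cS \<noteq> 0"
      using Tinf by (rule tendsto_imp_eventually_ne) (use XS nz in auto)
    then have "\<forall>\<^sub>F \<xi> in at_infinity. (f (scale_slots S \<xi> ?x) / \<xi> ^ (b + cross M (K + \<nu>) S)) / (\<kappa> * (T \<xi> / \<xi> ^ cS))
        = g (scale_slots S \<xi> x) / \<xi> ^ (b + cross M K S)"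
      using eventually_not_equal_at_infinity[of 0]
    proof eventually_elim
      case (elim \<xi>)
      then have "T \<xi> \<noteq> 0" by auto
      then show ?case using elim(2) \<kappa> by (simp add: F cross power_add)
    qed
    ultimately show ?thesis by (simp add: tendsto_cong)
  qed
  have lim_zero: "((\<lambda>\<xi>. g (scale_slots S \<xi> x) / \<xi> ^ b) \<longlongrightarrow> B / (\<kappa> * y ^ cS)) (at 0)"
  proof -
    have "((\<lambda>\<xi>. (f (scale_slots S \<xi> ?x) / \<xi> ^ b) / (\<kappa> * T \<xi>)) \<longlongrightarrow> B / (\<kappa> * y ^ cS)) (at 0)"
      using \<kappa> nz by (intro tendsto_divide tendsto_mult tendsto_const zero T0) auto
    moreover have "\<forall>\<^sub>F \<xi> in at 0. T \<xi> \<noteq> 0"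
      using T0 by (rule tendsto_imp_eventually_ne) (use nz in auto)
    then have "\<forall>\<^sub>F \<xi> in at 0. (f (scale_slots S \<xi> ?x) / \<xi> ^ b) / (\<kappa> * T \<xi>)
        = g (scale_slots S \<xi> x) / \<xi> ^ b"
      using eventually_neq_at_within[of 0 0 UNIV]
      by eventually_elim (use \<kappa> in \<open>simp add: F\<close>)
    ultimately show ?thesis by (simp add: tendsto_cong)
  qed
  have "A / (\<kappa> * (XS * Z)) * crossing K S (\<lambda>u w. at_slot x w) =
      (A * (crossing K S (\<lambda>u w. at_slot x w) * (y ^ cS * G1))) / (\<kappa> * XS * Z * (y ^ cS * G1))"
    using nz(1,2) y(1) by (simp add: field_simps)
  also have "A * (crossing K S (\<lambda>u w. at_slot x w) * (y ^ cS * G1)) =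
      B * (crossing K S (\<lambda>u w. at_slot x u) * XS) * h * (\<Prod>u\<in>S. s (fst u))"
    using rel unfolding cr_w cr_u .
  also have "\<dots> / (\<kappa> * XS * Z * (y ^ cS * G1)) =
      B / (\<kappa> * y ^ cS) * crossing K S (\<lambda>u w. at_slot x u) * (h / (Z * G1)) * (\<Prod>u\<in>S. s (fst u))"
    using XS by (simp add: mult_ac)
  finally show "\<exists>A B h. h \<in> GG \<and>
        ((\<lambda>\<xi>. g (scale_slots S \<xi> x) / \<xi> ^ (b + cross M K S)) \<longlongrightarrow> A) at_infinity \<and>
        ((\<lambda>\<xi>. g (scale_slots S \<xi> x) / \<xi> ^ b) \<longlongrightarrow> B) (at 0) \<and>
        A * crossing K S (\<lambda>u w. at_slot x w) =
          B * crossing K S (\<lambda>u w. at_slot x u) * h * (\<Prod>u\<in>S. s (fst u))"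
    using hZ lim_inf lim_zero by blast
qed

text \<open>
  All conditions except the balance of limits are linear and concern only the given variables, so they
  pass to each summand \<open>f (ext \<alpha> K z x)\<close> of \<open>g\<close>.
\<close>

lemma split_off_admissible:
  assumes adm: "admissible (K + \<nu>) f" and van: "\<And>\<beta>. vanishes (K + \<nu>) f \<beta> (Suc (\<nu> * M))"
    and \<alpha>: "\<alpha> \<in> {1..M}"
  shows "\<exists>g b. admissible K g \<and>
    (\<forall>x\<in>torus M K. \<forall>y. y \<noteq> 0 \<longrightarrow>
       f (ext \<alpha> K y x) = g x * y ^ b * seg_factor (slots M K) \<alpha> (\<nu> * M) x y) \<and>
    (\<forall>\<beta> len. vanishes (K + \<nu>) f \<beta> len \<longrightarrow> vanishes K g \<beta> len)"
proof -
  obtain Y l b where Y: "finite Y" "0 \<notin> Y" and fac: "\<And>x y. x \<in> torus M K \<Longrightarrow> y \<noteq> 0 \<Longrightarrow>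
      f (ext \<alpha> K y x) = (\<Sum>z\<in>Y. l z * f (ext \<alpha> K z x)) * y ^ b * seg_factor (slots M K) \<alpha> (\<nu> * M) x y"
    using split_off_exists[OF adm van \<alpha>] by blast
  define g where "g x = (\<Sum>z\<in>Y. l z * f (ext \<alpha> K z x))" for x
  note fac = fac[folded g_def]
  have nz: "z \<noteq> 0" if "z \<in> Y" for z using that Y(2) by auto
  have tor: "ext \<alpha> K z x \<in> torus M (K + \<nu>)" if "z \<in> Y" "x \<in> torus M K" for z x
    by (rule ext_torus[OF \<alpha> that(2) nz[OF that(1)]])
  have g0: "g x = 0" if "\<And>z. z \<in> Y \<Longrightarrow> f (ext \<alpha> K z x) = 0" for x
    unfolding g_def using that by (intro sum.neutral) auto
  have "depends_on_slots K g"
    unfolding depends_on_slots_def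
  proof (intro allI impI)
    fix x x' assume eq: "\<forall>u\<in>slots M K. at_slot x u = at_slot x' u"
    have "f (ext \<alpha> K z x) = f (ext \<alpha> K z x')" for z
      by (rule depends_on_slotsD[OF admissibleD(1)[OF adm]])
         (use eq in \<open>auto simp: at_slot_def ext_def slots_def\<close>)
    then show "g x = g x'" by (simp add: g_def)
  qed
  moreover have "laurentian g"
    unfolding g_def[abs_def]
    by (intro laurentian_sum laurentian_mult[OF laurentian_const laurentian_ext] admissibleD(2)[OF adm])
  moreover have "sign_symmetric K g"
    unfolding sign_symmetric_def
  proof (intro ballI allI impI)
    fix i \<pi> assume i: "i \<in> {1..M}" and \<pi>: "\<pi> permutes {1..K}"
    then have \<pi>': "\<pi> permutes {1..K + \<nu>}" by (auto intro: permutes_subset)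
    obtain e where e: "e \<in> {1, -1}"
      "\<And>x. x \<in> torus M (K + \<nu>) \<Longrightarrow> f (x(i := x i \<circ> \<pi>)) = e * f x"
      using sign_symmetricD[OF admissibleD(3)[OF adm] i \<pi>'] by blast
    have le: "\<pi> a \<le> K \<longleftrightarrow> a \<le> K" for a
    proof (cases "a \<in> {1..K}")
      case True
      then show ?thesis using permutes_in_image[OF \<pi>, of a] by simp
    next
      case False
      then show ?thesis using permutes_not_in[OF \<pi> False] by simp
    qed
    have "\<pi> a = a" if "\<not> a \<le> K" for a using that by (intro permutes_not_in[OF \<pi>]) auto
    then have swap: "ext \<alpha> K z (x(i := x i \<circ> \<pi>)) = (ext \<alpha> K z x)(i := ext \<alpha> K z x i \<circ> \<pi>)" for z x
      using le by (auto simp: ext_def fun_eq_iff)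
    have "g (x(i := x i \<circ> \<pi>)) = e * g x" if "x \<in> torus M K" for x
      unfolding g_def swap sum_distrib_left
      by (intro sum.cong refl) (simp add: e(2)[OF tor[OF _ that]])
    then show "\<exists>e\<in>{1, -1}. \<forall>x\<in>torus M K. g (x(i := x i \<circ> \<pi>)) = e * g x"
      using e(1) by blast
  qed
  moreover have "fermi_vanishing K g"
    unfolding fermi_vanishing_def
  proof (intro ballI impI)
    fix i x a c assume *: "i \<in> {1..M}" "x \<in> torus M K" "a \<in> {1..K}" "c \<in> {1..K}" "fermi i" "a \<noteq> c" "x i a = x i c"
    show "g x = 0"
      by (rule g0, rule fermi_vanishingD[OF admissibleD(4)[OF adm] *(1,5) tor[OF _ *(2)], of _ a c])
         (use * in \<open>auto simp: ext_def\<close>)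
  qed
  moreover have "wheel_conditions q d m n K g"
    unfolding wheel_conditions_def
  proof (intro ballI impI)
    fix x assume x: "x \<in> torus M K"
    assume "\<exists>a\<in>{1..K}. \<exists>b\<in>{1..K}. \<exists>c\<in>{1..K}. \<exists>e\<in>{1..K}. on_wheel q d m n x a b c e"
    then obtain a b c e where r: "a \<in> {1..K}" "b \<in> {1..K}" "c \<in> {1..K}" "e \<in> {1..K}"
      and w: "on_wheel q d m n x a b c e" by blast
    have w': "on_wheel q d m n (ext \<alpha> K z x) a b c e" for z
      using w by (rule on_wheel_cong[THEN iffD1, rotated]) (use r in \<open>auto simp: ext_def\<close>)
    have r': "a \<in> {1..K + \<nu>}" "b \<in> {1..K + \<nu>}" "c \<in> {1..K + \<nu>}" "e \<in> {1..K + \<nu>}" using r by auto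
    show "g x = 0"
      by (rule g0) (rule wheel_conditionsD[OF admissibleD(5)[OF adm] tor[OF _ x] r' w'])
  qed
  moreover have "\<exists>b. balanced K g S b" if "S \<subseteq> slots M K" for S
  proof -
    have "S \<subseteq> slots M (K + \<nu>)" using that by (auto simp: slots_def)
    then obtain b' where "balanced (K + \<nu>) f S b'" using admissibleD(6)[OF adm] by blast
    from split_off_balanced[OF \<alpha> that this fac] show ?thesis by blast
  qed
  ultimately have "admissible K g" unfolding admissible_def by blast
  moreover have "vanishes K g \<beta> len" if "vanishes (K + \<nu>) f \<beta> len" for \<beta> len
    unfolding vanishes_def
  proof (intro ballI allI impI)
    fix x y a assume x: "x \<in> torus M K" and c: "carries K x \<beta> len y a"
    have "carries (K + \<nu>) (ext \<alpha> K z x) \<beta> len y a" for z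
      unfolding carries_def
    proof
      fix t assume "t \<in> {\<beta>..<\<beta> + len}"
      then show "a t \<in> {1..K + \<nu>} \<and> ext \<alpha> K z x (col t) (a t) = y * C t"
        using carriesD[OF c, of t] by (simp add: ext_def)
    qed
    then show "g x = 0"
      using that tor[OF _ x] by (intro g0) (auto simp: vanishes_def)
  qed
  ultimately show ?thesis using fac by blast
qed

text \<open>
  By symmetry a segment may be moved to the last variables of each color.
\<close>

lemma vanishes_if_vanishes_on_ext:
  assumes adm: "admissible (K + \<nu>) f" and \<alpha>: "\<alpha> \<in> {1..M}" and \<nu>: "\<nu> \<ge> 1"
    and zero: "\<And>x y. x \<in> torus M K \<Longrightarrow> y \<noteq> 0 \<Longrightarrow> f (ext \<alpha> K y x) = 0"
  shows "vanishes (K + \<nu>) f \<alpha> (\<nu> * M)"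
  unfolding vanishes_def
proof (intro ballI allI impI)
  fix x y a assume x: "x \<in> torus M (K + \<nu>)" and c: "carries (K + \<nu>) x \<alpha> (\<nu> * M) y a"
  have "\<alpha> \<in> {\<alpha>..<\<alpha> + \<nu> * M}" using \<nu> M_pos by auto
  then have y: "y \<noteq> 0" using carries_nz[OF c x] by blast
  note inj = carries_inj[OF c y]
  let ?P = "\<lambda>i \<pi>. \<pi> permutes {1..K + \<nu>} \<and> (\<forall>b\<in>{K + 1..K + \<nu>}. \<pi> b = a (ext_pos \<alpha> K i b))"
  have "\<exists>\<pi>. ?P i \<pi>" if i: "i \<in> {1..M}" for i
  proof (rule permutes_extending)
    note r = ext_pos_range[OF \<alpha> i]
    show "{K + 1..K + \<nu>} \<subseteq> {1..K + \<nu>}" by auto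
    show "(\<lambda>b. a (ext_pos \<alpha> K i b)) ` {K + 1..K + \<nu>} \<subseteq> {1..K + \<nu>}"
      using carriesD(3)[OF c] r(1,2) by blast
    show "inj_on (\<lambda>b. a (ext_pos \<alpha> K i b)) {K + 1..K + \<nu>}"
    proof (rule inj_onI)
      fix b b' assume b: "b \<in> {K + 1..K + \<nu>}" "b' \<in> {K + 1..K + \<nu>}"
        "a (ext_pos \<alpha> K i b) = a (ext_pos \<alpha> K i b')"
      have "ext_pos \<alpha> K i b = ext_pos \<alpha> K i b'"
        by (rule inj_onD[OF inj]) (use b r(1-3)[OF b(1)] r(1-3)[OF b(2)] in auto)
      then show "b = b'" using r(4)[OF b(1)] r(4)[OF b(2)] by metis
    qed
  qed
  then obtain \<pi> where \<pi>: "\<And>i. i \<in> {1..M} \<Longrightarrow> ?P i (\<pi> i)" by metis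
  define x' where "x' = (\<lambda>i b. x i (\<pi> i b))"
  obtain e where e: "e \<in> {1, -1}" "f x' = e * f x"
    using sign_symmetric_all_colors[OF admissibleD(3,1)[OF adm], of \<pi>] \<pi> x unfolding x'_def by blast
  have x': "x' \<in> torus M K"
    unfolding torus_def
  proof (intro CollectI ballI)
    fix i b assume i: "i \<in> {1..M}" "b \<in> {1..K}"
    have "\<pi> i b \<in> {1..K + \<nu>}" using permutes_in_image[of "\<pi> i" "{1..K + \<nu>}" b] \<pi>[OF i(1)] i(2) by simp
    then show "x' i b \<noteq> 0" using x i(1) by (simp add: x'_def torus_def)
  qed
  have "f x' = f (ext \<alpha> K y x')"
  proof (rule depends_on_slotsD[OF admissibleD(1)[OF adm]])
    fix u assume "u \<in> slots M (K + \<nu>)"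
    then obtain i b where u: "u = (i, b)" "i \<in> {1..M}" "b \<in> {1..K + \<nu>}" by (auto simp: slots_def)
    show "at_slot x' u = at_slot (ext \<alpha> K y x') u"
    proof (cases "b \<le> K")
      case False
      then have b: "b \<in> {K + 1..K + \<nu>}" using u by auto
      note r = ext_pos_range[OF \<alpha> u(2) b]
      have "x' i b = x i (a (ext_pos \<alpha> K i b))" using \<pi>[OF u(2)] b by (simp add: x'_def)
      also have "\<dots> = y * C (ext_pos \<alpha> K i b)" using carriesD(4)[OF c r(1,2)] r(3) by simp
      finally show ?thesis using False by (simp add: u at_slot_def ext_def)
    qed (simp add: u at_slot_def ext_def)
  qed
  also have "\<dots> = 0" by (rule zero[OF x' y])
  finally show "f x = 0" using e by auto
qed

end

section \<open>Counting monomials\<close>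

definition monomials :: "(nat \<times> nat) set \<Rightarrow> nat \<Rightarrow> T_monomial set" where
  "monomials A N = {t. Poly_Mapping.keys t \<subseteq> A \<and> T_degree t = N}"

lemma T_degree_superset:
  assumes "finite K" "Poly_Mapping.keys t \<subseteq> K"
  shows "T_degree t = (\<Sum>v\<in>K. Poly_Mapping.lookup t v * snd v)"
  unfolding T_degree_def using assms by (intro sum.mono_neutral_left) (auto simp: in_keys_iff)

lemma T_degree_add_single: "T_degree (t + Poly_Mapping.single v 1) = T_degree t + snd v"
proof -
  let ?K = "insert v (Poly_Mapping.keys t)"
  have "Poly_Mapping.keys (t + Poly_Mapping.single v 1) \<subseteq> ?K"
    using keys_add[of t "Poly_Mapping.single v (1 :: nat)"] by auto
  then have "T_degree (t + Poly_Mapping.single v 1)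
      = (\<Sum>u\<in>?K. Poly_Mapping.lookup (t + Poly_Mapping.single v 1) u * snd u)"
    by (intro T_degree_superset) auto
  also have "\<dots> = (\<Sum>u\<in>?K. Poly_Mapping.lookup t u * snd u) + (\<Sum>u\<in>?K. (if u = v then snd u else 0))"
    unfolding sum.distrib[symmetric]
    by (intro sum.cong refl) (auto simp: lookup_add lookup_single algebra_simps)
  also have "(\<Sum>u\<in>?K. Poly_Mapping.lookup t u * snd u) = T_degree t"
    by (rule T_degree_superset[symmetric]) auto
  finally show ?thesis by simp
qed

lemma finite_monomials:
  assumes "A \<subseteq> {1..M} \<times> {0<..}"
  shows "finite (monomials A N)"
proof -
  let ?F = "{g :: nat \<times> nat \<Rightarrow> nat. \<forall>v. (v \<in> {1..M} \<times> {1..N} \<longrightarrow> g v \<in> {0..N}) \<and> (v \<notin> {1..M} \<times> {1..N} \<longrightarrow> g v = 0)}"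
  have "finite ?F" by (rule finite_set_of_finite_funs) auto
  moreover have "Poly_Mapping.lookup ` monomials A N \<subseteq> ?F"
  proof (rule image_subsetI, intro CollectI allI conjI impI)
    fix t assume t: "t \<in> monomials A N"
    have bound: "Poly_Mapping.lookup t v * snd v \<le> N" if "v \<in> Poly_Mapping.keys t" for v
      using that t member_le_sum[of v "Poly_Mapping.keys t" "\<lambda>v. Poly_Mapping.lookup t v * snd v"]
      by (auto simp: monomials_def T_degree_def)
    have key: "v \<in> {1..M} \<times> {1..N} \<and> Poly_Mapping.lookup t v \<le> N" if v: "v \<in> Poly_Mapping.keys t" for v
    proof -
      have "v \<in> {1..M} \<times> {0<..}" using v t assms by (auto simp: monomials_def)
      moreover have "Poly_Mapping.lookup t v \<ge> 1" using v by (simp add: in_keys_iff)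
      ultimately have "snd v \<le> Poly_Mapping.lookup t v * snd v"
        "Poly_Mapping.lookup t v \<le> Poly_Mapping.lookup t v * snd v" by auto
      then have "snd v \<le> N" "Poly_Mapping.lookup t v \<le> N"
        using bound[OF v] by linarith+
      then show ?thesis using \<open>v \<in> {1..M} \<times> {0<..}\<close> by auto
    qed
    show "Poly_Mapping.lookup t v \<in> {0..N}" for v
      using key[of v] by (cases "v \<in> Poly_Mapping.keys t") (auto simp: in_keys_iff)
    show "Poly_Mapping.lookup t v = 0" if "v \<notin> {1..M} \<times> {1..N}" for v
      using key[of v] that by (auto simp: in_keys_iff)
  qed
  ultimately have "finite (Poly_Mapping.lookup ` monomials A N)" by (rule finite_subset[rotated])
  then show ?thesis
    by (rule finite_imageD) (auto intro!: inj_onI poly_mapping_eqI)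
qed

lemma monomials_mono: "A \<subseteq> A' \<Longrightarrow> monomials A N \<subseteq> monomials A' N"
  by (auto simp: monomials_def)

text \<open>
  Either the variable \<open>v\<close> does not occur in a monomial or one factor \<open>v\<close> can be split off. The evaluation
  points obey the same recursion.
\<close>

lemma card_monomials_split:
  assumes "A \<subseteq> {1..M} \<times> {0<..}" "v \<in> A" "snd v \<le> N"
  shows "card (monomials (A - {v}) N) + card (monomials A (N - snd v)) \<le> card (monomials A N)"
proof -
  let ?T = "(\<lambda>t. t + Poly_Mapping.single v 1) ` monomials A (N - snd v)"
  have fin: "finite (monomials (A - {v}) N)" "finite (monomials A (N - snd v))" "finite (monomials A N)"
    using finite_monomials[OF assms(1)] finite_monomials[of "A - {v}" M] assms(1) by auto
  have "card ?T = card (monomials A (N - snd v))"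
    by (rule card_image) (auto intro: inj_onI)
  moreover have "monomials (A - {v}) N \<inter> ?T = {}"
  proof -
    have "v \<in> Poly_Mapping.keys (t + Poly_Mapping.single v 1)" for t :: T_monomial
      by (simp add: in_keys_iff lookup_add lookup_single)
    then show ?thesis by (auto simp: monomials_def)
  qed
  moreover have "monomials (A - {v}) N \<union> ?T \<subseteq> monomials A N"
  proof -
    have "?T \<subseteq> monomials A N"
    proof safe
      fix t assume t: "t \<in> monomials A (N - snd v)"
      then show "t + Poly_Mapping.single v 1 \<in> monomials A N"
        using keys_add[of t "Poly_Mapping.single v (1 :: nat)"] assms(2,3)
          T_degree_add_single[of t v]
        by (auto simp: monomials_def)
    qed
    then show ?thesis by (auto simp: monomials_def)
  qed
  moreover have "finite ?T" using fin(2) by simp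
  ultimately show ?thesis
    using card_mono[OF fin(3), of "monomials (A - {v}) N \<union> ?T"]
      card_Un_disjoint[OF fin(1), of ?T] by linarith
qed

section \<open>Evaluation points\<close>

text \<open>
  The pairs of starting color and length, in units of the number of colors, of the segments that have not
  yet been excluded when length \<open>\<nu>\<close> and starting color \<open>\<alpha>\<close> are about to be treated.
\<close>

definition remaining :: "nat \<Rightarrow> nat \<Rightarrow> nat \<Rightarrow> (nat \<times> nat) set" where
  "remaining M \<nu> \<alpha> = {(i, \<mu>). i \<in> {1..M} \<and> 0 < \<mu> \<and> (\<mu> < \<nu> \<or> \<mu> = \<nu> \<and> \<alpha> \<le> i)}"

lemma remaining_subset: "remaining M \<nu> \<alpha> \<subseteq> {1..M} \<times> {0<..}"
  by (auto simp: remaining_def)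

lemma remaining_step: "remaining M \<nu> \<alpha> - {(\<alpha>, \<nu>)} = remaining M \<nu> (Suc \<alpha>)"
  by (auto simp: remaining_def)

lemma remaining_next: "remaining M (Suc \<nu>) (Suc M) = remaining M \<nu> 1"
  by (auto simp: remaining_def)

context shuffle_parameters
begin

definition determines :: "nat \<Rightarrow> nat \<Rightarrow> nat \<Rightarrow> point set \<Rightarrow> bool" where
  "determines N \<nu> \<alpha> P \<longleftrightarrow>
     (\<forall>f. admissible N f \<longrightarrow> (\<forall>\<beta>. vanishes N f \<beta> (Suc (\<nu> * M))) \<longrightarrow>
        (\<forall>\<beta>\<in>{1..<\<alpha>}. vanishes N f \<beta> (\<nu> * M)) \<longrightarrow> (\<forall>p\<in>P. f p = 0) \<longrightarrow>
        (\<forall>x\<in>torus M N. f x = 0))"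

lemma vanishes_too_long:
  assumes "M * N < len" shows "vanishes N f \<beta> len"
  unfolding vanishes_def using carries_length assms by (meson leD)

text \<open>
  Lengths strictly between two multiples of the number of colors are excluded one after the other.
\<close>

lemma vanishes_descend:
  assumes adm: "admissible N f" and van: "\<And>\<beta>. vanishes N f \<beta> (Suc \<nu> * M)"
  shows "vanishes N f \<beta> (Suc (\<nu> * M))"
proof -
  have "Suc (\<nu> * M) \<le> Suc \<nu> * M" using M_pos by simp
  then have "\<forall>\<beta>. vanishes N f \<beta> (Suc (\<nu> * M))"
  proof (rule inc_induct)
    show "\<forall>\<beta>. vanishes N f \<beta> (Suc \<nu> * M)" using van by blast
  next
    fix len assume len: "Suc (\<nu> * M) \<le> len" "len < Suc \<nu> * M"
      and IH: "\<forall>\<beta>. vanishes N f \<beta> (Suc len)"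
    have "\<not> M dvd len"
    proof
      assume "M dvd len"
      then obtain k where k: "len = M * k" by (elim dvdE)
      have "M * \<nu> < M * k" "M * k < M * Suc \<nu>" using len unfolding k by (simp_all only: mult.commute)
      then have "\<nu> < k" "k < Suc \<nu>" unfolding mult_less_cancel1 by blast+
      then show False by simp
    qed
    then show "\<forall>\<beta>. vanishes N f \<beta> len"
      using vanishes_nonmultiple[OF adm] IH by blast
  qed
  then show ?thesis by blast
qed

text \<open>
  The induction treats the lengths \<open>\<nu> * M\<close> in decreasing order and for each of them the starting colors in
  increasing order. One step splits off a segment: points for the cofactor, extended by the segment at a
  suitable \<open>y\<close>, ensure that the cofactor is zero, and then \<open>f\<close> vanishes at all points containing this
  segment. The cofactor is treated with the same \<open>\<nu>\<close> and \<open>\<alpha>\<close>, since the segment may occur repeatedly. Once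
  length \<open>0\<close> is reached, \<open>f\<close> vanishes at all points containing a single variable.
\<close>

lemma determining_points:
  assumes "1 \<le> \<alpha>" "\<alpha> \<le> Suc M"
  shows "\<exists>P. finite P \<and> P \<subseteq> torus M N \<and> card P \<le> card (monomials (remaining M \<nu> \<alpha>) N)
    \<and> determines N \<nu> \<alpha> P"
  using assms
proof (induction N arbitrary: \<nu> \<alpha> rule: less_induct)
  case (less N)
  show ?case
  proof (cases "N = 0")
    case True
    have "0 \<in> monomials (remaining M \<nu> \<alpha>) N" by (simp add: monomials_def True T_degree_def)
    then have "0 < card (monomials (remaining M \<nu> \<alpha>) N)"
      using finite_monomials[OF remaining_subset] by (auto simp: card_gt_0_iff)
    moreover have "determines N \<nu> \<alpha> {\<lambda>i a. 1}"
      unfolding determines_def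
    proof (intro allI impI ballI)
      fix f x assume adm: "admissible N f" and zero: "\<forall>p\<in>{\<lambda>i a. 1}. f p = 0"
      have "f x = f (\<lambda>i a. 1)"
        by (rule depends_on_slotsD[OF admissibleD(1)[OF adm]]) (simp add: slots_def True)
      then show "f x = 0" using zero by simp
    qed
    ultimately show ?thesis
      by (intro exI[of _ "{\<lambda>i a. 1}"]) (auto simp: torus_def True)
  next
    case N: False
    have "\<forall>\<alpha>\<in>{1..Suc M}. \<exists>P. finite P \<and> P \<subseteq> torus M N \<and>
        card P \<le> card (monomials (remaining M \<nu> \<alpha>) N) \<and> determines N \<nu> \<alpha> P"
    proof (induction \<nu>)
      case 0
      have "determines N 0 \<alpha> {}" for \<alpha>
        unfolding determines_def
      proof (intro allI impI ballI)
        fix f x assume van: "\<forall>\<beta>. vanishes N f \<beta> (Suc (0 * M))" and x: "x \<in> torus M N"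
        have "carries N x 1 (Suc (0 * M)) (x (col 1) 1 / C 1) (\<lambda>_. 1)"
          using N by (auto simp: carries_def)
        then show "f x = 0" using van x unfolding vanishes_def by blast
      qed
      then show ?case by (intro ballI exI[of _ "{}"]) auto
    next
      case (Suc \<nu>)
      show ?case
      proof
        fix \<alpha> assume "\<alpha> \<in> {1..Suc M}"
        then have "\<alpha> \<le> Suc M" "1 \<le> \<alpha>" by auto
        then show "\<exists>P. finite P \<and> P \<subseteq> torus M N \<and>
            card P \<le> card (monomials (remaining M (Suc \<nu>) \<alpha>) N) \<and> determines N (Suc \<nu>) \<alpha> P"
        proof (induction rule: inc_induct)
          case base
          obtain P where P: "finite P" "P \<subseteq> torus M N" "card P \<le> card (monomials (remaining M \<nu> 1) N)"
            "determines N \<nu> 1 P" using bspec[OF Suc.IH, of 1] by auto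
          have "determines N (Suc \<nu>) (Suc M) P"
            unfolding determines_def
          proof (intro allI impI)
            fix f assume adm: "admissible N f" and van: "\<forall>\<beta>\<in>{1..<Suc M}. vanishes N f \<beta> (Suc \<nu> * M)"
              and zero: "\<forall>p\<in>P. f p = 0"
            have "vanishes N f \<beta> (Suc \<nu> * M)" for \<beta>
              by (rule vanishes_all_starts) (use van in auto)
            then have "vanishes N f \<beta> (Suc (\<nu> * M))" for \<beta> by (rule vanishes_descend[OF adm])
            then show "\<forall>x\<in>torus M N. f x = 0"
              using P(4) adm zero unfolding determines_def by auto
          qed
          then show ?case using P unfolding remaining_next by blast
        next
          case (step \<alpha>)
          then have \<alpha>: "\<alpha> \<in> {1..M}" by auto
          obtain P where P: "finite P" "P \<subseteq> torus M N"
            "card P \<le> card (monomials (remaining M (Suc \<nu>) (Suc \<alpha>)) N)"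
            "determines N (Suc \<nu>) (Suc \<alpha>) P" using step by auto
          have next_color: "\<forall>x\<in>torus M N. f x = 0"
            if "admissible N f" "\<forall>\<beta>. vanishes N f \<beta> (Suc (Suc \<nu> * M))"
              "\<forall>\<beta>\<in>{1..<\<alpha>}. vanishes N f \<beta> (Suc \<nu> * M)" "vanishes N f \<alpha> (Suc \<nu> * M)"
              "\<forall>p\<in>P. f p = 0" for f
          proof -
            have "\<forall>\<beta>\<in>{1..<Suc \<alpha>}. vanishes N f \<beta> (Suc \<nu> * M)"
              using that(3,4) by (auto simp: less_Suc_eq)
            then show ?thesis using P(4) that unfolding determines_def by blast
          qed
          show ?case
          proof (cases "Suc \<nu> \<le> N")
            case False
            have "vanishes N f \<alpha> (Suc \<nu> * M)" for f
            proof (rule vanishes_too_long)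
              have "M * N < M * Suc \<nu>" using False M_pos unfolding mult_less_cancel1 by auto
              then show "M * N < Suc \<nu> * M" by (simp only: mult.commute)
            qed
            then have "determines N (Suc \<nu>) \<alpha> P"
              unfolding determines_def using next_color by blast
            moreover have "card (monomials (remaining M (Suc \<nu>) (Suc \<alpha>)) N)
                \<le> card (monomials (remaining M (Suc \<nu>) \<alpha>) N)"
              by (intro card_mono finite_monomials[OF remaining_subset] monomials_mono)
                (auto simp: remaining_def)
            ultimately show ?thesis using P by (intro exI[of _ P]) auto
          next
            case True
            define K where "K = N - Suc \<nu>"
            have NK: "N = K + Suc \<nu>" "K < N" using True by (auto simp: K_def)
            obtain P' where P': "finite P'" "P' \<subseteq> torus M K"
              "card P' \<le> card (monomials (remaining M (Suc \<nu>) \<alpha>) K)" "determines K (Suc \<nu>) \<alpha> P'"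
              using less.IH[OF NK(2), of \<alpha> "Suc \<nu>"] \<alpha> by auto
            obtain y where y: "y \<noteq> 0" "\<And>x. x \<in> P' \<Longrightarrow> seg_factor (slots M K) \<alpha> (Suc \<nu> * M) x y \<noteq> 0"
              using seg_factor_avoid[OF P'(1) finite_slots[of M K]] by blast
            let ?P = "P \<union> ext \<alpha> K y ` P'"
            have "card ?P \<le> card P + card P'"
              using card_Un_le card_image_le[OF P'(1)] by (meson add_left_mono order_trans)
            also have "\<dots> \<le> card (monomials (remaining M (Suc \<nu>) \<alpha> - {(\<alpha>, Suc \<nu>)}) N)
                + card (monomials (remaining M (Suc \<nu>) \<alpha>) (N - snd (\<alpha>, Suc \<nu>)))"
              using P(3) P'(3) unfolding remaining_step by (simp add: K_def)
            also have "\<dots> \<le> card (monomials (remaining M (Suc \<nu>) \<alpha>) N)"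
              by (rule card_monomials_split[OF remaining_subset]) (use \<alpha> True in \<open>auto simp: remaining_def\<close>)
            finally have card: "card ?P \<le> card (monomials (remaining M (Suc \<nu>) \<alpha>) N)" .
            have tor: "?P \<subseteq> torus M N"
              using P(2) P'(2) ext_torus[OF \<alpha> _ y(1), of _ K "Suc \<nu>"] by (auto simp: NK(1))
            have "determines N (Suc \<nu>) \<alpha> ?P"
              unfolding determines_def
            proof (intro allI impI)
              fix f assume adm: "admissible N f" and van: "\<forall>\<beta>. vanishes N f \<beta> (Suc (Suc \<nu> * M))"
                and van': "\<forall>\<beta>\<in>{1..<\<alpha>}. vanishes N f \<beta> (Suc \<nu> * M)" and zero: "\<forall>p\<in>?P. f p = 0"
              have adm': "admissible (K + Suc \<nu>) f" and van'': "vanishes (K + Suc \<nu>) f \<beta> (Suc (Suc \<nu> * M))" for \<beta>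
                using adm van by (auto simp: NK(1))
              obtain g b where g: "admissible K g"
                "\<And>x y. x \<in> torus M K \<Longrightarrow> y \<noteq> 0 \<Longrightarrow>
                  f (ext \<alpha> K y x) = g x * y ^ b * seg_factor (slots M K) \<alpha> (Suc \<nu> * M) x y"
                "\<And>\<beta> len. vanishes (K + Suc \<nu>) f \<beta> len \<Longrightarrow> vanishes K g \<beta> len"
                using split_off_admissible[OF adm' van'' \<alpha>] by blast
              have "g p = 0" if "p \<in> P'" for p
              proof -
                have "f (ext \<alpha> K y p) = 0" using zero that by blast
                then show ?thesis using g(2)[of p y] y(1) y(2)[OF that] that P'(2) by auto
              qed
              moreover have "\<forall>\<beta>\<in>{1..<\<alpha>}. vanishes K g \<beta> (Suc \<nu> * M)"
                using van' g(3) unfolding NK(1) by blast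
              moreover have "\<forall>\<beta>. vanishes K g \<beta> (Suc (Suc \<nu> * M))" using van'' g(3) by blast
              ultimately have "\<forall>x\<in>torus M K. g x = 0"
                using P'(4) g(1) unfolding determines_def by blast
              then have "f (ext \<alpha> K y x) = 0" if "x \<in> torus M K" "y \<noteq> 0" for x y
                using g(2)[OF that] that(1) by simp
              then have "vanishes (K + Suc \<nu>) f \<alpha> (Suc \<nu> * M)"
                by (intro vanishes_if_vanishes_on_ext[OF adm' \<alpha>]) auto
              then show "\<forall>x\<in>torus M N. f x = 0"
                using next_color[OF adm van van'] zero unfolding NK(1) by blast
            qed
            then show ?thesis using card tor P(1) P'(1) by (intro exI[of _ ?P]) auto
          qed
        qed
      qed
    qed
    then show ?thesis using less.prems by auto
  qed
qed

theorem evaluation_points: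
  "\<exists>P. finite P \<and> P \<subseteq> torus M N \<and> card P \<le> card (monomials ({1..M} \<times> {0<..}) N) \<and>
     (\<forall>f. admissible N f \<longrightarrow> (\<forall>p\<in>P. f p = 0) \<longrightarrow> (\<forall>x\<in>torus M N. f x = 0))"
proof -
  obtain P where P: "finite P" "P \<subseteq> torus M N" "card P \<le> card (monomials (remaining M N 1) N)"
    "determines N N 1 P" using determining_points[of 1 N N] by auto
  have "vanishes N f \<beta> (Suc (N * M))" for f \<beta>
    by (rule vanishes_too_long) (simp only: mult.commute less_Suc_eq_le order_refl)
  then have "\<forall>f. admissible N f \<longrightarrow> (\<forall>p\<in>P. f p = 0) \<longrightarrow> (\<forall>x\<in>torus M N. f x = 0)"
    using P(4) unfolding determines_def by auto
  moreover have "card (monomials (remaining M N 1) N) \<le> card (monomials ({1..M} \<times> {0<..}) N)"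
    by (intro card_mono finite_monomials[OF order_refl] monomials_mono remaining_subset)
  ultimately show ?thesis using P by (intro exI[of _ P]) auto
qed

end

section \<open>The denominator as a product over arrows\<close>

definition arrows :: "nat \<Rightarrow> nat \<Rightarrow> ((nat \<times> nat) \<times> nat \<times> nat) set" where
  "arrows M N = {(u, w). u \<in> slots M N \<and> w \<in> slots M N \<and> u \<noteq> w \<and> fst w = cyc M (Suc (fst u))}"

lemma finite_arrows [simp, intro]: "finite (arrows M N)"
  by (rule finite_subset[of _ "slots M N \<times> slots M N"]) (auto simp: arrows_def)

lemma cyc_Suc_neq:
  assumes "2 \<le> M" shows "cyc M (Suc i) \<noteq> i"
proof
  assume "cyc M (Suc i) = i"
  then have "Suc i mod M = i mod M" using cyc_mod[of M "Suc i"] by simp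
  then show False using assms by (auto simp: mod_Suc split: if_splits)
qed

text \<open>
  This form covers one color and several colors alike. For one color every factor of
  \<open>(x\<^sub>a - x\<^sub>b)\<^sup>2\<close> belongs to one of the two ordered pairs, which changes the product by a sign.
\<close>

lemma denom_arrows:
  assumes "M \<ge> 1"
  shows "\<exists>\<epsilon>\<in>{1, - 1}. \<forall>x. denom M N x = \<epsilon> * (\<Prod>(u, w)\<in>arrows M N. at_slot x u - at_slot x w)"
proof (cases "M = 1")
  case False
  then have M: "2 \<le> M" using assms by simp
  have "denom M N x = (\<Prod>(u, w)\<in>arrows M N. at_slot x u - at_slot x w)" for x
  proof -
    have "denom M N x = (\<Prod>(i, a, b)\<in>{1..M} \<times> {1..N} \<times> {1..N}. x i a - x (cyc M (i + 1)) b)"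
      using False by (simp add: denom_def prod.cartesian_product)
    also have "\<dots> = (\<Prod>(u, w)\<in>arrows M N. at_slot x u - at_slot x w)"
      by (rule prod.reindex_bij_witness[of _ "\<lambda>(u, w). (fst u, snd u, snd w)"
            "\<lambda>(i, a, b). ((i, a), (cyc M (Suc i), b))"])
         (use cyc_range[OF assms] cyc_Suc_neq[OF M] cyc_Suc_neq[OF M, symmetric] in \<open>auto simp: arrows_def slots_def at_slot_def\<close>)
    finally show ?thesis .
  qed
  then show ?thesis by (intro bexI[of _ 1]) auto
next
  case True
  have c: "cyc (Suc 0) i = Suc 0" for i by (simp add: cyc_def)
  define L where "L = (SIGMA a:{1..N}. {a<..N})"
  have finL: "finite L" by (simp add: L_def)
  let ?f = "\<lambda>(a, b). ((1 :: nat, a), (1 :: nat, b))" and ?f' = "\<lambda>(a, b). ((1 :: nat, b), (1 :: nat, a))"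
  have arr: "arrows M N = ?f ` L \<union> ?f' ` L"
  proof (intro set_eqI iffI)
    fix v assume "v \<in> arrows M N"
    moreover obtain i a j b where ijab: "v = ((i, a), (j, b))" by (metis prod.collapse)
    ultimately have v: "v = ((1, a), (1, b))" "a \<in> {1..N}" "b \<in> {1..N}" "a \<noteq> b"
      by (auto simp: arrows_def slots_def True)
    then have "(a, b) \<in> L \<or> (b, a) \<in> L" by (simp add: L_def) linarith
    then show "v \<in> ?f ` L \<union> ?f' ` L" using v(1) by force
  qed (auto simp: arrows_def slots_def True c L_def)
  have disj: "?f ` L \<inter> ?f' ` L = {}" by (auto simp: L_def)
  have inj: "inj_on ?f L" "inj_on ?f' L" by (auto intro!: inj_onI)
  have "(\<Prod>(u, w)\<in>arrows M N. at_slot x u - at_slot x w) = (- 1) ^ card L * denom M N x" for x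
  proof -
    have "(\<Prod>(u, w)\<in>arrows M N. at_slot x u - at_slot x w)
        = (\<Prod>(a, b)\<in>L. x 1 a - x 1 b) * (\<Prod>(a, b)\<in>L. x 1 b - x 1 a)"
      unfolding arr
      by (subst prod.union_disjoint[OF _ _ disj], simp add: finL, simp add: finL,
          subst prod.reindex[OF inj(1)], subst prod.reindex[OF inj(2)])
        (simp add: case_prod_unfold at_slot_def)
    also have "\<dots> = (\<Prod>(a, b)\<in>L. (- 1) * (x 1 a - x 1 b) ^ 2)"
      unfolding prod.distrib[symmetric]
      by (intro prod.cong refl) (auto simp: power2_eq_square algebra_simps)
    also have "\<dots> = (- 1) ^ card L * (\<Prod>(a, b)\<in>L. (x 1 a - x 1 b) ^ 2)"
      unfolding case_prod_unfold prod.distrib prod_constant ..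
    also have "(\<Prod>(a, b)\<in>L. (x 1 a - x 1 b) ^ 2) = denom M N x"
      unfolding L_def by (subst prod.Sigma[symmetric]) (auto simp: denom_def True)
    finally show ?thesis .
  qed
  then have "denom M N x = (- 1) ^ card L * (\<Prod>(u, w)\<in>arrows M N. at_slot x u - at_slot x w)" for x
    by (simp add: mult.assoc[symmetric] flip: power_add mult_2)
  moreover have "(- 1 :: complex) ^ card L \<in> {1, - 1}" by (cases "even (card L)") auto
  ultimately show ?thesis by blast
qed

lemma regular_locus_iff:
  assumes "M \<ge> 1"
  shows "x \<in> regular_locus M N \<longleftrightarrow>
    x \<in> torus M N \<and> (\<forall>(u, w)\<in>arrows M N. at_slot x u \<noteq> at_slot x w)"
proof -
  obtain \<epsilon> where "\<epsilon> \<in> {1, - 1}" "denom M N x = \<epsilon> * (\<Prod>(u, w)\<in>arrows M N. at_slot x u - at_slot x w)"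
    using denom_arrows[OF assms] by blast
  then show ?thesis by (auto simp: regular_locus_def case_prod_unfold)
qed

lemma eventually_regular:
  assumes "M \<ge> 1" "x \<in> torus M N"
  shows "\<forall>\<^sub>F \<xi> in at 1. twist (spread N) \<xi> x \<in> regular_locus M N"
proof -
  have "\<forall>\<^sub>F \<xi> in at 1. \<forall>v\<in>arrows M N. \<xi> ^ spread N (fst (fst v)) (snd (fst v)) * at_slot x (fst v)
      \<noteq> \<xi> ^ spread N (fst (snd v)) (snd (snd v)) * at_slot x (snd v)"
  proof (intro eventually_ball_finite ballI eventually_powers_differ)
    fix v assume v: "v \<in> arrows M N"
    then show "at_slot x (fst v) \<noteq> 0" using assms(2) by (auto simp: arrows_def torus_iff)
    show "spread N (fst (fst v)) (snd (fst v)) \<noteq> spread N (fst (snd v)) (snd (snd v))"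
      using v spread_inj[of "snd (fst v)" N "snd (snd v)" "fst (fst v)" "fst (snd v)"]
      by (auto simp: arrows_def slots_def)
  qed auto
  then show ?thesis
    using eventually_neq_at_within[of 0 1 UNIV]
    by eventually_elim (auto simp: regular_locus_iff[OF assms(1)] twist_torus assms(2) at_slot_twist)
qed

lemma laurentian_extend:
  assumes "M \<ge> 1" "laurentian f" "laurentian g" "\<And>x. x \<in> regular_locus M N \<Longrightarrow> f x = g x"
    and "x \<in> torus M N"
  shows "f x = g x"
  by (rule laurentian_eqI[OF assms(2,3)], rule eventually_mono[OF eventually_regular[OF assms(1,5)]])
    (rule assms(4))

section \<open>Laurent sums and their limits\<close>

lemma prod_power_int_sum:
  fixes \<xi> :: complex
  assumes "\<xi> \<noteq> 0"
  shows "(\<Prod>i\<in>A. \<xi> powi g i) = \<xi> powi (\<Sum>i\<in>A. g i)"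
  by (induction A rule: infinite_finite_induct) (auto simp: power_int_add assms)

lemma laurent_expansion:
  assumes "laurent_polynomial M N f"
  shows "\<exists>R h. finite R \<and> (\<forall>r. laurentian (h r)) \<and> (\<forall>r x. r \<notin> R \<longrightarrow> h r x = 0) \<and>
    (\<forall>\<xi> x. \<xi> \<noteq> 0 \<longrightarrow> f (scale_slots S \<xi> x) = (\<Sum>r\<in>R. \<xi> powi r * h r x))"
proof -
  obtain E c where E: "finite E"
    and f: "f = (\<lambda>x. \<Sum>e\<in>E. c e * (\<Prod>i\<in>{1..M}. \<Prod>a\<in>{1..N}. x i a powi e i a))"
    using assms unfolding laurent_polynomial_def by blast
  define \<sigma> where "\<sigma> e = (\<Sum>i\<in>{1..M}. \<Sum>a\<in>{1..N}. if (i, a) \<in> S then e i a else 0)" for e :: "nat \<Rightarrow> nat \<Rightarrow> int"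
  define mon where "mon e x = (\<Prod>i\<in>{1..M}. \<Prod>a\<in>{1..N}. x i a powi e i a)" for e and x :: point
  define h where "h r x = (\<Sum>e\<in>{e\<in>E. \<sigma> e = r}. c e * mon e x)" for r and x :: point
  have mon: "mon e (scale_slots S \<xi> x) = \<xi> powi \<sigma> e * mon e x" if "\<xi> \<noteq> 0" for e \<xi> x
  proof -
    have "mon e (scale_slots S \<xi> x) =
        (\<Prod>i\<in>{1..M}. \<Prod>a\<in>{1..N}. \<xi> powi (if (i, a) \<in> S then e i a else 0) * x i a powi e i a)"
      unfolding mon_def by (intro prod.cong refl) (auto simp: scale_slots_def power_int_mult_distrib)
    then show ?thesis by (simp add: prod.distrib mon_def \<sigma>_def prod_power_int_sum that)
  qed
  have "f (scale_slots S \<xi> x) = (\<Sum>r\<in>\<sigma> ` E. \<xi> powi r * h r x)" if "\<xi> \<noteq> 0" for \<xi> x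
  proof -
    have "f (scale_slots S \<xi> x) = (\<Sum>e\<in>E. c e * (\<xi> powi \<sigma> e * mon e x))"
      unfolding f by (simp only: mon_def[symmetric] mon[OF that])
    also have "\<dots> = (\<Sum>r\<in>\<sigma> ` E. \<Sum>e\<in>{e\<in>E. \<sigma> e = r}. c e * (\<xi> powi \<sigma> e * mon e x))"
      by (rule sum.group[symmetric]) (use E in auto)
    also have "\<dots> = (\<Sum>r\<in>\<sigma> ` E. \<xi> powi r * h r x)"
      unfolding h_def sum_distrib_left by (intro sum.cong refl) auto
    finally show ?thesis .
  qed
  moreover have "laurentian (h r)" for r
    unfolding h_def[abs_def] mon_def
    by (intro laurentian_sum laurentian_mult laurentian_const laurentian_prod laurentian_coordinate_powi)
  moreover have "h r x = 0" if "r \<notin> \<sigma> ` E" for r x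
    unfolding h_def using that by (intro sum.neutral) auto
  ultimately show ?thesis using E by (intro exI[of _ "\<sigma> ` E"] exI[of _ h]) auto
qed

text \<open>
  The next two lemmas serve \<open>\<xi> \<rightarrow> \<infinity>\<close> with \<open>\<sigma> = 1\<close> and \<open>\<xi> \<rightarrow> 0\<close> with \<open>\<sigma> = - 1\<close>.
\<close>

lemma laurent_sum_tendsto:
  fixes Fl :: "complex filter" and \<sigma> :: int
  assumes R: "finite R" "\<And>r. r \<notin> R \<Longrightarrow> a r = 0"
    and ev: "\<forall>\<^sub>F \<xi> in Fl. \<xi> \<noteq> 0" and \<sigma>: "\<sigma> \<noteq> 0"
    and z: "\<And>z. \<sigma> * z < 0 \<Longrightarrow> ((\<lambda>\<xi>. \<xi> powi z) \<longlongrightarrow> 0) Fl"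
    and vanish: "\<And>r. \<sigma> * k < \<sigma> * r \<Longrightarrow> a r = 0"
  shows "((\<lambda>\<xi>. (\<Sum>r\<in>R. \<xi> powi r * a r) / \<xi> powi k) \<longlongrightarrow> a k) Fl"
proof -
  have "((\<lambda>\<xi>. \<Sum>r\<in>R. \<xi> powi (r - k) * a r) \<longlongrightarrow> (\<Sum>r\<in>R. if r = k then a r else 0)) Fl"
  proof (rule tendsto_sum)
    fix r assume "r \<in> R"
    consider "r = k" | "\<sigma> * k < \<sigma> * r" | "\<sigma> * r < \<sigma> * k" using \<sigma> by (metis linorder_neqE mult_left_cancel)
    then show "((\<lambda>\<xi>. \<xi> powi (r - k) * a r) \<longlongrightarrow> (if r = k then a r else 0)) Fl"
    proof cases
      case 2
      then show ?thesis using vanish by auto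
    next
      case 3
      then have "((\<lambda>\<xi>. \<xi> powi (r - k) * a r) \<longlongrightarrow> 0 * a r) Fl"
        by (intro tendsto_mult z tendsto_const) (simp add: right_diff_distrib)
      then show ?thesis using 3 by auto
    qed simp
  qed
  moreover have "(\<Sum>r\<in>R. if r = k then a r else 0) = a k"
    using R by (cases "k \<in> R") simp_all
  moreover have "\<forall>\<^sub>F \<xi> in Fl. (\<Sum>r\<in>R. \<xi> powi (r - k) * a r) = (\<Sum>r\<in>R. \<xi> powi r * a r) / \<xi> powi k"
    using ev by eventually_elim (simp add: sum_divide_distrib power_int_diff)
  ultimately show ?thesis by (simp add: tendsto_cong)
qed

lemma laurent_sum_vanish:
  fixes Fl :: "complex filter" and \<sigma> :: int
  assumes R: "finite R" "\<And>r. r \<notin> R \<Longrightarrow> a r = 0"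
    and ev: "\<forall>\<^sub>F \<xi> in Fl. \<xi> \<noteq> 0" and \<sigma>: "\<sigma> \<noteq> 0"
    and z: "\<And>z. \<sigma> * z < 0 \<Longrightarrow> ((\<lambda>\<xi>. \<xi> powi z) \<longlongrightarrow> 0) Fl"
    and nb: "Fl \<noteq> bot"
    and lim: "((\<lambda>\<xi>. (\<Sum>r\<in>R. \<xi> powi r * a r) / \<xi> powi k) \<longlongrightarrow> L) Fl"
    and r: "\<sigma> * k < \<sigma> * r"
  shows "a r = 0"
proof (rule ccontr)
  assume "a r \<noteq> 0"
  define T where "T = {r \<in> R. a r \<noteq> 0 \<and> \<sigma> * k < \<sigma> * r}"
  have T: "finite T" "T \<noteq> {}" using R r \<open>a r \<noteq> 0\<close> by (auto simp: T_def)
  then have "Max ((*) \<sigma> ` T) \<in> (*) \<sigma> ` T" by (intro Max_in) auto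
  then obtain r0 where r0: "r0 \<in> T" "\<sigma> * r0 = Max ((*) \<sigma> ` T)" by auto
  have "a r' = 0" if "\<sigma> * r0 < \<sigma> * r'" for r'
  proof (rule ccontr)
    assume "a r' \<noteq> 0"
    then have "r' \<in> T" using R(2)[of r'] that r0(1) by (auto simp: T_def)
    then have "\<sigma> * r' \<le> \<sigma> * r0" unfolding r0(2) using T(1) by (intro Max_ge) auto
    then show False using that by simp
  qed
  then have 1: "((\<lambda>\<xi>. (\<Sum>r\<in>R. \<xi> powi r * a r) / \<xi> powi r0) \<longlongrightarrow> a r0) Fl"
    by (intro laurent_sum_tendsto[OF R ev \<sigma> z]) auto
  have "((\<lambda>\<xi>. (\<Sum>r\<in>R. \<xi> powi r * a r) / \<xi> powi k * \<xi> powi (k - r0)) \<longlongrightarrow> L * 0) Fl"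
    using r0(1) by (intro tendsto_mult lim z) (auto simp: T_def right_diff_distrib)
  moreover have "\<forall>\<^sub>F \<xi> in Fl. (\<Sum>r\<in>R. \<xi> powi r * a r) / \<xi> powi k * \<xi> powi (k - r0)
      = (\<Sum>r\<in>R. \<xi> powi r * a r) / \<xi> powi r0"
    using ev by eventually_elim (simp add: power_int_diff)
  ultimately have "((\<lambda>\<xi>. (\<Sum>r\<in>R. \<xi> powi r * a r) / \<xi> powi r0) \<longlongrightarrow> L * 0) Fl"
    by (simp add: tendsto_cong)
  then have "a r0 = 0" using tendsto_unique[OF nb 1] by simp
  then show False using r0(1) by (simp add: T_def)
qed

lemma powi_at_infinity:
  fixes z :: int assumes "1 * z < 0" shows "((\<lambda>\<xi> :: complex. \<xi> powi z) \<longlongrightarrow> 0) at_infinity"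
proof -
  have "((\<lambda>\<xi> :: complex. inverse \<xi> ^ nat (- z)) \<longlongrightarrow> 0 ^ nat (- z)) at_infinity"
    by (intro tendsto_power tendsto_inverse_0)
  moreover have "(0 :: complex) ^ nat (- z) = 0" using assms by (intro zero_power) simp
  ultimately show ?thesis using assms by (simp add: power_int_def)
qed

lemma powi_at_zero:
  fixes z :: int assumes "- 1 * z < 0" shows "((\<lambda>\<xi> :: complex. \<xi> powi z) \<longlongrightarrow> 0) (at 0)"
proof -
  have "((\<lambda>\<xi> :: complex. \<xi> ^ nat z) \<longlongrightarrow> 0 ^ nat z) (at 0)"
    by (intro tendsto_intros)
  moreover have "(0 :: complex) ^ nat z = 0" using assms by (intro zero_power) simp
  ultimately show ?thesis using assms by (simp add: power_int_def)
qed

section \<open>Numerators are admissible\<close>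

definition out_arrows :: "nat \<Rightarrow> nat \<Rightarrow> (nat \<times> nat) set \<Rightarrow> ((nat \<times> nat) \<times> nat \<times> nat) set" where
  "out_arrows M N S = {(u, w) \<in> arrows M N. u \<in> S \<and> w \<notin> S}"

definition in_arrows :: "nat \<Rightarrow> nat \<Rightarrow> (nat \<times> nat) set \<Rightarrow> ((nat \<times> nat) \<times> nat \<times> nat) set" where
  "in_arrows M N S = {(u, w) \<in> arrows M N. u \<notin> S \<and> w \<in> S}"

definition inner_arrows :: "nat \<Rightarrow> nat \<Rightarrow> (nat \<times> nat) set \<Rightarrow> ((nat \<times> nat) \<times> nat \<times> nat) set" where
  "inner_arrows M N S = {(u, w) \<in> arrows M N. u \<in> S \<and> w \<in> S}"

definition outer_arrows :: "nat \<Rightarrow> nat \<Rightarrow> (nat \<times> nat) set \<Rightarrow> ((nat \<times> nat) \<times> nat \<times> nat) set" where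
  "outer_arrows M N S = {(u, w) \<in> arrows M N. u \<notin> S \<and> w \<notin> S}"

lemma finite_arrow_parts [simp, intro]:
  "finite (out_arrows M N S)" "finite (in_arrows M N S)"
  "finite (inner_arrows M N S)" "finite (outer_arrows M N S)"
  by (auto simp: out_arrows_def in_arrows_def inner_arrows_def outer_arrows_def
      intro: finite_subset[OF _ finite_arrows[of M N]])

lemma prod_arrows_split:
  fixes \<phi> :: "_ \<Rightarrow> complex"
  shows "(\<Prod>v\<in>arrows M N. \<phi> v) = (\<Prod>v\<in>inner_arrows M N S. \<phi> v) * (\<Prod>v\<in>outer_arrows M N S. \<phi> v) *
    (\<Prod>v\<in>out_arrows M N S. \<phi> v) * (\<Prod>v\<in>in_arrows M N S. \<phi> v)"
proof -
  have split: "arrows M N = inner_arrows M N S \<union> (outer_arrows M N S \<union> (out_arrows M N S \<union> in_arrows M N S))"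
    by (auto simp: out_arrows_def in_arrows_def inner_arrows_def outer_arrows_def)
  have d1: "inner_arrows M N S \<inter> (outer_arrows M N S \<union> (out_arrows M N S \<union> in_arrows M N S)) = {}"
    and d2: "outer_arrows M N S \<inter> (out_arrows M N S \<union> in_arrows M N S) = {}"
    and d3: "out_arrows M N S \<inter> in_arrows M N S = {}"
    by (auto simp: out_arrows_def in_arrows_def inner_arrows_def outer_arrows_def)
  show ?thesis
    unfolding split by (simp add: prod.union_disjoint d1 d2 d3 mult.assoc)
qed

context shuffle_parameters
begin

lemma crossing_arrows:
  assumes "S \<subseteq> slots M N"
  shows "crossing N S \<phi> =
    (\<Prod>(u, w)\<in>out_arrows M N S. \<phi> u w) * (\<Prod>(u, w)\<in>in_arrows M N S. \<phi> w u)"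
proof -
  let ?U = "S \<times> (slots M N - S)"
  have fin: "finite ?U" using assms finite_subset finite_slots by blast
  have "crossing N S \<phi> = (\<Prod>(u, w)\<in>?U. \<phi> u w ^ link M (fst u) (fst w))"
    unfolding crossing_def by (simp add: prod.cartesian_product)
  also have "\<dots> = (\<Prod>v\<in>?U. if col (Suc (fst (fst v))) = fst (snd v) then \<phi> (fst v) (snd v) else 1) *
      (\<Prod>v\<in>?U. if col (Suc (fst (snd v))) = fst (fst v) then \<phi> (fst v) (snd v) else 1)"
    unfolding prod.distrib[symmetric] by (intro prod.cong refl) (auto simp: link_def)
  also have "(\<Prod>v\<in>?U. if col (Suc (fst (fst v))) = fst (snd v) then \<phi> (fst v) (snd v) else 1) =
      (\<Prod>v\<in>{v\<in>?U. col (Suc (fst (fst v))) = fst (snd v)}. \<phi> (fst v) (snd v))"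
    by (rule prod.inter_filter[OF fin, symmetric])
  also have "\<dots> = (\<Prod>(u, w)\<in>out_arrows M N S. \<phi> u w)"
    by (rule prod.cong) (use assms in \<open>auto simp: out_arrows_def arrows_def\<close>)
  also have "(\<Prod>v\<in>?U. if col (Suc (fst (snd v))) = fst (fst v) then \<phi> (fst v) (snd v) else 1) =
      (\<Prod>v\<in>{v\<in>?U. col (Suc (fst (snd v))) = fst (fst v)}. \<phi> (fst v) (snd v))"
    by (rule prod.inter_filter[OF fin, symmetric])
  also have "\<dots> = (\<Prod>(u, w)\<in>in_arrows M N S. \<phi> w u)"
    by (rule prod.reindex_bij_witness[of _ prod.swap prod.swap])
      (use assms in \<open>auto simp: in_arrows_def arrows_def\<close>)
  finally show ?thesis .
qed

lemma cross_arrows: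
  assumes "S \<subseteq> slots M N"
  shows "cross M N S = card (out_arrows M N S) + card (in_arrows M N S)"
proof -
  have "(2 :: complex) ^ cross M N S = crossing N S (\<lambda>_ _. 2)"
    by (simp add: cross_def crossing_def power_sum)
  also have "\<dots> = 2 ^ (card (out_arrows M N S) + card (in_arrows M N S))"
    unfolding crossing_arrows[OF assms] by (simp add: power_add case_prod_unfold)
  finally have "of_nat (2 ^ cross M N S) = (of_nat (2 ^ (card (out_arrows M N S) + card (in_arrows M N S))) :: complex)"
    by simp
  then show ?thesis unfolding of_nat_eq_iff by simp
qed

text \<open>
  Multiplying by the denominator turns the limit condition for the rational function into one for the
  numerator. The arrows leaving and entering \<open>S\<close> contribute factors in which only one variable is scaled;
  the sign arises from those factors in which the surviving variable is subtracted.
\<close>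

lemma ratfun_scale_limits:
  assumes f: "depends_on_slots N f" and S: "S \<subseteq> slots M N" and x: "x \<in> regular_locus M N"
    and inf: "((\<lambda>\<xi>. ratfun M N f (scale_slots S \<xi> x)) \<longlongrightarrow> Fi) at_infinity"
    and zero: "((\<lambda>\<xi>. ratfun M N f (scale_slots S \<xi> x)) \<longlongrightarrow> Fz) (at 0)"
    and rel: "Fi = Fz * \<theta>"
  defines "b \<equiv> card (inner_arrows M N S)"
  shows "\<exists>A B. ((\<lambda>\<xi>. f (scale_slots S \<xi> x) / \<xi> ^ (b + cross M N S)) \<longlongrightarrow> A) at_infinity \<and>
     ((\<lambda>\<xi>. f (scale_slots S \<xi> x) / \<xi> ^ b) \<longlongrightarrow> B) (at 0) \<and>
     A * crossing N S (\<lambda>u w. at_slot x w) =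
       B * crossing N S (\<lambda>u w. at_slot x u) * ((- 1) ^ cross M N S * \<theta>)"
proof -
  have xt: "x \<in> torus M N" and xa: "\<And>u w. (u, w) \<in> arrows M N \<Longrightarrow> at_slot x u \<noteq> at_slot x w"
    using x regular_locus_iff[OF M_pos] by auto
  obtain \<epsilon> where \<epsilon>: "\<epsilon> \<in> {1, - 1}" "\<And>x. denom M N x = \<epsilon> * (\<Prod>(u, w)\<in>arrows M N. at_slot x u - at_slot x w)"
    using denom_arrows[OF M_pos] by blast
  have \<epsilon>0: "\<epsilon> \<noteq> 0" using \<epsilon>(1) by auto
  let ?I = "in_arrows M N S" and ?O = "out_arrows M N S"
  define K where "K = \<epsilon> * (\<Prod>(u, w)\<in>inner_arrows M N S. at_slot x u - at_slot x w) *
     (\<Prod>(u, w)\<in>outer_arrows M N S. at_slot x u - at_slot x w)"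
  have "(\<Prod>(u, w)\<in>inner_arrows M N S. at_slot x u - at_slot x w) \<noteq> 0"
    "(\<Prod>(u, w)\<in>outer_arrows M N S. at_slot x u - at_slot x w) \<noteq> 0"
    unfolding prod_zero_iff[OF finite_arrow_parts(3)] prod_zero_iff[OF finite_arrow_parts(4)]
    using xa by (auto simp: inner_arrows_def outer_arrows_def)
  then have K: "K \<noteq> 0" using \<epsilon>0 by (simp add: K_def)
  define D where "D \<xi> = K * ((\<Prod>v\<in>?O. \<xi> * at_slot x (fst v) - at_slot x (snd v)) *
     (\<Prod>v\<in>?I. at_slot x (fst v) - \<xi> * at_slot x (snd v)))" for \<xi>
  have denom: "denom M N (scale_slots S \<xi> x) = \<xi> ^ b * D \<xi>" for \<xi>
  proof -
    have "(\<Prod>(u, w)\<in>inner_arrows M N S. at_slot (scale_slots S \<xi> x) u - at_slot (scale_slots S \<xi> x) w)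
        = (\<Prod>v\<in>inner_arrows M N S. \<xi> * (at_slot x (fst v) - at_slot x (snd v)))"
      by (intro prod.cong refl) (auto simp: inner_arrows_def at_slot_scale algebra_simps)
    moreover have "(\<Prod>(u, w)\<in>outer_arrows M N S. at_slot (scale_slots S \<xi> x) u - at_slot (scale_slots S \<xi> x) w)
        = (\<Prod>v\<in>outer_arrows M N S. at_slot x (fst v) - at_slot x (snd v))"
      by (intro prod.cong refl) (auto simp: outer_arrows_def at_slot_scale)
    moreover have "(\<Prod>(u, w)\<in>?O. at_slot (scale_slots S \<xi> x) u - at_slot (scale_slots S \<xi> x) w)
        = (\<Prod>v\<in>?O. \<xi> * at_slot x (fst v) - at_slot x (snd v))"
      by (intro prod.cong refl) (auto simp: out_arrows_def at_slot_scale)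
    moreover have "(\<Prod>(u, w)\<in>?I. at_slot (scale_slots S \<xi> x) u - at_slot (scale_slots S \<xi> x) w)
        = (\<Prod>v\<in>?I. at_slot x (fst v) - \<xi> * at_slot x (snd v))"
      by (intro prod.cong refl) (auto simp: in_arrows_def at_slot_scale)
    ultimately show ?thesis
      unfolding \<epsilon>(2) prod_arrows_split[of _ M N S]
      by (simp add: D_def K_def b_def prod.distrib case_prod_unfold mult_ac)
  qed
  have f_eq: "f (scale_slots S \<xi> x) = ratfun M N f (scale_slots S \<xi> x) * (\<xi> ^ b * D \<xi>)"
    if "\<xi> \<noteq> 0" "D \<xi> \<noteq> 0" for \<xi>
  proof -
    have "scale_slots S \<xi> x \<in> regular_locus M N"
      using scale_slots_torus[OF xt that(1)] that denom by (auto simp: regular_locus_def)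
    then show ?thesis using that by (simp add: ratfun_def denom)
  qed
  define c where "c = cross M N S"
  have c: "c = card ?O + card ?I" unfolding c_def by (rule cross_arrows[OF S])
  define Di where "Di = K * ((\<Prod>v\<in>?O. at_slot x (fst v)) * (\<Prod>v\<in>?I. - at_slot x (snd v)))"
  define Dz where "Dz = K * ((\<Prod>v\<in>?O. - at_slot x (snd v)) * (\<Prod>v\<in>?I. at_slot x (fst v)))"
  have nz: "at_slot x (fst v) \<noteq> 0" "at_slot x (snd v) \<noteq> 0" if "v \<in> ?O \<or> v \<in> ?I" for v
    using that xt by (auto simp: in_arrows_def out_arrows_def arrows_def torus_iff)
  have Dnz: "Di \<noteq> 0" "Dz \<noteq> 0" using K nz by (auto simp: Di_def Dz_def)
  have Dinf: "((\<lambda>\<xi>. D \<xi> / \<xi> ^ c) \<longlongrightarrow> Di) at_infinity"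
  proof -
    have "((\<lambda>\<xi>. K * ((\<Prod>v\<in>?O. at_slot x (fst v) - at_slot x (snd v) * inverse \<xi>) *
        (\<Prod>v\<in>?I. at_slot x (fst v) * inverse \<xi> - at_slot x (snd v)))) \<longlongrightarrow>
      K * ((\<Prod>v\<in>?O. at_slot x (fst v) - at_slot x (snd v) * 0) *
        (\<Prod>v\<in>?I. at_slot x (fst v) * 0 - at_slot x (snd v)))) at_infinity"
      by (intro tendsto_intros tendsto_inverse_0)
    moreover have "\<forall>\<^sub>F \<xi> in at_infinity. K * ((\<Prod>v\<in>?O. at_slot x (fst v) - at_slot x (snd v) * inverse \<xi>) *
        (\<Prod>v\<in>?I. at_slot x (fst v) * inverse \<xi> - at_slot x (snd v))) = D \<xi> / \<xi> ^ c"
      using eventually_not_equal_at_infinity[of 0]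
    proof eventually_elim
      case (elim \<xi>)
      have "(\<Prod>v\<in>?O. at_slot x (fst v) - at_slot x (snd v) * inverse \<xi>)
          = (\<Prod>v\<in>?O. (\<xi> * at_slot x (fst v) - at_slot x (snd v)) / \<xi>)"
        using elim by (intro prod.cong refl) (simp add: field_simps)
      moreover have "(\<Prod>v\<in>?I. at_slot x (fst v) * inverse \<xi> - at_slot x (snd v))
          = (\<Prod>v\<in>?I. (at_slot x (fst v) - \<xi> * at_slot x (snd v)) / \<xi>)"
        using elim by (intro prod.cong refl) (simp add: field_simps)
      ultimately show ?case by (simp add: D_def c prod_dividef power_add)
    qed
    ultimately show ?thesis by (simp add: tendsto_cong Di_def)
  qed
  have Dzero: "(D \<longlongrightarrow> Dz) (at 0)"
  proof -
    have "(D \<longlongrightarrow> K * ((\<Prod>v\<in>?O. 0 * at_slot x (fst v) - at_slot x (snd v)) *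
        (\<Prod>v\<in>?I. at_slot x (fst v) - 0 * at_slot x (snd v)))) (at 0)"
      unfolding D_def by (intro tendsto_intros)
    then show ?thesis by (simp add: Dz_def)
  qed
  have lim_inf: "((\<lambda>\<xi>. f (scale_slots S \<xi> x) / \<xi> ^ (b + c)) \<longlongrightarrow> Fi * Di) at_infinity"
  proof -
    have "\<forall>\<^sub>F \<xi> in at_infinity. D \<xi> / \<xi> ^ c \<noteq> 0"
      using Dinf by (rule tendsto_imp_eventually_ne) (rule Dnz)
    then have "\<forall>\<^sub>F \<xi> in at_infinity. ratfun M N f (scale_slots S \<xi> x) * (D \<xi> / \<xi> ^ c)
        = f (scale_slots S \<xi> x) / \<xi> ^ (b + c)"
      using eventually_not_equal_at_infinity[of 0]
      by eventually_elim (simp add: f_eq power_add)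
    then show ?thesis using tendsto_mult[OF inf Dinf] by (simp add: tendsto_cong)
  qed
  have lim_zero: "((\<lambda>\<xi>. f (scale_slots S \<xi> x) / \<xi> ^ b) \<longlongrightarrow> Fz * Dz) (at 0)"
  proof -
    have "\<forall>\<^sub>F \<xi> in at 0. D \<xi> \<noteq> 0"
      using Dzero by (rule tendsto_imp_eventually_ne) (rule Dnz)
    then have "\<forall>\<^sub>F \<xi> in at 0. ratfun M N f (scale_slots S \<xi> x) * D \<xi> = f (scale_slots S \<xi> x) / \<xi> ^ b"
      using eventually_neq_at_within[of 0 0 UNIV]
      by eventually_elim (simp add: f_eq)
    then show ?thesis using tendsto_mult[OF zero Dzero] by (simp add: tendsto_cong)
  qed
  have "Di * crossing N S (\<lambda>u w. at_slot x w) =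
      Dz * crossing N S (\<lambda>u w. at_slot x u) * (- 1) ^ c"
  proof -
    have neg: "(\<Prod>v\<in>X. - at_slot x (snd v)) = (- 1) ^ card X * (\<Prod>v\<in>X. at_slot x (snd v))" for X
      by (induction X rule: infinite_finite_induct) auto
    have sq: "(- 1 :: complex) ^ card ?O * (- 1) ^ card ?O = 1" by (simp flip: power_add mult_2)
    have "(- 1) ^ card ?O * (- 1) ^ c = (- 1 :: complex) ^ card ?I"
      unfolding c power_add using sq by (simp add: mult.assoc[symmetric])
    then show ?thesis
      unfolding crossing_arrows[OF S] Di_def Dz_def neg
      by (simp add: case_prod_unfold mult_ac)
  qed
  then have "Fi * Di * crossing N S (\<lambda>u w. at_slot x w) =
      Fz * Dz * crossing N S (\<lambda>u w. at_slot x u) * ((- 1) ^ c * \<theta>)"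
    unfolding rel by (simp add: mult_ac)
  then show ?thesis using lim_inf lim_zero unfolding c_def by blast
qed

end

lemma laurent_polynomial_depends:
  assumes "laurent_polynomial M N f" "\<And>u. u \<in> slots M N \<Longrightarrow> at_slot x u = at_slot x' u"
  shows "f x = f x'"
proof -
  obtain E c where f: "f = (\<lambda>x. \<Sum>e\<in>E. c e * (\<Prod>i\<in>{1..M}. \<Prod>a\<in>{1..N}. x i a powi e i a))"
    using assms(1) unfolding laurent_polynomial_def by blast
  have "x i a = x' i a" if "i \<in> {1..M}" "a \<in> {1..N}" for i a
    using assms(2)[of "(i, a)"] that by (simp add: slots_def at_slot_def)
  then show ?thesis unfolding f by (intro sum.cong arg_cong2[where f = "(*)"] prod.cong refl) simp
qed

lemma torus_depends:
  assumes "\<And>u. u \<in> slots M N \<Longrightarrow> at_slot x u = at_slot x' u"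
  shows "x \<in> torus M N \<longleftrightarrow> x' \<in> torus M N"
  using assms by (auto simp: torus_iff)

lemma denom_depends:
  assumes "M \<ge> 1" "\<And>u. u \<in> slots M N \<Longrightarrow> at_slot x u = at_slot x' u"
  shows "denom M N x = denom M N x'"
proof -
  obtain \<epsilon> where \<epsilon>: "\<And>x. denom M N x = \<epsilon> * (\<Prod>(u, w)\<in>arrows M N. at_slot x u - at_slot x w)"
    using denom_arrows[OF assms(1)] by blast
  have "(\<Prod>(u, w)\<in>arrows M N. at_slot x u - at_slot x w) = (\<Prod>(u, w)\<in>arrows M N. at_slot x' u - at_slot x' w)"
    by (rule prod.cong) (auto simp: arrows_def assms(2))
  then show ?thesis unfolding \<epsilon> by simp
qed

lemma ratfun_depends:
  assumes "M \<ge> 1" "laurent_polynomial M N f" "\<And>u. u \<in> slots M N \<Longrightarrow> at_slot x u = at_slot x' u"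
  shows "ratfun M N f x = ratfun M N f x'"
proof -
  have "denom M N x = denom M N x'" by (rule denom_depends[OF assms(1,3)])
  moreover have "x \<in> torus M N \<longleftrightarrow> x' \<in> torus M N" by (rule torus_depends[OF assms(3)])
  moreover have "f x = f x'" by (rule laurent_polynomial_depends[OF assms(2,3)])
  ultimately show ?thesis by (simp add: ratfun_def regular_locus_def)
qed

lemma denom_permute:
  assumes M: "M \<ge> 1" and \<pi>: "\<pi> permutes {1..N}"
  shows "denom M N (x(i := x i \<circ> \<pi>)) = denom M N x"
proof -
  obtain \<epsilon> where \<epsilon>: "\<And>x. denom M N x = \<epsilon> * (\<Prod>(u, w)\<in>arrows M N. at_slot x u - at_slot x w)"
    using denom_arrows[OF M] by blast
  define \<sigma> where "\<sigma> \<rho> u = (if fst u = i then (i, \<rho> (snd u)) else u)" for \<rho> :: "nat \<Rightarrow> nat" and u :: "nat \<times> nat"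
  have fst: "fst (\<sigma> \<rho> u) = fst u" for \<rho> u by (simp add: \<sigma>_def)
  have slots: "\<sigma> \<rho> u \<in> slots M N" if "\<rho> permutes {1..N}" "u \<in> slots M N" for \<rho> u
    using that permutes_in_image[OF that(1), of "snd u"] by (auto simp: \<sigma>_def slots_def)
  have inv: "\<sigma> \<pi> (\<sigma> (inv \<pi>) u) = u" "\<sigma> (inv \<pi>) (\<sigma> \<pi> u) = u" for u
    using permutes_inverses[OF \<pi>] by (auto simp: \<sigma>_def prod_eq_iff)
  have arr: "(\<sigma> \<rho> u, \<sigma> \<rho> w) \<in> arrows M N" if "\<rho> = \<pi> \<or> \<rho> = inv \<pi>" "(u, w) \<in> arrows M N" for \<rho> u w
  proof -
    have "\<rho> permutes {1..N}" using that(1) \<pi> permutes_inv[OF \<pi>] by auto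
    moreover have "\<sigma> \<rho> u \<noteq> \<sigma> \<rho> w" if "u \<noteq> w"
      using that inv \<open>\<rho> = \<pi> \<or> \<rho> = inv \<pi>\<close> by metis
    ultimately show ?thesis using that slots by (auto simp: arrows_def fst)
  qed
  have "(\<Prod>(u, w)\<in>arrows M N. at_slot (x(i := x i \<circ> \<pi>)) u - at_slot (x(i := x i \<circ> \<pi>)) w)
      = (\<Prod>(u, w)\<in>arrows M N. at_slot x u - at_slot x w)"
  proof (rule prod.reindex_bij_witness[of _ "map_prod (\<sigma> (inv \<pi>)) (\<sigma> (inv \<pi>))" "map_prod (\<sigma> \<pi>) (\<sigma> \<pi>)"])
    fix v assume v: "v \<in> arrows M N"
    show "map_prod (\<sigma> (inv \<pi>)) (\<sigma> (inv \<pi>)) (map_prod (\<sigma> \<pi>) (\<sigma> \<pi>) v) = v"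
      "map_prod (\<sigma> \<pi>) (\<sigma> \<pi>) (map_prod (\<sigma> (inv \<pi>)) (\<sigma> (inv \<pi>)) v) = v"
      by (simp_all add: inv map_prod_def case_prod_unfold)
    show "map_prod (\<sigma> \<pi>) (\<sigma> \<pi>) v \<in> arrows M N" "map_prod (\<sigma> (inv \<pi>)) (\<sigma> (inv \<pi>)) v \<in> arrows M N"
      using v arr[of \<pi> "fst v" "snd v"] arr[of "inv \<pi>" "fst v" "snd v"]
      by (simp_all add: map_prod_def case_prod_unfold)
    show "(case map_prod (\<sigma> \<pi>) (\<sigma> \<pi>) v of (u, w) \<Rightarrow> at_slot x u - at_slot x w) =
      (case v of (u, w) \<Rightarrow> at_slot (x(i := x i \<circ> \<pi>)) u - at_slot (x(i := x i \<circ> \<pi>)) w)"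
      by (auto simp: \<sigma>_def at_slot_def split: prod.splits)
  qed
  then show ?thesis unfolding \<epsilon> by simp
qed

lemma torus_permute:
  assumes "\<pi> permutes {1..N}" "x \<in> torus M N"
  shows "x(i := x i \<circ> \<pi>) \<in> torus M N"
  unfolding torus_def
proof (intro CollectI ballI)
  fix j a assume *: "j \<in> {1..M}" "a \<in> {1..N}"
  have "\<pi> a \<in> {1..N}" using permutes_in_image[OF assms(1)] *(2) by simp
  then show "(x(i := x i \<circ> \<pi>)) j a \<noteq> 0" using assms(2) * by (auto simp: torus_def)
qed

lemma laurentian_permute:
  assumes "laurentian f"
  shows "laurentian (\<lambda>x. f (x(i := x i \<circ> \<pi>)))"
proof -
  have "(twist e \<xi> x)(i := twist e \<xi> x i \<circ> \<pi>) = twist (e(i := e i \<circ> \<pi>)) \<xi> (x(i := x i \<circ> \<pi>))" for e \<xi> x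
    by (auto simp: twist_def fun_eq_iff)
  then show ?thesis using assms unfolding laurentian_def by simp
qed

lemma numerator_permute:
  assumes M: "M \<ge> 1" and f: "laurentian f" and \<pi>: "\<pi> permutes {1..N}"
    and sym: "\<And>x. ratfun M N f (x(i := x i \<circ> \<pi>)) = c * ratfun M N f x" and x: "x \<in> torus M N"
  shows "f (x(i := x i \<circ> \<pi>)) = c * f x"
proof (rule laurentian_extend[OF M laurentian_permute[OF f] laurentian_mult[OF laurentian_const f] _ x])
  fix x assume x: "x \<in> regular_locus M N"
  then have "x(i := x i \<circ> \<pi>) \<in> regular_locus M N"
    using torus_permute[OF \<pi>] by (simp add: regular_locus_def denom_permute[OF M \<pi>])
  then show "f (x(i := x i \<circ> \<pi>)) = c * f x"
    using sym[of x] x by (simp add: ratfun_def denom_permute[OF M \<pi>] regular_locus_def)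
qed

context shuffle_parameters
begin

lemma laurentian_crossing:
  "(\<And>u w. laurentian (\<lambda>x. \<phi> x u w)) \<Longrightarrow> laurentian (\<lambda>x. crossing N S (\<phi> x))"
  unfolding crossing_def by (intro laurentian_prod laurentian_power) auto

text \<open>
  The coefficients \<open>h r\<close> of \<open>f\<close> in \<open>\<xi>\<close> are Laurent polynomials in the point, so their vanishing
  outside the allowed range and the relation between the extreme ones extend from the regular locus to
  the torus. This is needed because segments may contain neighboring variables with equal values, where
  the denominator vanishes.
\<close>

lemma balanced_if_generically_balanced:
  assumes f: "laurent_polynomial M N f" and g: "g \<in> GG"
    and reg: "\<And>x. x \<in> regular_locus M N \<Longrightarrow> \<exists>A B.
      ((\<lambda>\<xi>. f (scale_slots S \<xi> x) / \<xi> ^ (b + cross M N S)) \<longlongrightarrow> A) at_infinity \<and>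
      ((\<lambda>\<xi>. f (scale_slots S \<xi> x) / \<xi> ^ b) \<longlongrightarrow> B) (at 0) \<and>
      A * crossing N S (\<lambda>u w. at_slot x w) =
        B * crossing N S (\<lambda>u w. at_slot x u) * g * (\<Prod>u\<in>S. s (fst u))"
  shows "balanced N f S b"
proof -
  obtain R h where R: "finite R" and h: "\<And>r. laurentian (h r)" "\<And>r x. r \<notin> R \<Longrightarrow> h r x = 0"
    and fh: "\<And>\<xi> x. \<xi> \<noteq> 0 \<Longrightarrow> f (scale_slots S \<xi> x) = (\<Sum>r\<in>R. \<xi> powi r * h r x)"
    using laurent_expansion[OF f, of S] by blast
  let ?c = "b + cross M N S"
  have conv_inf: "((\<lambda>\<xi>. f (scale_slots S \<xi> x) / \<xi> ^ ?c) \<longlongrightarrow> L) at_infinity \<longleftrightarrow>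
      ((\<lambda>\<xi>. (\<Sum>r\<in>R. \<xi> powi r * h r x) / \<xi> powi int ?c) \<longlongrightarrow> L) at_infinity" for x L
    by (rule tendsto_cong)
       (use eventually_not_equal_at_infinity[of 0] in eventually_elim, simp add: fh power_int_def nat_add_distrib)
  have conv_zero: "((\<lambda>\<xi>. f (scale_slots S \<xi> x) / \<xi> ^ b) \<longlongrightarrow> L) (at 0) \<longleftrightarrow>
      ((\<lambda>\<xi>. (\<Sum>r\<in>R. \<xi> powi r * h r x) / \<xi> powi int b) \<longlongrightarrow> L) (at 0)" for x L
    by (rule tendsto_cong)
       (use eventually_neq_at_within[of 0 0 UNIV] in eventually_elim, simp add: fh power_int_def)
  have reg': "(\<forall>r. int ?c < r \<longrightarrow> h r x = 0) \<and> (\<forall>r. r < int b \<longrightarrow> h r x = 0) \<and>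
      h ?c x * crossing N S (\<lambda>u w. at_slot x w) =
        h b x * (crossing N S (\<lambda>u w. at_slot x u) * (g * (\<Prod>u\<in>S. s (fst u))))"
    if x: "x \<in> regular_locus M N" for x
  proof -
    obtain A B where A: "((\<lambda>\<xi>. f (scale_slots S \<xi> x) / \<xi> ^ ?c) \<longlongrightarrow> A) at_infinity"
      and B: "((\<lambda>\<xi>. f (scale_slots S \<xi> x) / \<xi> ^ b) \<longlongrightarrow> B) (at 0)"
      and rel: "A * crossing N S (\<lambda>u w. at_slot x w) =
        B * crossing N S (\<lambda>u w. at_slot x u) * g * (\<Prod>u\<in>S. s (fst u))" using reg[OF x] by blast
    have above: "h r x = 0" if "int ?c < r" for r
      by (rule laurent_sum_vanish[where a = "\<lambda>r. h r x" and \<sigma> = 1 and k = "int ?c" and L = A,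
            OF R h(2) eventually_not_equal_at_infinity])
         (use powi_at_infinity A conv_inf at_infinity_nontrivial that in auto)
    have below: "h r x = 0" if "r < int b" for r
      by (rule laurent_sum_vanish[where a = "\<lambda>r. h r x" and \<sigma> = "- 1" and k = "int b" and L = B,
            OF R h(2) eventually_neq_at_within[of 0 0 UNIV]])
         (use powi_at_zero B conv_zero that in auto)
    have "((\<lambda>\<xi>. (\<Sum>r\<in>R. \<xi> powi r * h r x) / \<xi> powi int ?c) \<longlongrightarrow> h ?c x) at_infinity"
      by (rule laurent_sum_tendsto[where a = "\<lambda>r. h r x" and \<sigma> = 1 and k = "int ?c",
            OF R h(2) eventually_not_equal_at_infinity])
         (use powi_at_infinity above in auto)
    then have "A = h ?c x" using A unfolding conv_inf using tendsto_unique at_infinity_nontrivial by blast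
    moreover have "((\<lambda>\<xi>. (\<Sum>r\<in>R. \<xi> powi r * h r x) / \<xi> powi int b) \<longlongrightarrow> h b x) (at 0)"
      by (rule laurent_sum_tendsto[where a = "\<lambda>r. h r x" and \<sigma> = "- 1" and k = "int b",
            OF R h(2) eventually_neq_at_within[of 0 0 UNIV]])
         (use powi_at_zero below in auto)
    then have "B = h b x" using B unfolding conv_zero using tendsto_unique at_neq_bot by blast
    ultimately show ?thesis using rel above below by (simp add: mult.assoc)
  qed
  show ?thesis
    unfolding balanced_def
  proof
    fix x assume x: "x \<in> torus M N"
    have above: "h r x = 0" if "int ?c < r" for r
      by (rule laurentian_extend[OF M_pos h(1) laurentian_const _ x]) (use reg' that in auto)
    have below: "h r x = 0" if "r < int b" for r
      by (rule laurentian_extend[OF M_pos h(1) laurentian_const _ x]) (use reg' that in auto)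
    have "h ?c x * crossing N S (\<lambda>u w. at_slot x w) =
        h b x * (crossing N S (\<lambda>u w. at_slot x u) * (g * (\<Prod>u\<in>S. s (fst u))))"
      by (rule laurentian_extend[OF M_pos _ _ _ x])
         (use reg' h(1) in \<open>auto intro!: laurentian_mult laurentian_crossing laurentian_at_slot laurentian_const\<close>)
    moreover have "((\<lambda>\<xi>. f (scale_slots S \<xi> x) / \<xi> ^ ?c) \<longlongrightarrow> h ?c x) at_infinity"
      unfolding conv_inf
      by (rule laurent_sum_tendsto[where a = "\<lambda>r. h r x" and \<sigma> = 1 and k = "int ?c",
            OF R h(2) eventually_not_equal_at_infinity])
         (use powi_at_infinity above in auto)
    moreover have "((\<lambda>\<xi>. f (scale_slots S \<xi> x) / \<xi> ^ b) \<longlongrightarrow> h b x) (at 0)"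
      unfolding conv_zero
      by (rule laurent_sum_tendsto[where a = "\<lambda>r. h r x" and \<sigma> = "- 1" and k = "int b",
            OF R h(2) eventually_neq_at_within[of 0 0 UNIV]])
         (use powi_at_zero below in auto)
    ultimately show "\<exists>A B g. g \<in> GG \<and>
        ((\<lambda>\<xi>. f (scale_slots S \<xi> x) / \<xi> ^ ?c) \<longlongrightarrow> A) at_infinity \<and>
        ((\<lambda>\<xi>. f (scale_slots S \<xi> x) / \<xi> ^ b) \<longlongrightarrow> B) (at 0) \<and>
        A * crossing N S (\<lambda>u w. at_slot x w) =
          B * crossing N S (\<lambda>u w. at_slot x u) * g * (\<Prod>u\<in>S. s (fst u))"
      using g by (intro exI[of _ "h ?c x"] exI[of _ "h b x"] exI[of _ g]) (simp add: mult.assoc)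
  qed
qed

text \<open>
  The definition of \<open>B_space\<close> scales the first \<open>k i\<close> variables of each color; by symmetry any other choice
  of \<open>k i\<close> variables behaves in the same way.
\<close>

lemma balanced_permute:
  assumes bal: "balanced N f S b" and dep: "depends_on_slots N f" and sym: "sign_symmetric N f"
    and S: "S \<subseteq> slots M N" and \<pi>: "\<And>i. i \<in> {1..M} \<Longrightarrow> \<pi> i permutes {1..N}"
  defines "\<psi> \<equiv> \<lambda>u. (fst u, \<pi> (fst u) (snd u))"
  shows "balanced N f (\<psi> ` S) b"
proof -
  have inj: "inj_on \<psi> (slots M N)"
  proof (rule inj_onI)
    fix u w assume u: "u \<in> slots M N" "w \<in> slots M N" "\<psi> u = \<psi> w"
    then have "fst u \<in> {1..M}" "fst u = fst w" "\<pi> (fst u) (snd u) = \<pi> (fst u) (snd w)"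
      by (auto simp: slots_def \<psi>_def)
    then show "u = w" using permutes_inj[OF \<pi>] by (auto simp: prod_eq_iff dest: injD)
  qed
  have into: "\<psi> ` slots M N \<subseteq> slots M N"
  proof
    fix v assume "v \<in> \<psi> ` slots M N"
    then obtain i a where "i \<in> {1..M}" "a \<in> {1..N}" "v = (i, \<pi> i a)" by (auto simp: slots_def \<psi>_def)
    then show "v \<in> slots M N" using permutes_in_image[OF \<pi>, of i a] by (simp add: slots_def)
  qed
  then have onto: "\<psi> ` slots M N = slots M N"
    using inj by (intro endo_inj_surj) auto
  then have compl: "slots M N - \<psi> ` S = \<psi> ` (slots M N - S)"
    using inj_on_image_set_diff[OF inj Diff_subset S] by simp
  have injs: "inj_on \<psi> S" "inj_on \<psi> (slots M N - S)" using inj S by (auto intro: inj_on_subset)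
  have fst: "fst (\<psi> u) = fst u" for u by (simp add: \<psi>_def)
  have cross: "cross M N (\<psi> ` S) = cross M N S"
    unfolding cross_def compl by (simp add: sum.reindex[OF injs(1)] sum.reindex[OF injs(2)] fst)
  have crossing: "crossing N (\<psi> ` S) \<phi> = crossing N S (\<lambda>u w. \<phi> (\<psi> u) (\<psi> w))" for \<phi>
    unfolding crossing_def compl by (simp add: prod.reindex[OF injs(1)] prod.reindex[OF injs(2)] fst)
  have ss: "(\<Prod>u\<in>\<psi> ` S. s (fst u)) = (\<Prod>u\<in>S. s (fst u))"
    by (simp add: prod.reindex[OF injs(1)] fst)
  obtain e where e: "e \<in> {1, - 1}" "\<And>x. x \<in> torus M N \<Longrightarrow> f (\<lambda>i b. x i (\<pi> i b)) = e * f x"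
    using sign_symmetric_all_colors[OF sym dep, of \<pi>] \<pi> by blast
  show ?thesis
    unfolding balanced_def
  proof
    fix x assume x: "x \<in> torus M N"
    define x' where "x' = (\<lambda>i b. x i (\<pi> i b))"
    have at': "at_slot x' u = at_slot x (\<psi> u)" for u by (simp add: x'_def at_slot_def \<psi>_def)
    have x': "x' \<in> torus M N" unfolding torus_iff at' using x into by (auto simp: torus_iff)
    have fe: "f (scale_slots (\<psi> ` S) \<xi> x) = e * f (scale_slots S \<xi> x')" if "\<xi> \<noteq> 0" for \<xi>
    proof -
      have "f (\<lambda>i b. scale_slots (\<psi> ` S) \<xi> x i (\<pi> i b)) = f (scale_slots S \<xi> x')"
      proof (rule depends_on_slotsD[OF dep])
        fix u assume u: "u \<in> slots M N"
        have "at_slot (\<lambda>i b. scale_slots (\<psi> ` S) \<xi> x i (\<pi> i b)) u = at_slot (scale_slots (\<psi> ` S) \<xi> x) (\<psi> u)"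
          by (simp add: at_slot_def \<psi>_def)
        moreover have "\<psi> u \<in> \<psi> ` S \<longleftrightarrow> u \<in> S" using inj_on_image_mem_iff[OF inj u S] .
        ultimately show "at_slot (\<lambda>i b. scale_slots (\<psi> ` S) \<xi> x i (\<pi> i b)) u = at_slot (scale_slots S \<xi> x') u"
          by (simp add: at_slot_scale at')
      qed
      then have "f (scale_slots S \<xi> x') = e * f (scale_slots (\<psi> ` S) \<xi> x)"
        using e(2)[OF scale_slots_torus[OF x that]] by simp
      then show ?thesis using e(1) by auto
    qed
    obtain A B g where g: "g \<in> GG"
        and inf: "((\<lambda>\<xi>. f (scale_slots S \<xi> x') / \<xi> ^ (b + cross M N S)) \<longlongrightarrow> A) at_infinity"
        and zero: "((\<lambda>\<xi>. f (scale_slots S \<xi> x') / \<xi> ^ b) \<longlongrightarrow> B) (at 0)"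
        and rel: "A * crossing N S (\<lambda>u w. at_slot x' w) =
          B * crossing N S (\<lambda>u w. at_slot x' u) * g * (\<Prod>u\<in>S. s (fst u))"
      using bal x' unfolding balanced_def by blast
    have "((\<lambda>\<xi>. e * (f (scale_slots S \<xi> x') / \<xi> ^ (b + cross M N S))) \<longlongrightarrow> e * A) at_infinity"
      by (intro tendsto_mult tendsto_const inf)
    moreover have "\<forall>\<^sub>F \<xi> in at_infinity. e * (f (scale_slots S \<xi> x') / \<xi> ^ (b + cross M N S))
        = f (scale_slots (\<psi> ` S) \<xi> x) / \<xi> ^ (b + cross M N (\<psi> ` S))"
      using eventually_not_equal_at_infinity[of 0] by eventually_elim (simp add: fe cross)
    ultimately have inf': "((\<lambda>\<xi>. f (scale_slots (\<psi> ` S) \<xi> x) / \<xi> ^ (b + cross M N (\<psi> ` S))) \<longlongrightarrow> e * A) at_infinity"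
      by (rule Lim_transform_eventually)
    have "((\<lambda>\<xi>. e * (f (scale_slots S \<xi> x') / \<xi> ^ b)) \<longlongrightarrow> e * B) (at 0)"
      by (intro tendsto_mult tendsto_const zero)
    moreover have "\<forall>\<^sub>F \<xi> in at 0. e * (f (scale_slots S \<xi> x') / \<xi> ^ b) = f (scale_slots (\<psi> ` S) \<xi> x) / \<xi> ^ b"
      using eventually_neq_at_within[of 0 0 UNIV] by eventually_elim (simp add: fe)
    ultimately have zero': "((\<lambda>\<xi>. f (scale_slots (\<psi> ` S) \<xi> x) / \<xi> ^ b) \<longlongrightarrow> e * B) (at 0)"
      by (rule Lim_transform_eventually)
    have "(e * A) * crossing N (\<psi> ` S) (\<lambda>u w. at_slot x w) =
        (e * B) * crossing N (\<psi> ` S) (\<lambda>u w. at_slot x u) * g * (\<Prod>u\<in>\<psi> ` S. s (fst u))"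
      unfolding crossing ss using rel by (simp add: at' mult.assoc)
    then show "\<exists>A B g. g \<in> GG \<and>
        ((\<lambda>\<xi>. f (scale_slots (\<psi> ` S) \<xi> x) / \<xi> ^ (b + cross M N (\<psi> ` S))) \<longlongrightarrow> A) at_infinity \<and>
        ((\<lambda>\<xi>. f (scale_slots (\<psi> ` S) \<xi> x) / \<xi> ^ b) \<longlongrightarrow> B) (at 0) \<and>
        A * crossing N (\<psi> ` S) (\<lambda>u w. at_slot x w) =
          B * crossing N (\<psi> ` S) (\<lambda>u w. at_slot x u) * g * (\<Prod>u\<in>\<psi> ` S. s (fst u))"
      using g inf' zero' by blast
  qed
qed

lemma numerator_admissible:
  assumes F: "F \<in> B_space q d m n s N" and f: "laurent_polynomial M N f" "F = ratfun M N f"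
    and wheel: "wheel_conditions q d m n N f"
  shows "admissible N f"
proof -
  have dep: "depends_on_slots N f"
    unfolding depends_on_slots_def using laurent_polynomial_depends[OF f(1)] by blast
  have lau: "laurentian f" by (rule laurent_polynomial_laurentian[OF f(1)])
  have symF: "if fermi i then skew_symmetric_in N i F else symmetric_in N i F" if "i \<in> {1..M}" for i
    using F that unfolding B_space_def Sh0_def fermi_def by auto
  have fermi: "f (x(i := x i \<circ> \<pi>)) = of_int (sign \<pi>) * f x"
    if "i \<in> {1..M}" "fermi i" "\<pi> permutes {1..N}" "x \<in> torus M N" for i \<pi> x
    by (rule numerator_permute[OF M_pos lau that(3) _ that(4)])
       (use symF[OF that(1)] that(2,3) in \<open>simp add: skew_symmetric_in_def f(2)\<close>)
  have bose: "f (x(i := x i \<circ> \<pi>)) = 1 * f x"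
    if "i \<in> {1..M}" "\<not> fermi i" "\<pi> permutes {1..N}" "x \<in> torus M N" for i \<pi> x
    by (rule numerator_permute[OF M_pos lau that(3) _ that(4)])
       (use symF[OF that(1)] that(2,3) in \<open>simp add: symmetric_in_def f(2)\<close>)
  have sym: "sign_symmetric N f"
    unfolding sign_symmetric_def
  proof (intro ballI allI impI)
    fix i \<pi> assume i: "i \<in> {1..M}" and \<pi>: "\<pi> permutes {1..N}"
    show "\<exists>e\<in>{1, - 1}. \<forall>x\<in>torus M N. f (x(i := x i \<circ> \<pi>)) = e * f x"
    proof (cases "fermi i")
      case True
      then show ?thesis using fermi[OF i True \<pi>]
        by (intro bexI[of _ "of_int (sign \<pi>)"]) (auto simp: sign_def)
    next
      case False
      then show ?thesis using bose[OF i False \<pi>] by (intro bexI[of _ 1]) auto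
    qed
  qed
  have fv: "fermi_vanishing N f"
    unfolding fermi_vanishing_def
  proof (intro ballI impI)
    fix i x a b assume *: "i \<in> {1..M}" "x \<in> torus M N" "a \<in> {1..N}" "b \<in> {1..N}"
      "fermi i" "a \<noteq> b" "x i a = x i b"
    have "x(i := x i \<circ> transpose a b) = x"
      using *(7) by (auto simp: fun_eq_iff transpose_def)
    then have "f x = - f x"
      using fermi[OF *(1,5) permutes_swap_id[OF *(3,4)] *(2)] *(6) by (simp add: sign_swap_id)
    then show "f x = 0" by simp
  qed
  have "\<exists>b. balanced N f S b" if S: "S \<subseteq> slots M N" for S
  proof -
    define T where "T i = {a. (i, a) \<in> S}" for i
    define k where "k i = card (T i)" for i
    have T: "T i \<subseteq> {1..N}" for i using S by (auto simp: T_def slots_def)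
    then have finT: "finite (T i)" for i using finite_subset by blast
    have kN: "k i \<le> N" for i using card_mono[OF _ T[of i]] by (simp add: k_def)
    have "\<exists>\<pi>. \<pi> permutes {1..N} \<and> \<pi> ` {1..k i} = T i" for i
    proof -
      obtain h where h: "bij_betw h {1..k i} (T i)"
        using ex_bij_betw_nat_finite_1[OF finT[of i]] unfolding k_def by blast
      have "\<exists>\<pi>. \<pi> permutes {1..N} \<and> (\<forall>a\<in>{1..k i}. \<pi> a = h a)"
        by (rule permutes_extending) (use h kN[of i] T[of i] in \<open>auto simp: bij_betw_def\<close>)
      then obtain \<pi> where "\<pi> permutes {1..N}" "\<forall>a\<in>{1..k i}. \<pi> a = h a" by blast
      moreover have "\<pi> ` {1..k i} = h ` {1..k i}" using calculation(2) by (intro image_cong) auto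
      moreover have "h ` {1..k i} = T i" using h by (simp add: bij_betw_def)
      ultimately show ?thesis by (intro exI[of _ \<pi>]) simp
    qed
    then obtain \<pi> where \<pi>: "\<And>i. \<pi> i permutes {1..N}" "\<And>i. \<pi> i ` {1..k i} = T i" by metis
    define S0 where "S0 = (SIGMA i:{1..M}. {1..k i})"
    have S0: "S0 \<subseteq> slots M N" using kN order_trans by (fastforce simp: S0_def slots_def)
    have image: "(\<lambda>u. (fst u, \<pi> (fst u) (snd u))) ` S0 = S"
    proof (intro set_eqI iffI)
      fix v assume "v \<in> (\<lambda>u. (fst u, \<pi> (fst u) (snd u))) ` S0"
      then obtain i a where "i \<in> {1..M}" "a \<in> {1..k i}" "v = (i, \<pi> i a)" by (auto simp: S0_def)
      then show "v \<in> S" using \<pi>(2)[of i] by (auto simp: T_def)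
    next
      fix v assume v: "v \<in> S"
      obtain i c where ic: "v = (i, c)" by (cases v)
      have "i \<in> {1..M}" "c \<in> T i" using v S by (auto simp: ic slots_def T_def)
      then obtain a where "a \<in> {1..k i}" "c = \<pi> i a" using \<pi>(2)[of i] by blast
      then show "v \<in> (\<lambda>u. (fst u, \<pi> (fst u) (snd u))) ` S0"
        using \<open>i \<in> {1..M}\<close> by (intro image_eqI[of _ _ "(i, a)"]) (auto simp: S0_def ic)
    qed
    have bal: "balanced N f S0 (card (inner_arrows M N S0))"
    proof (rule balanced_if_generically_balanced[OF f(1)])
      \<comment> \<open>The sign comes from clearing denominators, the power of \<open>d\<close> from the definition of \<open>B_space\<close>.\<close>
      let ?e = "2 * int N * (int (k m) - int (k (m + n)))"
      let ?g = "(- 1) ^ cross M N S0 * d powi ?e"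
      show "?g \<in> GG" by (intro GG_mult GG_power GG_minus GG_1 GG_powi GG_d)
      fix x assume x: "x \<in> regular_locus M N"
      have "\<exists>F_inf F_zero. \<forall>x\<in>regular_locus M N.
                ((\<lambda>\<xi>. F (scale_point k \<xi> x)) \<longlongrightarrow> F_inf x) at_infinity \<and>
                ((\<lambda>\<xi>. F (scale_point k \<xi> x)) \<longlongrightarrow> F_zero x) (at 0) \<and>
                F_inf x = F_zero x * (\<Prod>i\<in>{1..M}. s i ^ k i) * d powi ?e"
        using F kN unfolding B_space_def by blast
      then obtain Fi Fz where lims: "((\<lambda>\<xi>. F (scale_point k \<xi> x)) \<longlongrightarrow> Fi) at_infinity"
        "((\<lambda>\<xi>. F (scale_point k \<xi> x)) \<longlongrightarrow> Fz) (at 0)"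
        and rel: "Fi = Fz * (\<Prod>i\<in>{1..M}. s i ^ k i) * d powi ?e" using x by blast
      have "F (scale_point k \<xi> x) = ratfun M N f (scale_slots S0 \<xi> x)" for \<xi>
        unfolding f(2)
        by (rule ratfun_depends[OF M_pos f(1)])
           (auto simp: at_slot_def scale_point_def scale_slots_def S0_def slots_def)
      note lims = lims[unfolded this]
      have "(\<Prod>i\<in>{1..M}. s i ^ k i) = (\<Prod>u\<in>S0. s (fst u))"
        unfolding S0_def by (subst prod.Sigma[of "{1..M}" "\<lambda>i. {1..k i}" "\<lambda>i a. s i", simplified case_prod_unfold, symmetric]) auto
      then have rel': "Fi = Fz * (d powi ?e * (\<Prod>u\<in>S0. s (fst u)))" using rel by simp
      show "\<exists>A B. ((\<lambda>\<xi>. f (scale_slots S0 \<xi> x) / \<xi> ^ (card (inner_arrows M N S0) + cross M N S0)) \<longlongrightarrow> A) at_infinity \<and>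
        ((\<lambda>\<xi>. f (scale_slots S0 \<xi> x) / \<xi> ^ card (inner_arrows M N S0)) \<longlongrightarrow> B) (at 0) \<and>
        A * crossing N S0 (\<lambda>u w. at_slot x w) =
          B * crossing N S0 (\<lambda>u w. at_slot x u) * ?g * (\<Prod>u\<in>S0. s (fst u))"
        using ratfun_scale_limits[OF dep S0 x lims rel'] by (simp only: mult.assoc)
    qed
    show ?thesis
      using balanced_permute[where \<pi> = \<pi>, OF bal dep sym S0 \<pi>(1)] unfolding image by blast
  qed
  then show ?thesis using dep lau sym fv wheel unfolding admissible_def by blast
qed

end

section \<open>Linear algebra\<close>

text \<open>
  More unknowns than equations; elimination of one unknown per equation.
\<close>

lemma homogeneous_system_solvable:
  fixes A :: "'b \<Rightarrow> 'p \<Rightarrow> complex"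
  assumes "finite P" "finite B" "card P < card B"
  shows "\<exists>c. (\<exists>v\<in>B. c v \<noteq> 0) \<and> (\<forall>p\<in>P. (\<Sum>v\<in>B. c v * A v p) = 0)"
  using assms
proof (induction P arbitrary: B A rule: finite_induct)
  case empty
  then obtain v where "v \<in> B" by fastforce
  then show ?case by (intro exI[of _ "\<lambda>_. 1"]) auto
next
  case (insert p P)
  show ?case
  proof (cases "\<forall>v\<in>B. A v p = 0")
    case True
    obtain c where "\<exists>v\<in>B. c v \<noteq> 0" "\<forall>p\<in>P. (\<Sum>v\<in>B. c v * A v p) = 0"
      using insert.IH[of B A] insert.prems insert.hyps by auto
    then show ?thesis using True by (intro exI[of _ c]) auto
  next
    case False
    then obtain v0 where v0: "v0 \<in> B" "A v0 p \<noteq> 0" by blast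
    define A' where "A' v r = A v r - A v p / A v0 p * A v0 r" for v r
    have "card P < card (B - {v0})" using insert.prems insert.hyps v0(1) by simp
    then obtain c where c: "\<exists>v\<in>B - {v0}. c v \<noteq> 0" "\<forall>r\<in>P. (\<Sum>v\<in>B - {v0}. c v * A' v r) = 0"
      using insert.IH[of "B - {v0}" A'] insert.prems by auto
    \<comment> \<open>Chosen such that the equation for \<open>p\<close> holds.\<close>
    define c0 where "c0 = - (\<Sum>v\<in>B - {v0}. c v * A v p) / A v0 p"
    define c' where "c' = c(v0 := c0)"
    have sum: "(\<Sum>v\<in>B. c' v * A v r) = (\<Sum>v\<in>B - {v0}. c v * A' v r)" for r
    proof -
      have "(\<Sum>v\<in>B. c' v * A v r) = c0 * A v0 r + (\<Sum>v\<in>B - {v0}. c' v * A v r)"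
        using sum.remove[OF insert.prems(1) v0(1), of "\<lambda>v. c' v * A v r"] by (simp add: c'_def)
      also have "(\<Sum>v\<in>B - {v0}. c' v * A v r) = (\<Sum>v\<in>B - {v0}. c v * A v r)"
        by (intro sum.cong refl) (auto simp: c'_def)
      also have "c0 * A v0 r = - (\<Sum>v\<in>B - {v0}. c v * (A v p / A v0 p * A v0 r))"
        by (simp add: c0_def sum_distrib_left sum_distrib_right sum_divide_distrib mult_ac)
      also have "- (\<Sum>v\<in>B - {v0}. c v * (A v p / A v0 p * A v0 r)) + (\<Sum>v\<in>B - {v0}. c v * A v r)
          = (\<Sum>v\<in>B - {v0}. c v * A' v r)"
        by (simp add: A'_def right_diff_distrib sum_subtractf)
      finally show ?thesis .
    qed
    have "A' v p = 0" for v using v0(2) by (simp add: A'_def)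
    then have "\<forall>r\<in>insert p P. (\<Sum>v\<in>B. c' v * A v r) = 0" using c(2) by (simp add: sum)
    moreover have "\<exists>v\<in>B. c' v \<noteq> 0" using c(1) by (auto simp: c'_def)
    ultimately show ?thesis by blast
  qed
qed

lemma dim_R_comp: "polys.dim (R_comp m n N) = card (monomials ({1..m + n} \<times> {0<..}) N)"
proof -
  let ?Mon = "monomials ({1..m + n} \<times> {0<..}) N"
  let ?e = "\<lambda>t. Poly_Mapping.single t (1 :: complex)"
  have lookup_scale: "Poly_Mapping.lookup (scaleT c p) t = c * Poly_Mapping.lookup p t" for c p t
    by (simp add: scaleT_def map.rep_eq when_def)
  have fin: "finite ?Mon" by (rule finite_monomials[OF order_refl])
  have inj: "inj_on ?e ?Mon"
  proof (rule inj_onI)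
    fix t t' assume "?e t = ?e t'"
    then have "Poly_Mapping.lookup (?e t) t = Poly_Mapping.lookup (?e t') t" by simp
    then show "t = t'" by (auto simp: lookup_single when_def split: if_splits)
  qed
  have sub: "?e ` ?Mon \<subseteq> R_comp m n N"
    by (auto simp: R_comp_def R_ring_def monomials_def)
  have span: "R_comp m n N \<subseteq> polys.span (?e ` ?Mon)"
  proof
    fix p assume p: "p \<in> R_comp m n N"
    have keys: "Poly_Mapping.keys p \<subseteq> ?Mon"
      using p by (auto simp: R_comp_def R_ring_def monomials_def)
    have "p = (\<Sum>t\<in>Poly_Mapping.keys p. scaleT (Poly_Mapping.lookup p t) (?e t))"
      by (rule poly_mapping_eqI)
         (auto simp: lookup_sum lookup_scale lookup_single when_def in_keys_iff
            if_distrib[of "(*) _"] cong: if_cong)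
    also have "\<dots> \<in> polys.span (?e ` ?Mon)"
      using keys by (intro polys.span_sum polys.span_scale polys.span_base) auto
    finally show "p \<in> polys.span (?e ` ?Mon)" .
  qed
  have indep: "polys.independent (?e ` ?Mon)"
  proof
    assume "polys.dependent (?e ` ?Mon)"
    then obtain u where u: "\<exists>v\<in>?e ` ?Mon. u v \<noteq> 0" "(\<Sum>v\<in>?e ` ?Mon. scaleT (u v) v) = 0"
      using polys.dependent_finite[of "?e ` ?Mon"] fin by auto
    then obtain t0 where t0: "t0 \<in> ?Mon" "u (?e t0) \<noteq> 0" by auto
    have "0 = Poly_Mapping.lookup (\<Sum>t\<in>?Mon. scaleT (u (?e t)) (?e t)) t0"
      using u(2) unfolding sum.reindex[OF inj] o_def by simp
    also have "\<dots> = (\<Sum>t\<in>?Mon. if t = t0 then u (?e t) else 0)"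
      by (simp add: lookup_sum lookup_scale lookup_single when_def)
         (intro sum.cong refl, auto)
    also have "\<dots> = u (?e t0)" using t0(1) fin by simp
    finally show False using t0(2) by simp
  qed
  have "card (?e ` ?Mon) = polys.dim (R_comp m n N)"
    by (rule polys.basis_card_eq_dim[OF sub span indep])
  then show ?thesis unfolding card_image[OF inj] by (rule sym)
qed

section \<open>The dimension bound\<close>

lemma laurent_polynomial_combination:
  assumes "laurent_polynomial M N f" "laurent_polynomial M N g"
  shows "laurent_polynomial M N (\<lambda>x. a * f x + b * g x)"
proof -
  obtain E c where E: "finite E" and f: "f = (\<lambda>x. \<Sum>e\<in>E. c e * (\<Prod>i\<in>{1..M}. \<Prod>a\<in>{1..N}. x i a powi e i a))"
    using assms(1) unfolding laurent_polynomial_def by blast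
  obtain E' c' where E': "finite E'" and g: "g = (\<lambda>x. \<Sum>e\<in>E'. c' e * (\<Prod>i\<in>{1..M}. \<Prod>a\<in>{1..N}. x i a powi e i a))"
    using assms(2) unfolding laurent_polynomial_def by blast
  let ?c = "\<lambda>e. a * (if e \<in> E then c e else 0) + b * (if e \<in> E' then c' e else 0)"
  have "(\<lambda>x. a * f x + b * g x) = (\<lambda>x. \<Sum>e\<in>E \<union> E'. ?c e * (\<Prod>i\<in>{1..M}. \<Prod>a\<in>{1..N}. x i a powi e i a))"
  proof
    fix x :: point
    let ?m = "\<lambda>e. \<Prod>i\<in>{1..M}. \<Prod>a\<in>{1..N}. x i a powi e i a"
    have "f x = (\<Sum>e\<in>E \<union> E'. (if e \<in> E then c e else 0) * ?m e)"
      unfolding f using E E' by (intro sum.mono_neutral_cong_left) auto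
    moreover have "g x = (\<Sum>e\<in>E \<union> E'. (if e \<in> E' then c' e else 0) * ?m e)"
      unfolding g using E E' by (intro sum.mono_neutral_cong_left) auto
    ultimately have "a * f x + b * g x =
        (\<Sum>e\<in>E \<union> E'. a * ((if e \<in> E then c e else 0) * ?m e) + b * ((if e \<in> E' then c' e else 0) * ?m e))"
      by (simp only: sum_distrib_left sum.distrib)
    also have "\<dots> = (\<Sum>e\<in>E \<union> E'. ?c e * ?m e)"
      by (intro sum.cong refl) (simp only: distrib_right mult.assoc)
    finally show "a * f x + b * g x = (\<Sum>e\<in>E \<union> E'. ?c e * ?m e)" .
  qed
  moreover have "finite (E \<union> E')" using E E' by simp
  ultimately show ?thesis
    unfolding laurent_polynomial_def by (intro exI[of _ "E \<union> E'"] exI[of _ ?c] conjI)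
qed

lemma Sh0_combination:
  assumes "F \<in> Sh0 q d m n N" "G \<in> Sh0 q d m n N"
  shows "(\<lambda>x. a * F x + b * G x) \<in> Sh0 q d m n N"
proof -
  obtain f where f: "laurent_polynomial (m + n) N f" "F = ratfun (m + n) N f" "wheel_conditions q d m n N f"
    using assms(1) unfolding Sh0_def by blast
  obtain g where g: "laurent_polynomial (m + n) N g" "G = ratfun (m + n) N g" "wheel_conditions q d m n N g"
    using assms(2) unfolding Sh0_def by blast
  have "(\<lambda>x. a * F x + b * G x) = ratfun (m + n) N (\<lambda>x. a * f x + b * g x)"
    unfolding f(2) g(2) by (auto simp: ratfun_def fun_eq_iff add_divide_distrib)
  moreover have "wheel_conditions q d m n N (\<lambda>x. a * f x + b * g x)"
    using f(3) g(3) unfolding wheel_conditions_def by auto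
  moreover have "laurent_polynomial (m + n) N (\<lambda>x. a * f x + b * g x)"
    by (rule laurent_polynomial_combination[OF f(1) g(1)])
  moreover have "if n \<ge> 1 \<and> (i = m \<or> i = m + n) then skew_symmetric_in N i (\<lambda>x. a * F x + b * G x)
      else symmetric_in N i (\<lambda>x. a * F x + b * G x)" if "i \<in> {1..m + n}" for i
  proof (cases "n \<ge> 1 \<and> (i = m \<or> i = m + n)")
    case True
    then have "skew_symmetric_in N i F" "skew_symmetric_in N i G"
      using assms that by (auto simp: Sh0_def)
    then have "skew_symmetric_in N i (\<lambda>x. a * F x + b * G x)"
      unfolding skew_symmetric_in_def by (simp add: algebra_simps)
    then show ?thesis using True by simp
  next
    case False
    then have "symmetric_in N i F" "symmetric_in N i G"
      using assms that by (auto simp: Sh0_def)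
    then have "symmetric_in N i (\<lambda>x. a * F x + b * G x)"
      unfolding symmetric_in_def by simp
    then show ?thesis using False by (simp only: if_False)
  qed
  ultimately show ?thesis unfolding Sh0_def by blast
qed

lemma sum_fun_apply: "(\<Sum>F\<in>T. \<phi> F) x = (\<Sum>F\<in>T. \<phi> F x)"
  for \<phi> :: "'a \<Rightarrow> 'b \<Rightarrow> complex"
  by (induction T rule: infinite_finite_induct) auto

lemma B_space_combination:
  assumes "F \<in> B_space q d m n s N" "G \<in> B_space q d m n s N"
  shows "(\<lambda>x. a * F x + b * G x) \<in> B_space q d m n s N"
proof -
  let ?c = "\<lambda>k. (\<Prod>i\<in>{1..m + n}. s i ^ k i) * d powi (2 * int N * (int (k m) - int (k (m + n))))"
  let ?lim = "\<lambda>F k Fi Fz. \<forall>x\<in>regular_locus (m + n) N.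
     ((\<lambda>\<xi>. F (scale_point k \<xi> x)) \<longlongrightarrow> Fi x) at_infinity \<and>
     ((\<lambda>\<xi>. F (scale_point k \<xi> x)) \<longlongrightarrow> Fz x) (at 0) \<and>
     Fi x = Fz x * (\<Prod>i\<in>{1..m + n}. s i ^ k i) * d powi (2 * int N * (int (k m) - int (k (m + n))))"
  have "\<exists>Fi Fz. ?lim (\<lambda>x. a * F x + b * G x) k Fi Fz" if k: "\<forall>i\<in>{1..m + n}. k i \<le> N" for k
  proof -
    obtain Fi Fz where F: "?lim F k Fi Fz" using assms(1) k unfolding B_space_def by blast
    obtain Gi Gz where G: "?lim G k Gi Gz" using assms(2) k unfolding B_space_def by blast
    have "?lim (\<lambda>x. a * F x + b * G x) k (\<lambda>x. a * Fi x + b * Gi x) (\<lambda>x. a * Fz x + b * Gz x)"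
    proof (intro ballI conjI)
      fix x assume "x \<in> regular_locus (m + n) N"
      note F' = F[rule_format, OF this] and G' = G[rule_format, OF this]
      show "((\<lambda>\<xi>. a * F (scale_point k \<xi> x) + b * G (scale_point k \<xi> x)) \<longlongrightarrow> a * Fi x + b * Gi x) at_infinity"
        "((\<lambda>\<xi>. a * F (scale_point k \<xi> x) + b * G (scale_point k \<xi> x)) \<longlongrightarrow> a * Fz x + b * Gz x) (at 0)"
        using F' G' by (auto intro!: tendsto_add tendsto_mult)
      show "a * Fi x + b * Gi x = (a * Fz x + b * Gz x) * (\<Prod>i\<in>{1..m + n}. s i ^ k i) *
          d powi (2 * int N * (int (k m) - int (k (m + n))))"
        using F' G' by (simp only: distrib_right mult.assoc)
    qed
    then show ?thesis by (intro exI)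
  qed
  moreover have "(\<lambda>x. a * F x + b * G x) \<in> Sh0 q d m n N"
    using assms by (intro Sh0_combination) (auto simp: B_space_def)
  ultimately show ?thesis unfolding B_space_def by blast
qed

lemma zero_in_B_space: "(\<lambda>x. 0) \<in> B_space q d m n s N"
proof -
  have "laurent_polynomial (m + n) N (\<lambda>x. 0)"
    unfolding laurent_polynomial_def by (rule exI[of _ "{}"]) simp
  moreover have "(\<lambda>x. 0) = ratfun (m + n) N (\<lambda>x. 0)" by (simp add: ratfun_def fun_eq_iff)
  moreover have "wheel_conditions q d m n N (\<lambda>x. 0)" by (simp add: wheel_conditions_def)
  ultimately have "(\<lambda>x. 0) \<in> Sh0 q d m n N"
    unfolding Sh0_def skew_symmetric_in_def symmetric_in_def by auto
  then show ?thesis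
    unfolding B_space_def by (auto intro!: exI[of _ "\<lambda>x. 0"])
qed

lemma subspace_B_space: "funs.subspace (B_space q d m n s N)"
proof (rule funs.subspaceI)
  show "0 \<in> B_space q d m n s N" using zero_in_B_space by (simp add: zero_fun_def)
  fix F G assume F: "F \<in> B_space q d m n s N"
  show "scaleF c F \<in> B_space q d m n s N" for c
    using B_space_combination[OF F F, of c 0] by (simp add: scaleF_def)
  assume "G \<in> B_space q d m n s N"
  from B_space_combination[OF F this, of 1 1] show "F + G \<in> B_space q d m n s N"
    by (simp add: plus_fun_def)
qed

context shuffle_parameters
begin

lemma independent_in_B_space_bound:
  assumes P: "finite P" "P \<subseteq> torus M N"
    and det: "\<forall>f. admissible N f \<longrightarrow> (\<forall>p\<in>P. f p = 0) \<longrightarrow> (\<forall>x\<in>torus M N. f x = 0)"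
    and T: "finite T" "T \<subseteq> B_space q d m n s N" "funs.independent T"
  shows "card T \<le> card P"
proof (rule ccontr)
  assume "\<not> card T \<le> card P"
  then have less: "card P < card T" by simp
  have num: "\<exists>f. laurent_polynomial M N f \<and> F = ratfun M N f \<and> wheel_conditions q d m n N f"
    if "F \<in> B_space q d m n s N" for F using that by (auto simp: B_space_def Sh0_def)
  obtain r where r: "\<And>F. F \<in> T \<Longrightarrow> laurent_polynomial M N (r F)" "\<And>F. F \<in> T \<Longrightarrow> F = ratfun M N (r F)"
    using bchoice[of T "\<lambda>F f. laurent_polynomial M N f \<and> F = ratfun M N f"] num T(2) by blast
  obtain c where "(\<exists>F\<in>T. c F \<noteq> 0) \<and> (\<forall>p\<in>P. (\<Sum>F\<in>T. c F * r F p) = 0)"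
    using homogeneous_system_solvable[OF P(1) T(1) less, of r] by (rule exE)
  then have c: "\<exists>F\<in>T. c F \<noteq> 0" "\<forall>p\<in>P. (\<Sum>F\<in>T. c F * r F p) = 0" by simp_all
  define G where "G = (\<Sum>F\<in>T. scaleF (c F) F)"
  have G: "G \<in> B_space q d m n s N"
    unfolding G_def using T(2) by (intro funs.subspace_sum funs.subspace_scale subspace_B_space) auto
  obtain g where g: "laurent_polynomial M N g" "G = ratfun M N g" "wheel_conditions q d m n N g"
    using num[OF G] by blast
  have "g x = (\<Sum>F\<in>T. c F * r F x)" if "x \<in> torus M N" for x
  proof (rule laurentian_extend[OF M_pos laurent_polynomial_laurentian[OF g(1)] _ _ that])
    show "laurentian (\<lambda>x. \<Sum>F\<in>T. c F * r F x)"
      by (intro laurentian_sum laurentian_mult[OF laurentian_const] laurent_polynomial_laurentian[OF r(1)])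
    fix x assume x: "x \<in> regular_locus M N"
    then have dn: "denom M N x \<noteq> 0" by (simp add: regular_locus_def)
    have "G x = (\<Sum>F\<in>T. c F * F x)"
      unfolding G_def by (simp add: sum_fun_apply scaleF_def)
    also have "\<dots> = (\<Sum>F\<in>T. c F * (r F x / denom M N x))"
      by (intro sum.cong refl arg_cong2[where f = "(*)"], subst r(2)) (use x in \<open>auto simp: ratfun_def\<close>)
    also have "\<dots> = (\<Sum>F\<in>T. c F * r F x) / denom M N x" by (simp add: sum_divide_distrib)
    finally show "g x = (\<Sum>F\<in>T. c F * r F x)" using x dn by (simp add: g(2) ratfun_def)
  qed
  then have "g p = 0" if "p \<in> P" for p using c(2) P(2) that by auto
  then have "\<forall>x\<in>torus M N. g x = 0" using det numerator_admissible[OF G g] by simp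
  then have "G = 0" by (auto simp: g(2) ratfun_def regular_locus_def fun_eq_iff)
  then have "funs.dependent T"
    using c(1) unfolding funs.dependent_finite[OF T(1)] G_def by (intro exI[of _ c] conjI)
  with T(3) show False by blast
qed

lemma B_space_dimension:
  "finite_dim (B_space q d m n s N) \<and>
   funs.dim (B_space q d m n s N) \<le> card (monomials ({1..M} \<times> {0<..}) N)"
proof -
  let ?B = "B_space q d m n s N"
  obtain P where P: "finite P" "P \<subseteq> torus M N" "card P \<le> card (monomials ({1..M} \<times> {0<..}) N)"
    and det: "\<forall>f. admissible N f \<longrightarrow> (\<forall>p\<in>P. f p = 0) \<longrightarrow> (\<forall>x\<in>torus M N. f x = 0)"
    using evaluation_points[of N] by (elim exE conjE)
  note bound = independent_in_B_space_bound[OF P(1,2) det]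
  obtain T where T: "T \<subseteq> ?B" "funs.independent T" "?B \<subseteq> funs.span T"
    using funs.maximal_independent_subset[of ?B] by blast
  have fin: "finite T"
  proof (rule ccontr)
    assume "infinite T"
    then obtain T' where T': "T' \<subseteq> T" "finite T'" "card T' = Suc (card P)"
      using infinite_arbitrarily_large by blast
    have "card T' \<le> card P"
      by (intro bound T'(2) subset_trans[OF T'(1) T(1)] funs.independent_mono[OF T(2) T'(1)])
    with T'(3) show False by simp
  qed
  have "card T = funs.dim ?B" by (rule funs.basis_card_eq_dim[OF T(1,3,2)])
  moreover have "card T \<le> card P" by (rule bound[OF fin T(1,2)])
  ultimately show ?thesis using T(3) fin P(3) by (auto simp: finite_dim_def)
qed

end

theorem proposition4p4:
  fixes q d :: complex and m n N :: nat and s :: "nat \<Rightarrow> complex"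
  assumes "q \<noteq> 0" and "d \<noteq> 0"
    and "\<And>n1 n2 n3 :: int.
           q1 q d powi n1 * q2 q powi n2 * q3 q d powi n3 = 1 \<Longrightarrow> n1 = n2 \<and> n2 = n3"
    and "m \<ge> 1" and "m \<noteq> n"
    and "\<And>i. i \<in> {1..m + n} \<Longrightarrow> s i \<noteq> 0"
    and "(\<Prod>i\<in>{1..m + n}. s i) = 1"
    and "generic_params q d (m + n) s"
  shows "finite_dim (B_space q d m n s N) \<and>
         funs.dim (B_space q d m n s N) \<le> polys.dim (R_comp m n N)"
proof -
  interpret shuffle_parameters q d m n s
    by unfold_locales (use assms in auto)
  show ?thesis unfolding dim_R_comp by (rule B_space_dimension)
qed

end
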